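(* Let $K$ be a field with $\operatorname{char}(K)\neq 2,3$ and $\zeta_3\notin K$, where $\zeta_3$ is a primitive cubic root of unity. Let $f(x)=x^6+ax^3+b\in K[x]$ be irreducible over $K$, let $F$ be its splitting field over $K$, put $\Delta=a^2-4b$, $R(x)=x^3-3bx+ab$, and suppose that $\Delta\neq -3n^2$ for every $n\in K$. Let $\alpha,\beta\in F$ be roots of $f$ with $\alpha^3\ne\beta^3$, and write $\sqrt[3]{b}=\alpha\beta$. Then the following are complete lists, without repetition, of the intermediate fields strictly between $K$ and $F$, arranged by degree over $K$; the fields marked (normal) are normal over $K$ and the others are not. (A) Suppose no cubic root of $b$ lies in $K$ and $R(x)$ is reducible over $K$, and $\beta$ is chosen so that $\alpha\beta\in K(\alpha)=K(\beta)$ (such a choice exists). There are $14$ fields: - degree 2: $K(\sqrt\Delta)$, $K(\zeta_3)$, $K(\sqrt{-3\Delta})$ (all normal); - degree 3: $K(\sqrt[3]b)$, $K(\sqrt[3]b\,\zeta_3)$, $K(\sqrt[3]b\,\zeta_3^2)$; - degree 4: $K(\sqrt\Delta,\zeta_3)$ (normal); - degree 6: $K(\zeta_3,\sqrt[3]b)$ (normal); $K(\alpha)$, $K(\alpha\zeta_3)$, $K(\alpha\zeta_3^2)$; $K(\alpha\zeta_3+\beta\zeta_3^2)$, $K(\alpha+\beta\zeta_3)$, $K(\alpha+\beta\zeta_3^2)$. (B) Suppose some cubic root of $b$ lies in $K$ and $R(x)$ is irreducible over $K$, and $\beta$ is chosen so that $\alpha\beta\in K$. There are $14$ fields: - degree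 2: $K(\sqrt\Delta)$, $K(\zeta_3)$, $K(\sqrt{-3\Delta})$ (all normal); - degree 3: $K(\alpha+\beta)$, $K(\alpha\zeta_3+\beta\zeta_3^2)$, $K(\alpha\zeta_3^2+\beta\zeta_3)$; - degree 4: $K(\sqrt\Delta,\zeta_3)$ (normal); - degree 6: $K(\sqrt{-3\Delta},\alpha+\beta)$ (normal); $K(\alpha)$, $K(\alpha\zeta_3)$, $K(\alpha\zeta_3^2)$; $K(\zeta_3,\alpha+\beta)$, $K(\zeta_3,\alpha\zeta_3+\beta\zeta_3^2)$, $K(\zeta_3,\alpha\zeta_3^2+\beta\zeta_3)$. (C) Suppose no cubic root of $b$ lies in $K$ and $R(x)$ is irreducible over $K$. Put $\rho_0=\sqrt[3]b(\alpha+\beta)$, $\rho_1=\sqrt[3]b(\alpha\zeta_3+\beta\zeta_3^2)$, $\rho_2=\sqrt[3]b(\alpha\zeta_3^2+\beta\zeta_3)$. There are $58$ fields: - degree 2: $K(\zeta_3)$, $K(\sqrt{-3\Delta})$, $K(\sqrt\Delta)$ (all normal); - degree 3: $K(\sqrt[3]b\,\zeta_3^i)$ and $K(\rho_i)$ for $i=0,1,2$; - degree 4: $K(\sqrt\Delta,\zeta_3)$ (normal); - degree 6: $K(\zeta_3,\sqrt[3]b)$ and $K(\sqrt{-3\Delta},\rho_0)$ (both normal); and, for $i=0,1,2$: $K(\zeta_3,\rho_i)$, $K(\sqrt{-3\Delta},\sqrt[3]b\,\zeta_3^i)$, $K(\sqrt\Delta,\sqrt[3]b\,\zeta_3^i)$,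 $K(\sqrt\Delta,\rho_i)$, $K(\alpha\zeta_3^i)$, $K(\beta\zeta_3^i)$; - degree 9: $K(\alpha\zeta_3^i+\beta\zeta_3^j)$ for $i,j\in\{0,1,2\}$; - degree 12: $K(\sqrt\Delta,\zeta_3,\sqrt[3]b)$ and $K(\sqrt\Delta,\zeta_3,\rho_0)$ (both normal); $K(\zeta_3,\alpha)$, $K(\zeta_3,\beta)$; - degree 18: $K(\alpha\zeta_3^i,\beta\zeta_3^j)$ for $i,j\in\{0,1,2\}$; $K(\zeta_3,\alpha+\beta\zeta_3^i)$ for $i=0,1,2$; $K(\zeta_3^i(\zeta_3-1)(\alpha-\beta))$ for $i=0,1,2$.
   Context: The roots of $f$ are $\alpha,\alpha\zeta_3,\alpha\zeta_3^2,\beta,\beta\zeta_3,\beta\zeta_3^2$, where $\alpha^3$ and $\beta^3$ are the two roots $\frac{-a\pm\sqrt\Delta}{2}$ of $y^2+ay+b$; so $(\alpha\beta)^3=b$, and replacing $\beta$ by $\beta\zeta_3^i$ changes the chosen cubic root $\sqrt[3]b=\alpha\beta$ of $b$. *)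

theory Defs
  imports "HOL-Computational_Algebra.Computational_Algebra"
begin

text \<open>
  A field extension \<open>F/K\<close> is a homomorphism \<open>h\<close> from the field \<open>K\<close> (the type \<open>'k\<close>) to the field
  \<open>F\<close> (the type \<open>'f\<close>); such a map is injective, and \<open>K\<close> is identified with \<open>range h\<close>.
\<close>

definition field_embedding :: "('k::field \<Rightarrow> 'f::field) \<Rightarrow> bool" where
  "field_embedding h \<longleftrightarrow>
     h 1 = 1 \<and> (\<forall>x y. h (x + y) = h x + h y) \<and> (\<forall>x y. h (x * y) = h x * h y)"

definition is_subfield :: "'f::field set \<Rightarrow> bool" where
  "is_subfield E \<longleftrightarrow>
     0 \<in> E \<and> 1 \<in> E \<and>
     (\<forall>x\<in>E. \<forall>y\<in>E. x - y \<in> E) \<and> (\<forall>x\<in>E. \<forall>y\<in>E. x * y \<in> E) \<and> (\<forall>x\<in>E. inverse x \<in> E)"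

text \<open>\<open>adjoin h S\<close> is \<open>K(S)\<close>.\<close>

definition adjoin :: "('k::field \<Rightarrow> 'f::field) \<Rightarrow> 'f set \<Rightarrow> 'f set" where
  "adjoin h S = is_subfield hull (range h \<union> S)"

definition strictly_intermediate :: "('k::field \<Rightarrow> 'f::field) \<Rightarrow> 'f set \<Rightarrow> bool" where
  "strictly_intermediate h E \<longleftrightarrow> is_subfield E \<and> range h \<subset> E \<and> E \<subset> UNIV"

text \<open>
  The degree \<open>[E : K]\<close>. Since \<open>dim\<close> is \<open>0\<close> for infinite-dimensional spaces, a positive value
  entails finiteness.
\<close>

definition ext_degree :: "('k::field \<Rightarrow> 'f::field) \<Rightarrow> 'f set \<Rightarrow> nat" where
  "ext_degree h E = vector_space.dim (\<lambda>c x. h c * x) E"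

definition splits_in :: "('k::field \<Rightarrow> 'f::field) \<Rightarrow> 'f set \<Rightarrow> 'k poly \<Rightarrow> bool" where
  "splits_in h E p \<longleftrightarrow>
     (\<exists>rs. set rs \<subseteq> E \<and> map_poly h p = smult (h (lead_coeff p)) (\<Prod>r\<leftarrow>rs. [:- r, 1:]))"

definition is_splitting_field :: "('k::field \<Rightarrow> 'f::field) \<Rightarrow> 'k poly \<Rightarrow> bool" where
  "is_splitting_field h p \<longleftrightarrow>
     splits_in h UNIV p \<and> adjoin h {x. poly (map_poly h p) x = 0} = UNIV"

definition normal_over :: "('k::field \<Rightarrow> 'f::field) \<Rightarrow> 'f set \<Rightarrow> bool" where
  "normal_over h E \<longleftrightarrow>
     (\<forall>x\<in>E. \<exists>p. p \<noteq> 0 \<and> poly (map_poly h p) x = 0) \<and>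
     (\<forall>p. irreducible p \<and> (\<exists>x\<in>E. poly (map_poly h p) x = 0) \<longrightarrow> splits_in h E p)"

text \<open>In characteristic other than 3.\<close>

definition primitive_cube_root_of_unity :: "'a::field \<Rightarrow> bool" where
  "primitive_cube_root_of_unity z \<longleftrightarrow> z ^ 3 = 1 \<and> z \<noteq> 1"

text \<open>
  A table has one row \<open>(d, Ns, Us)\<close> per degree \<open>d\<close>, where \<open>Ns\<close> lists the fields that are normal
  over \<open>K\<close> and \<open>Us\<close> those that are not.
\<close>

definition table_fields :: "(nat \<times> 'f set list \<times> 'f set list) list \<Rightarrow> 'f set list" where
  "table_fields T = concat (map (\<lambda>(d, Ns, Us). Ns @ Us) T)"

definition complete_table ::
    "('k::field \<Rightarrow> 'f::field) \<Rightarrow> (nat \<times> 'f set list \<times> 'f set list) list \<Rightarrow> bool" where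
  "complete_table h T \<longleftrightarrow>
     distinct (table_fields T) \<and>
     set (table_fields T) = {E. strictly_intermediate h E} \<and>
     (\<forall>(d, Ns, Us) \<in> set T.
        (\<forall>E \<in> set Ns. ext_degree h E = d \<and> normal_over h E) \<and>
        (\<forall>E \<in> set Us. ext_degree h E = d \<and> \<not> normal_over h E))"

end

theory Submission
  imports Defs
begin

text \<open>
  The field \<open>F\<close> arises from \<open>L = K(\<surd>\<Delta>, \<zeta>)\<close>, which has degree 4, by adjoining the cube roots
  \<open>\<alpha>, \<beta>\<close> of two elements conjugate over \<open>K\<close>. Irreducibility of \<open>f\<close> gives \<open>[L(\<alpha>) : L] = 3\<close>;
  moreover \<open>\<alpha>\<^sup>2\<beta> \<in> L\<close> up to a cube root of unity iff \<open>R\<close> is reducible, \<open>\<alpha>\<beta> \<in> L\<close> iff \<open>b\<close> is a cube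
  in \<open>K\<close>, and otherwise \<open>\<beta> \<notin> L(\<alpha>)\<close>. An automorphism of \<open>F\<close> over \<open>K\<close> is determined by \<open>\<zeta> \<mapsto> \<zeta>\<^sup>\<plusminus>\<^sup>1\<close>
  and by \<open>(\<alpha>, \<beta>) \<mapsto> (\<zeta>\<^sup>i \<alpha>, \<zeta>\<^sup>j \<beta>)\<close> or \<open>(\<zeta>\<^sup>i \<beta>, \<zeta>\<^sup>j \<alpha>)\<close>; the admissible \<open>(i, j)\<close> are those with
  \<open>i = j\<close> in case (A), \<open>i = - j\<close> in case (B), and all of them in case (C). By the Galois correspondence
  the intermediate fields are the fixed fields of the subgroups of a group of order 12, 12 or 36, and
  a field \<open>K(S)\<close> is identified by the stabiliser of \<open>S\<close>. The subgroups of these concrete groups are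
  enumerated by computation.

  No minimal polynomials of the listed generators are needed: since \<open>\<Delta>\<close>, \<open>-3\<close> and \<open>-3\<Delta>\<close> are not squares, \<open>K\<close>
  is infinite, so every intermediate field has a primitive element, and Lagrange interpolation on
  its orbit yields the Galois correspondence and the degrees.
\<close>

subsection \<open>Embeddings and subfields\<close>

text \<open>Everything happens in one tower \<open>K\<close>, \<open>K1\<close> = K(\<delta>),
  \<open>L\<close> = K1(\<open>w\<close>), \<open>M\<close> = L(\<alpha>), F, where \<delta> and
  \<open>w\<close> are square roots of \<Delta> and -3. Each step adjoins a pure square or cube
  root, so elements have unique coordinates; extending a homomorphism and finding the elements it
  fixes both reduce to comparing coordinates. What must be shown at each step is that the radicand
  is not yet a power below. The absence of \<zeta> from K and the condition on \<Delta> handle the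
  two square roots. For \<alpha>, a norm argument moves a supposed cube root from \<open>L\<close>
  to \<open>K1\<close>, where it would be a root of f of degree at most 2 over K. The cubic R enters
  through Cardano's formula: its roots are \<open>\<zeta>^k \<alpha>\<^sup>2\<beta> + \<zeta>^-k
  \<alpha>\<beta>\<^sup>2\<close>, whose summands have product b and cubes with sum -ab. A root in K
  makes the two summands conjugate elements of \<open>K1\<close>, and this ties \<beta> to \<alpha>.
  The condition that b be a cube ties them through \<alpha>\<beta> instead. If neither happens, a
  Kummer argument shows that \<beta> is a new cube root over \<open>M\<close>.\<close>

lemma
  assumes "field_embedding h"
  shows field_embedding_1: "h 1 = 1"
    and field_embedding_add: "h (x + y) = h x + h y"
    and field_embedding_mult: "h (x * y) = h x * h y"
  using assms by (auto simp: field_embedding_def)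

lemma field_embedding_0:
  assumes "field_embedding h" shows "h 0 = 0"
  using field_embedding_add[OF assms, of 0 0] by (metis add.right_neutral add_cancel_left_right)

lemma field_embedding_minus:
  assumes "field_embedding h" shows "h (- x) = - h x"
  using field_embedding_add[OF assms, of x "- x"] field_embedding_0[OF assms]
  by (simp add: eq_neg_iff_add_eq_0 add.commute)

lemma field_embedding_diff:
  assumes "field_embedding h" shows "h (x - y) = h x - h y"
  using field_embedding_add[OF assms, of x "- y"] field_embedding_minus[OF assms] by simp

lemma field_embedding_power:
  assumes "field_embedding h" shows "h (x ^ n) = h x ^ n"
  by (induction n) (simp_all add: field_embedding_1[OF assms] field_embedding_mult[OF assms])

lemma field_embedding_numeral:
  assumes "field_embedding h" shows "h (numeral n) = numeral n"
proof -
  have "h (of_nat m) = of_nat m" for m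
    by (induction m) (simp_all add: field_embedding_0[OF assms] field_embedding_1[OF assms]
        field_embedding_add[OF assms])
  from this[of "numeral n"] show ?thesis by simp
qed

lemma field_embedding_eq_0_iff:
  assumes "field_embedding h" shows "h x = 0 \<longleftrightarrow> x = 0"
proof
  assume "h x = 0"
  then show "x = 0"
    using field_embedding_mult[OF assms, of x "inverse x"] field_embedding_1[OF assms]
    by (cases "x = 0") auto
qed (simp add: field_embedding_0[OF assms])

lemma field_embedding_eq_iff:
  assumes "field_embedding h" shows "h x = h y \<longleftrightarrow> x = y"
  using field_embedding_eq_0_iff[OF assms, of "x - y"] by (simp add: field_embedding_diff[OF assms])

lemma field_embedding_inj: "field_embedding h \<Longrightarrow> inj h"
  by (rule injI) (simp add: field_embedding_eq_iff)

lemma field_embedding_inverse: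
  assumes "field_embedding h" shows "h (inverse x) = inverse (h x)"
proof (cases "x = 0")
  case False
  then have "h x * h (inverse x) = 1"
    by (simp add: field_embedding_1[OF assms] flip: field_embedding_mult[OF assms])
  then show ?thesis by (simp add: inverse_unique)
qed (simp add: field_embedding_0[OF assms])

lemma field_embedding_divide:
  assumes "field_embedding h" shows "h (x / y) = h x / h y"
  by (simp add: divide_inverse field_embedding_mult[OF assms] field_embedding_inverse[OF assms])

lemmas field_embedding_simps = field_embedding_0 field_embedding_1 field_embedding_add
  field_embedding_mult field_embedding_minus field_embedding_diff field_embedding_power
  field_embedding_numeral field_embedding_inverse field_embedding_divide

lemma field_embedding_sum:
  assumes "field_embedding h" shows "h (sum f A) = (\<Sum>x\<in>A. h (f x))"
  by (induction A rule: infinite_finite_induct)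
    (simp_all add: field_embedding_0[OF assms] field_embedding_add[OF assms])

lemma coeff_map_poly_embedding:
  assumes "field_embedding h" shows "coeff (map_poly h p) i = h (coeff p i)"
  by (simp add: coeff_map_poly field_embedding_0[OF assms])

lemma degree_map_poly_embedding:
  assumes "field_embedding h" shows "degree (map_poly h p) = degree p"
  by (cases "p = 0") (simp_all add: map_poly_degree_eq field_embedding_eq_0_iff[OF assms])

lemma map_poly_embedding_eq_0_iff:
  assumes "field_embedding h" shows "map_poly h p = 0 \<longleftrightarrow> p = 0"
  by (simp add: poly_eq_iff coeff_map_poly_embedding[OF assms] field_embedding_eq_0_iff[OF assms])

lemma map_poly_embedding_mult:
  assumes "field_embedding h" shows "map_poly h (p * q) = map_poly h p * map_poly h q"
  by (rule poly_eqI) (simp add: coeff_map_poly_embedding[OF assms] coeff_mult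
      field_embedding_sum[OF assms] field_embedding_mult[OF assms])

lemma map_poly_embedding_add:
  assumes "field_embedding h" shows "map_poly h (p + q) = map_poly h p + map_poly h q"
  by (rule poly_eqI) (simp add: coeff_map_poly_embedding[OF assms] field_embedding_add[OF assms])

lemma map_poly_embedding_pCons:
  assumes "field_embedding h" shows "map_poly h (pCons c p) = pCons (h c) (map_poly h p)"
  by (simp add: map_poly_pCons field_embedding_0[OF assms])

lemma poly_map_poly_embedding:
  assumes "field_embedding h" shows "poly (map_poly h p) (h x) = h (poly p x)"
  by (induction p) (simp_all add: map_poly_embedding_pCons[OF assms] field_embedding_simps[OF assms])

section \<open>Subfields and adjunction\<close>

lemma is_subfield_range:
  assumes "field_embedding h" shows "is_subfield (range h)"
  unfolding is_subfield_def
  by (auto simp flip: field_embedding_simps[OF assms])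

lemma is_subfield_0: "is_subfield E \<Longrightarrow> 0 \<in> E"
  and is_subfield_1: "is_subfield E \<Longrightarrow> 1 \<in> E"
  and is_subfield_diff: "is_subfield E \<Longrightarrow> x \<in> E \<Longrightarrow> y \<in> E \<Longrightarrow> x - y \<in> E"
  and is_subfield_mult: "is_subfield E \<Longrightarrow> x \<in> E \<Longrightarrow> y \<in> E \<Longrightarrow> x * y \<in> E"
  and is_subfield_inverse: "is_subfield E \<Longrightarrow> x \<in> E \<Longrightarrow> inverse x \<in> E"
  by (auto simp: is_subfield_def)

lemma is_subfield_minus: "is_subfield E \<Longrightarrow> x \<in> E \<Longrightarrow> - x \<in> E"
  using is_subfield_diff[of E 0 x] is_subfield_0[of E] by simp

lemma is_subfield_add: "is_subfield E \<Longrightarrow> x \<in> E \<Longrightarrow> y \<in> E \<Longrightarrow> x + y \<in> E"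
  using is_subfield_diff[of E x "- y"] is_subfield_minus[of E y] by simp

lemma is_subfield_divide: "is_subfield E \<Longrightarrow> x \<in> E \<Longrightarrow> y \<in> E \<Longrightarrow> x / y \<in> E"
  by (simp add: divide_inverse is_subfield_mult is_subfield_inverse)

lemma is_subfield_power: "is_subfield E \<Longrightarrow> x \<in> E \<Longrightarrow> x ^ n \<in> E"
  by (induction n) (simp_all add: is_subfield_1 is_subfield_mult)

lemma is_subfield_numeral: "is_subfield E \<Longrightarrow> numeral n \<in> E"
proof -
  assume E: "is_subfield E"
  have "of_nat m \<in> E" for m
    by (induction m) (simp_all add: E is_subfield_0 is_subfield_1 is_subfield_add)
  from this[of "numeral n"] show ?thesis by simp
qed

lemmas is_subfield_intros = is_subfield_0 is_subfield_1 is_subfield_diff is_subfield_mult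
  is_subfield_inverse is_subfield_minus is_subfield_add is_subfield_divide is_subfield_power
  is_subfield_numeral

lemma is_subfield_Inter: "(\<And>E. E \<in> \<E> \<Longrightarrow> is_subfield E) \<Longrightarrow> is_subfield (\<Inter>\<E>)"
  by (simp add: is_subfield_def)

lemma is_subfield_adjoin: "is_subfield (adjoin h S)"
  unfolding adjoin_def by (rule hull_in) (simp add: is_subfield_Inter)

lemma adjoin_base: "h x \<in> adjoin h S" and adjoin_gen: "y \<in> S \<Longrightarrow> y \<in> adjoin h S"
  unfolding adjoin_def by (auto intro: hull_inc)

lemma adjoin_least: "is_subfield E \<Longrightarrow> range h \<subseteq> E \<Longrightarrow> S \<subseteq> E \<Longrightarrow> adjoin h S \<subseteq> E"
  unfolding adjoin_def by (simp add: hull_minimal)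

lemma is_subfield_fixed_points: "field_embedding g \<Longrightarrow> is_subfield {x. g x = x}"
  by (simp add: is_subfield_def field_embedding_simps)

text \<open>The fixed points of \<open>g\<close> form a subfield containing \<open>range h\<close>.
  Hence the stabiliser of an adjoined field can be read off its generators.\<close>

lemma fixes_adjoin_iff:
  assumes "field_embedding g" "\<And>x. g (h x) = h x"
  shows "(\<forall>x\<in>adjoin h S. g x = x) \<longleftrightarrow> (\<forall>x\<in>S. g x = x)"
proof
  assume "\<forall>x\<in>S. g x = x"
  then have "adjoin h S \<subseteq> {x. g x = x}"
    using assms by (intro adjoin_least is_subfield_fixed_points) auto
  then show "\<forall>x\<in>adjoin h S. g x = x" by auto
next
  assume "\<forall>x\<in>adjoin h S. g x = x"
  then show "\<forall>x\<in>S. g x = x" by (meson adjoin_gen)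
qed

lemma poly_linear_product_eq_0_iff:
  fixes rs :: "'a::field list"
  shows "poly (\<Prod>r\<leftarrow>rs. [:- r, 1:]) y = 0 \<longleftrightarrow> y \<in> set rs"
  by (induction rs) auto

subsection \<open>Interpolation\<close>

text \<open>The value at a new point is corrected by a multiple of the polynomial \<open>w\<close>
  vanishing at the old ones. The bound is put on coefficients because
  \<open>degree p < card A\<close> would fail for empty \<open>A\<close>, as
  \<open>degree 0 = 0\<close>.\<close>

lemma interpolation_exists:
  fixes f :: "'a::field \<Rightarrow> 'a"
  assumes "finite A"
  shows "\<exists>p. (\<forall>i\<ge>card A. coeff p i = 0) \<and> (\<forall>y\<in>A. poly p y = f y)"
  using assms
proof (induction A rule: finite_induct)
  case (insert a A)
  then obtain p where p: "\<forall>i\<ge>card A. coeff p i = 0" "\<forall>y\<in>A. poly p y = f y" by auto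
  define w where "w = (\<Prod>y\<in>A. [:- y, 1:])"
  have w: "poly w y = (\<Prod>z\<in>A. y - z)" for y
    by (simp add: w_def poly_prod)
  have "poly w a \<noteq> 0" using insert by (auto simp: w)
  have "degree w = card A"
    unfolding w_def by (subst degree_prod_eq_sum_degree) auto
  define q where "q = p + smult ((f a - poly p a) / poly w a) w"
  have "coeff q i = 0" if "i \<ge> card (insert a A)" for i
    using that insert p(1) \<open>degree w = card A\<close> by (simp add: q_def coeff_eq_0)
  moreover have "poly q y = f y" if "y \<in> A" for y
    using that insert p(2) by (simp add: q_def w prod_zero)
  moreover have "poly q a = f a"
    using \<open>poly w a \<noteq> 0\<close> by (simp add: q_def)
  ultimately show ?case by blast
qed (auto intro: exI[of _ 0])

lemma interpolation_unique:
  fixes p :: "'a::field poly"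
  assumes "finite A" "\<forall>i\<ge>card A. coeff p i = 0" "\<forall>y\<in>A. poly p y = 0"
  shows "p = 0"
proof (rule ccontr)
  assume "p \<noteq> 0"
  have "card A \<le> card {x. poly p x = 0}"
    using assms \<open>p \<noteq> 0\<close> by (intro card_mono poly_roots_finite) auto
  also have "\<dots> \<le> degree p" using \<open>p \<noteq> 0\<close> by (rule card_poly_roots_bound)
  finally show False using assms(2) \<open>p \<noteq> 0\<close> leading_coeff_0_iff by blast
qed

subsection \<open>Galois correspondence for a finite group of automorphisms\<close>

text \<open>Artin's form of a Galois extension: a finite set of embeddings, closed under
  composition, whose fixed field is the base. Finiteness supplies inverses, and the infinite base
  supplies primitive elements.\<close>

locale finite_galois =
  fixes h :: "'k::field \<Rightarrow> 'f::field" and G :: "('f \<Rightarrow> 'f) set"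
  assumes embedding: "field_embedding h"
    and infinite_base: "infinite (UNIV :: 'k set)"
    and finite_G: "finite G"
    and id_in_G: "id \<in> G"
    and comp_in_G: "g \<in> G \<Longrightarrow> g' \<in> G \<Longrightarrow> g \<circ> g' \<in> G"
    and emb_G: "g \<in> G \<Longrightarrow> field_embedding g"
    and fixed_field_G: "{x. \<forall>g\<in>G. g x = x} = range h"
begin

definition stab :: "'f set \<Rightarrow> ('f \<Rightarrow> 'f) set" where
  "stab S = {g \<in> G. \<forall>x\<in>S. g x = x}"

lemma G_base: "g \<in> G \<Longrightarrow> g (h x) = h x"
  using fixed_field_G by auto

lemma stab_adjoin: "stab (adjoin h S) = stab S"
  unfolding stab_def using fixes_adjoin_iff[OF emb_G, of _ h S] G_base by blast

lemma G_inverse: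
  assumes "g \<in> G"
  obtains g' where "g' \<in> G" "g' \<circ> g = id" "g \<circ> g' = id"
proof -
  have inj: "inj g" using assms emb_G field_embedding_inj by blast
  have "inj_on (\<lambda>f. g \<circ> f) G"
    using inj by (auto simp: inj_on_def fun.inj_map_strong fun_eq_iff)
  then have "(\<lambda>f. g \<circ> f) ` G = G"
    using assms comp_in_G finite_G by (intro endo_inj_surj) auto
  then obtain g' where "g' \<in> G" "g \<circ> g' = id" using id_in_G by (metis imageE)
  moreover have "g' \<circ> g = id"
  proof
    fix x
    have "g (g' (g x)) = g x" using \<open>g \<circ> g' = id\<close> by (metis comp_apply id_apply)
    then show "(g' \<circ> g) x = id x" using inj by (simp add: inj_eq)
  qed
  ultimately show ?thesis using that by blast
qed

definition orbit :: "'f \<Rightarrow> 'f set" where "orbit \<theta> = (\<lambda>g. g \<theta>) ` G"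

lemma finite_orbit: "finite (orbit \<theta>)" by (simp add: orbit_def finite_G)

lemma orbit_self: "\<theta> \<in> orbit \<theta>" using id_in_G by (auto simp: orbit_def intro: image_eqI[of _ _ id])

lemma orbit_closed: "g \<in> G \<Longrightarrow> y \<in> orbit \<theta> \<Longrightarrow> g y \<in> orbit \<theta>"
  using comp_in_G unfolding orbit_def by (metis (no_types, lifting) comp_apply imageE image_eqI)

lemma orbit_image: "g \<in> G \<Longrightarrow> g ` orbit \<theta> = orbit \<theta>"
  using field_embedding_inj[OF emb_G, of g] orbit_closed finite_orbit
  by (intro endo_inj_surj) (auto intro: inj_on_subset)

lemma poly_over_base:
  assumes "\<And>g. g \<in> G \<Longrightarrow> map_poly g p = p"
  obtains q where "p = map_poly h q"
proof -
  have "coeff p i \<in> range h" for i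
  proof -
    have "g (coeff p i) = coeff p i" if "g \<in> G" for g
      using assms[OF that] coeff_map_poly_embedding[OF emb_G[OF that], of p i] by simp
    then show ?thesis using fixed_field_G by blast
  qed
  then have *: "h (inv h (coeff p i)) = coeff p i" for i by (simp add: f_inv_into_f)
  have inv0: "inv h 0 = 0"
    using field_embedding_0[OF embedding] field_embedding_inj[OF embedding] by (metis inv_f_f)
  have "p = map_poly h (map_poly (inv h) p)"
    by (rule poly_eqI) (simp add: coeff_map_poly_embedding[OF embedding] coeff_map_poly inv0 *)
  then show ?thesis by (rule that)
qed

lemma poly_conjugate:
  assumes "g \<in> G" shows "poly (map_poly h p) (g x) = g (poly (map_poly h p) x)"
proof -
  have "map_poly g (map_poly h p) = map_poly h p"
    using assms by (intro poly_eqI)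
      (simp add: coeff_map_poly_embedding[OF emb_G] coeff_map_poly_embedding[OF embedding] G_base)
  then show ?thesis using poly_map_poly_embedding[OF emb_G[OF assms], of "map_poly h p" x] by simp
qed

lemma root_orbit:
  assumes "poly (map_poly h p) \<theta> = 0" "y \<in> orbit \<theta>"
  shows "poly (map_poly h p) y = 0"
  using assms poly_conjugate field_embedding_0[OF emb_G] by (auto simp: orbit_def)

text \<open>The assignment \<open>g \<theta> \<mapsto> g x\<close> is well defined on the orbit,
  since two \<open>g\<close> agreeing at \<theta> differ by an element of
  \<open>stab {\<theta>}\<close>, which fixes \<open>x\<close>. The polynomial interpolating it is
  invariant under \<open>G\<close>, so its coefficients lie in the base.\<close>

lemma stab_poly_expression:
  assumes "\<And>g. g \<in> stab {\<theta>} \<Longrightarrow> g x = x"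
  obtains p where "\<forall>i\<ge>card (orbit \<theta>). coeff p i = 0" "poly (map_poly h p) \<theta> = x"
proof -
  have well_defined: "g x = g' x" if "g \<in> G" "g' \<in> G" "g \<theta> = g' \<theta>" for g g'
  proof -
    obtain k where k: "k \<in> G" "k \<circ> g' = id" "g' \<circ> k = id" using G_inverse[OF \<open>g' \<in> G\<close>] .
    have "(k \<circ> g) \<theta> = \<theta>" using k(2) that(3) by (metis comp_apply id_apply)
    then have "(k \<circ> g) x = x"
      using assms[of "k \<circ> g"] k(1) that(1) comp_in_G by (auto simp: stab_def)
    then show ?thesis using k(3) by (metis comp_apply id_apply)
  qed
  define f where "f y = (SOME z. \<exists>g\<in>G. g \<theta> = y \<and> g x = z)" for y
  have f: "f (g \<theta>) = g x" if "g \<in> G" for g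
    unfolding f_def using that well_defined by (intro some_equality) blast+
  obtain p where p: "\<forall>i\<ge>card (orbit \<theta>). coeff p i = 0" "\<forall>y\<in>orbit \<theta>. poly p y = f y"
    using interpolation_exists[OF finite_orbit] by blast
  \<comment> \<open>Applying \<open>g\<close> to the coefficients permutes nodes and values of the
    interpolation problem compatibly, so uniqueness gives the same polynomial.\<close>
  have "map_poly g p = p" if "g \<in> G" for g
  proof -
    have "map_poly g p - p = 0"
    proof (rule interpolation_unique[OF finite_orbit[of \<theta>]])
      show "\<forall>i\<ge>card (orbit \<theta>). coeff (map_poly g p - p) i = 0"
        using p(1) that by (simp add: coeff_map_poly_embedding[OF emb_G] field_embedding_0[OF emb_G])
      show "\<forall>y\<in>orbit \<theta>. poly (map_poly g p - p) y = 0"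
      proof
        fix y assume "y \<in> orbit \<theta>"
        then obtain y' where y': "y' \<in> orbit \<theta>" "y = g y'" using orbit_image[OF \<open>g \<in> G\<close>, of \<theta>] by blast
        obtain k where k: "k \<in> G" "y' = k \<theta>" using y'(1) by (auto simp: orbit_def)
        have "poly (map_poly g p) y = g (f y')"
          using y' p(2) by (simp add: poly_map_poly_embedding[OF emb_G[OF that]])
        also have "\<dots> = f y"
          using f[OF k(1)] f[OF comp_in_G[OF that k(1)]] k(2) y'(2) by simp
        finally show "poly (map_poly g p - p) y = 0" using p(2) \<open>y \<in> orbit \<theta>\<close> by simp
      qed
    qed
    then show ?thesis by simp
  qed
  then obtain q where q: "p = map_poly h q" using poly_over_base by blast
  have "\<forall>i\<ge>card (orbit \<theta>). coeff q i = 0"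
    using p(1) by (simp add: q coeff_map_poly_embedding[OF embedding] field_embedding_eq_0_iff[OF embedding])
  moreover have "poly (map_poly h q) \<theta> = x"
    using p(2) orbit_self f[OF id_in_G] by (simp flip: q)
  ultimately show ?thesis by (rule that)
qed

text \<open>The witness \<open>x\<close> for \<open>A\<close> is perturbed to
  \<open>x + h k * y\<close>. If \<open>g'\<close> fixes \<open>y\<close>, then it lies in
  \<open>A\<close> and moves \<open>x\<close>, hence moves every perturbation; otherwise it fixes
  the perturbation for at most one \<open>k\<close>. An infinite base leaves a good
  \<open>k\<close>.\<close>

lemma separating_element:
  assumes "is_subfield E" "range h \<subseteq> E" "finite A" "A \<subseteq> G" "\<And>g. g \<in> A \<Longrightarrow> \<exists>x\<in>E. g x \<noteq> x"
  shows "\<exists>x\<in>E. \<forall>g\<in>A. g x \<noteq> x"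
  using assms(3-5)
proof (induction A rule: finite_induct)
  case empty
  then show ?case using is_subfield_0[OF assms(1)] by blast
next
  case (insert g A)
  then obtain x where x: "x \<in> E" "\<forall>g\<in>A. g x \<noteq> x" by auto
  obtain y where y: "y \<in> E" "g y \<noteq> y" using insert.prems by auto
  define bad where "bad = (\<Union>g'\<in>insert g A. {k. g' (x + h k * y) = x + h k * y \<and> k \<noteq> 0})"
  have "finite {k. g' (x + h k * y) = x + h k * y \<and> k \<noteq> 0}" (is "finite ?B") if "g' \<in> insert g A" for g'
  proof -
    have g': "g' \<in> G" using that insert.prems by auto
    have eq: "g' x - x = - h k * (g' y - y)" if "k \<in> ?B" for k
      using that by (simp add: field_embedding_simps[OF emb_G[OF g']] G_base[OF g'] algebra_simps)
    have "k = k'" if "k \<in> ?B" "k' \<in> ?B" for k k'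
    proof (cases "g' y = y")
      case True
      then have "g' x = x" using eq[OF that(1)] by simp
      then have "g' = g" using x(2) \<open>g' \<in> insert g A\<close> by auto
      then show ?thesis using True y by simp
    next
      case False
      then have "h k = h k'" using eq[OF that(1)] eq[OF that(2)] by simp
      then show ?thesis by (simp add: field_embedding_eq_iff[OF embedding])
    qed
    then show ?thesis by (metis (no_types, lifting) finite.emptyI finite_insert insertCI subsetI finite_subset)
  qed
  then have "finite (insert 0 bad)" using insert.hyps by (auto simp: bad_def)
  then obtain k where "k \<notin> insert 0 bad" using infinite_base by (meson ex_new_if_finite)
  then have "\<forall>g'\<in>insert g A. g' (x + h k * y) \<noteq> x + h k * y" by (auto simp: bad_def)
  moreover have "x + h k * y \<in> E"
    using x y assms(1,2) by (auto intro!: is_subfield_intros)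
  ultimately show ?case by blast
qed

lemma primitive_element:
  assumes "is_subfield E" "range h \<subseteq> E"
  obtains \<theta> where "\<theta> \<in> E" "stab {\<theta>} = stab E"
proof -
  have "\<exists>x\<in>E. \<forall>g\<in>G - stab E. g x \<noteq> x"
    by (rule separating_element[OF assms]) (use finite_G in \<open>auto simp: stab_def\<close>)
  then obtain \<theta> where "\<theta> \<in> E" "\<forall>g\<in>G - stab E. g \<theta> \<noteq> \<theta>" by blast
  moreover from this have "stab {\<theta>} = stab E" by (auto simp: stab_def)
  ultimately show ?thesis using that by blast
qed

lemma poly_in_subfield:
  assumes "is_subfield E" "range h \<subseteq> E" "\<theta> \<in> E"
  shows "poly (map_poly h p) \<theta> \<in> E"
proof (induction p)
  case (pCons c p)
  then show ?case using assms
    by (auto simp: map_poly_embedding_pCons[OF embedding] intro!: is_subfield_intros)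
qed (simp add: assms is_subfield_0)

text \<open>An element fixed by \<open>stab E\<close> is a polynomial over the base in a primitive
  element of \<open>E\<close>, hence lies in \<open>E\<close>.\<close>

lemma fixed_field_stab:
  assumes "is_subfield E" "range h \<subseteq> E"
  shows "{x. \<forall>g\<in>stab E. g x = x} = E"
proof (intro equalityI subsetI)
  fix x assume "x \<in> {x. \<forall>g\<in>stab E. g x = x}"
  moreover obtain \<theta> where \<theta>: "\<theta> \<in> E" "stab {\<theta>} = stab E" using primitive_element[OF assms] .
  ultimately obtain p where "poly (map_poly h p) \<theta> = x"
    using stab_poly_expression[of \<theta> x] by (metis (mono_tags, lifting) mem_Collect_eq)
  then show "x \<in> E" using poly_in_subfield[OF assms \<theta>(1)] by blast
qed (auto simp: stab_def)

lemma stab_inject: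
  assumes "is_subfield E" "range h \<subseteq> E" "is_subfield E'" "range h \<subseteq> E'" "stab E = stab E'"
  shows "E = E'"
proof -
  have "E = {x. \<forall>g\<in>stab E. g x = x}" by (rule fixed_field_stab[OF assms(1,2), symmetric])
  also have "\<dots> = E'" unfolding assms(5) by (rule fixed_field_stab[OF assms(3,4)])
  finally show ?thesis .
qed

text \<open>Orbit and stabiliser: the fibres of \<open>g \<mapsto> g \<theta>\<close> are the left
  cosets of \<open>stab {\<theta>}\<close>.\<close>

lemma card_orbit: "card (stab {\<theta>}) * card (orbit \<theta>) = card G"
proof -
  have "card {g \<in> G. g \<theta> = y} = card (stab {\<theta>})" if "y \<in> orbit \<theta>" for y
  proof -
    obtain k where k: "k \<in> G" "y = k \<theta>" using \<open>y \<in> orbit \<theta>\<close> by (auto simp: orbit_def)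
    obtain k' where k': "k' \<in> G" "k' \<circ> k = id" "k \<circ> k' = id" using G_inverse[OF k(1)] .
    have inv: "k' (k x) = x" "k (k' x) = x" for x
      using k'(2,3) by (metis comp_apply id_apply)+
    have "bij_betw (\<lambda>g. k \<circ> g) (stab {\<theta>}) {g \<in> G. g \<theta> = y}"
      by (rule bij_betw_byWitness[where f' = "\<lambda>g. k' \<circ> g"])
        (use k k' comp_in_G in \<open>auto simp: stab_def inv fun_eq_iff\<close>)
    then show ?thesis by (simp add: bij_betw_same_card)
  qed
  then have "card (\<Union>y\<in>orbit \<theta>. {g \<in> G. g \<theta> = y}) = (\<Sum>y\<in>orbit \<theta>. card (stab {\<theta>}))"
    using finite_orbit finite_G by (subst card_UN_disjoint) auto
  moreover have "(\<Union>y\<in>orbit \<theta>. {g \<in> G. g \<theta> = y}) = G" by (auto simp: orbit_def)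
  ultimately show ?thesis by (simp add: mult.commute)
qed

text \<open>For a primitive element \<theta>, the powers with exponent below the orbit size form a
  basis. They span by \<open>stab_poly_expression\<close>, and a dependence would be a polynomial of
  degree below the orbit size vanishing on the whole orbit.\<close>

lemma ext_degree_stab:
  assumes "is_subfield E" "range h \<subseteq> E"
  shows "ext_degree h E * card (stab E) = card G"
proof -
  interpret vs: vector_space "\<lambda>c x. h c * x"
    by unfold_locales (simp_all add: field_embedding_simps[OF embedding] algebra_simps)
  obtain \<theta> where \<theta>: "\<theta> \<in> E" "stab {\<theta>} = stab E" using primitive_element[OF assms] .
  define n where "n = card (orbit \<theta>)"
  define B where "B = (\<lambda>i. \<theta> ^ i) ` {..<n}"
  have indep: "\<forall>i<n. u i = 0" if "(\<Sum>i<n. h (u i) * \<theta> ^ i) = 0" for u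
  proof -
    define q where "q = (\<Sum>i<n. monom (u i) i)"
    have coeff_q: "coeff q i = (if i < n then u i else 0)" for i
      by (auto simp: q_def coeff_sum coeff_monom)
    have "poly (map_poly h q) \<theta> = (\<Sum>i<n. h (u i) * \<theta> ^ i)"
      unfolding poly_altdef degree_map_poly_embedding[OF embedding] coeff_map_poly_embedding[OF embedding]
    proof (intro sum.mono_neutral_cong)
      fix i assume "i \<in> {..<n} - {..degree q}"
      then have "u i = 0" using coeff_eq_0[of q i] coeff_q[of i] by auto
      then show "h (u i) * \<theta> ^ i = 0" by (simp add: field_embedding_0[OF embedding])
    qed (auto simp: coeff_q field_embedding_0[OF embedding])
    then have "\<forall>y\<in>orbit \<theta>. poly (map_poly h q) y = 0" using that root_orbit by simp
    then have "map_poly h q = 0"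
      by (intro interpolation_unique[OF finite_orbit])
        (auto simp: coeff_map_poly_embedding[OF embedding] coeff_q field_embedding_0[OF embedding] n_def)
    then have "q = 0" by (simp add: map_poly_embedding_eq_0_iff[OF embedding])
    then show ?thesis using coeff_q by (metis coeff_0)
  qed
  \<comment> \<open>\<open>B\<close> is a set, so its cardinality requires the powers to be
    distinct. A coincidence would be a dependence with coefficients 1 and -1.\<close>
  have inj: "inj_on (\<lambda>i. \<theta> ^ i) {..<n}"
  proof (rule inj_onI, rule ccontr)
    fix i j assume ij: "i \<in> {..<n}" "j \<in> {..<n}" "\<theta> ^ i = \<theta> ^ j" "i \<noteq> j"
    define u where "u = (\<lambda>m. if m = i then 1 else if m = j then - 1 else 0 :: 'k)"
    have "(\<Sum>m<n. h (u m) * \<theta> ^ m) = (\<Sum>m\<in>{i, j}. h (u m) * \<theta> ^ m)"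
      using ij by (intro sum.mono_neutral_right) (auto simp: u_def field_embedding_0[OF embedding])
    also have "\<dots> = 0" using ij by (simp add: u_def field_embedding_simps[OF embedding])
    finally show False using indep[of u] ij by (auto simp: u_def)
  qed
  have "vs.dim E = n"
  proof (rule vs.dim_unique)
    show "B \<subseteq> E" using \<theta>(1) assms(1) by (auto simp: B_def is_subfield_power)
    show "E \<subseteq> vs.span B"
    proof
      fix x assume "x \<in> E"
      then have "g x = x" if "g \<in> stab {\<theta>}" for g using that \<theta>(2) by (auto simp: stab_def)
      then obtain p where p: "\<forall>i\<ge>card (orbit \<theta>). coeff p i = 0" "poly (map_poly h p) \<theta> = x"
        using stab_poly_expression[of \<theta> x] by blast
      have "x = (\<Sum>i\<le>degree p. h (coeff p i) * \<theta> ^ i)"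
        using p(2) by (simp add: poly_altdef degree_map_poly_embedding[OF embedding]
            coeff_map_poly_embedding[OF embedding])
      moreover have "h (coeff p i) * \<theta> ^ i \<in> vs.span B" for i
      proof (cases "i < n")
        case True
        then show ?thesis by (intro vs.span_scale vs.span_base) (auto simp: B_def)
      next
        case False
        then show ?thesis using p(1) by (simp add: n_def field_embedding_0[OF embedding] vs.span_zero)
      qed
      ultimately show "x \<in> vs.span B" by (simp add: vs.span_sum)
    qed
    show "vs.independent B"
    proof (rule ccontr)
      assume "\<not> vs.independent B"
      then obtain u where u: "\<exists>v\<in>B. u v \<noteq> 0" "(\<Sum>v\<in>B. h (u v) * v) = 0"
        by (subst (asm) vs.dependent_finite) (auto simp: B_def)
      have "(\<Sum>i<n. h (u (\<theta> ^ i)) * \<theta> ^ i) = 0"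
        using u(2) inj by (simp add: B_def sum.reindex)
      then show False using indep[of "\<lambda>i. u (\<theta> ^ i)"] u(1) by (auto simp: B_def)
    qed
    show "card B = n" using inj by (simp add: B_def card_image)
  qed
  then show ?thesis
    using card_orbit[of \<theta>] \<theta>(2) by (simp add: ext_degree_def n_def mult.commute)
qed

text \<open>A polynomial over the base vanishing at \<theta> vanishes on the whole orbit, so a
  proper factor of the orbit product has too small a degree to have \<theta> as a root.\<close>

lemma minimal_polynomial:
  obtains p where "irreducible p" "lead_coeff p = 1" "map_poly h p = (\<Prod>y\<in>orbit \<theta>. [:- y, 1:])"
proof -
  define m where "m = (\<Prod>y\<in>orbit \<theta>. [:- y, 1:])"
  have "map_poly g m = m" if "g \<in> G" for g
  proof -
    have "map_poly g (\<Prod>y\<in>A. [:- y, 1:]) = (\<Prod>y\<in>g ` A. [:- y, 1:])" if "finite A" for A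
      using that
    proof (induction A rule: finite_induct)
      case (insert a A)
      have "g a \<notin> g ` A"
        using insert field_embedding_inj[OF emb_G[OF \<open>g \<in> G\<close>]] by (simp add: inj_image_mem_iff)
      then show ?case using insert
        by (simp add: map_poly_embedding_mult[OF emb_G[OF \<open>g \<in> G\<close>]] field_embedding_simps[OF emb_G[OF \<open>g \<in> G\<close>]]
            map_poly_embedding_pCons[OF emb_G[OF \<open>g \<in> G\<close>]] map_poly_1' del: mult_pCons_left)
    qed (simp add: field_embedding_1[OF emb_G[OF \<open>g \<in> G\<close>]])
    then show ?thesis using orbit_image[OF that] finite_orbit by (simp add: m_def)
  qed
  then obtain p where p: "m = map_poly h p" using poly_over_base by blast
  have degm: "degree m = card (orbit \<theta>)" unfolding m_def by (subst degree_prod_eq_sum_degree) auto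
  have pos: "card (orbit \<theta>) > 0" using orbit_self finite_orbit by (auto simp: card_gt_0_iff)
  have root: "poly m y = 0" if "y \<in> orbit \<theta>" for y
    using that finite_orbit by (auto simp: m_def poly_prod intro!: prod_zero)
  have degp: "degree p = card (orbit \<theta>)" using degm by (simp add: p degree_map_poly_embedding[OF embedding])
  have factor: "degree q \<ge> card (orbit \<theta>)" if "poly (map_poly h q) \<theta> = 0" "q \<noteq> 0" for q
  proof (rule ccontr)
    assume "\<not> ?thesis"
    then have "map_poly h q = 0"
      using that root_orbit by (intro interpolation_unique[OF finite_orbit[of \<theta>]])
        (auto simp: coeff_eq_0 degree_map_poly_embedding[OF embedding])
    then show False using that by (simp add: map_poly_embedding_eq_0_iff[OF embedding])
  qed
  have "irreducible p"
  proof (rule irreducibleI)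
    show "p \<noteq> 0" using degp pos by auto
    show "\<not> is_unit p" using degp pos \<open>p \<noteq> 0\<close> by (simp add: is_unit_iff_degree)
    fix u v assume uv: "p = u * v"
    then have "u \<noteq> 0" "v \<noteq> 0" using \<open>p \<noteq> 0\<close> by auto
    then have deg: "degree u + degree v = card (orbit \<theta>)" using uv degp by (simp add: degree_mult_eq)
    have "poly (map_poly h u) \<theta> * poly (map_poly h v) \<theta> = 0"
      using root[OF orbit_self] by (simp add: p uv map_poly_embedding_mult[OF embedding])
    then have "degree v = 0 \<or> degree u = 0"
      using factor[of u] factor[of v] \<open>u \<noteq> 0\<close> \<open>v \<noteq> 0\<close> deg by auto
    then show "is_unit u \<or> is_unit v" using \<open>u \<noteq> 0\<close> \<open>v \<noteq> 0\<close> by (auto simp: is_unit_iff_degree)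
  qed
  moreover have "lead_coeff m = 1" by (simp add: m_def lead_coeff_prod)
  then have "h (lead_coeff p) = h 1"
    by (simp add: p degree_map_poly_embedding[OF embedding] coeff_map_poly_embedding[OF embedding]
        field_embedding_1[OF embedding])
  then have "lead_coeff p = 1" by (simp only: field_embedding_eq_iff[OF embedding])
  ultimately show ?thesis using that p m_def by auto
qed

text \<open>If \<open>E\<close> is normal, the orbit product of each of its elements splits in
  \<open>E\<close>, so the orbit stays in \<open>E\<close>. Conversely, an irreducible polynomial
  with a root in an invariant \<open>E\<close> is a scalar multiple of the orbit product of that
  root.\<close>

lemma normal_over_iff_invariant:
  assumes "is_subfield E" "range h \<subseteq> E"
  shows "normal_over h E \<longleftrightarrow> (\<forall>g\<in>G. g ` E \<subseteq> E)"
proof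
  assume normal: "normal_over h E"
  show "\<forall>g\<in>G. g ` E \<subseteq> E"
  proof (intro ballI subsetI)
    fix g y assume "g \<in> G" "y \<in> g ` E"
    then obtain x where x: "x \<in> E" "y = g x" by blast
    obtain p where p: "irreducible p" "lead_coeff p = 1" "map_poly h p = (\<Prod>y\<in>orbit x. [:- y, 1:])"
      using minimal_polynomial .
    have root: "poly (map_poly h p) z = 0 \<longleftrightarrow> z \<in> orbit x" for z
      using finite_orbit by (auto simp: p(3) poly_prod)
    then have "splits_in h E p" using normal p(1) x(1) orbit_self unfolding normal_over_def by blast
    then obtain rs where rs: "set rs \<subseteq> E" "map_poly h p = (\<Prod>r\<leftarrow>rs. [:- r, 1:])"
      using p(2) by (auto simp: splits_in_def field_embedding_1[OF embedding])
    have "poly (map_poly h p) y = 0" using root x \<open>g \<in> G\<close> by (auto simp: orbit_def)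
    then have "y \<in> set rs" by (simp add: rs(2) poly_linear_product_eq_0_iff)
    then show "y \<in> E" using rs(1) by blast
  qed
next
  assume inv: "\<forall>g\<in>G. g ` E \<subseteq> E"
  show "normal_over h E" unfolding normal_over_def
  proof (intro conjI ballI allI impI)
    fix x
    obtain p where p: "irreducible p" "lead_coeff p = 1" "map_poly h p = (\<Prod>y\<in>orbit x. [:- y, 1:])"
      using minimal_polynomial .
    show "\<exists>p. p \<noteq> 0 \<and> poly (map_poly h p) x = 0"
      using p finite_orbit orbit_self by (intro exI[of _ p]) (auto simp: poly_prod)
  next
    fix p assume "irreducible p \<and> (\<exists>x\<in>E. poly (map_poly h p) x = 0)"
    then obtain x where p: "irreducible p" and x: "x \<in> E" "poly (map_poly h p) x = 0" by blast
    obtain m where m: "irreducible m" "lead_coeff m = 1" "map_poly h m = (\<Prod>y\<in>orbit x. [:- y, 1:])"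
      using minimal_polynomial .
    have deg_m: "degree m = card (orbit x)"
      using degree_map_poly_embedding[OF embedding, of m] by (simp add: m(3) degree_prod_eq_sum_degree)
    \<comment> \<open>The remainder of \<open>p\<close> modulo \<open>m\<close> vanishes on the
      orbit but has degree below its size.\<close>
    have "m dvd p"
    proof -
      have mod: "poly (map_poly h (p mod m)) y = 0" if "y \<in> orbit x" for y
      proof -
        have "poly (map_poly h m) y = 0" using that finite_orbit by (auto simp: m(3) poly_prod)
        moreover have "map_poly h p = map_poly h (p div m) * map_poly h m + map_poly h (p mod m)"
          by (simp flip: map_poly_embedding_mult[OF embedding] map_poly_embedding_add[OF embedding])
        ultimately show ?thesis using root_orbit[OF x(2) that] by simp
      qed
      have "m \<noteq> 0" using m(2) by auto
      have "degree m > 0" using deg_m orbit_self finite_orbit by (auto simp: card_gt_0_iff)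
      have "coeff (p mod m) i = 0" if "i \<ge> card (orbit x)" for i
        using degree_mod_less'[of m p] \<open>m \<noteq> 0\<close> \<open>degree m > 0\<close> that deg_m
        by (cases "p mod m = 0") (auto simp: coeff_eq_0)
      then have "map_poly h (p mod m) = 0"
        using mod by (intro interpolation_unique[OF finite_orbit[of x]])
          (auto simp: coeff_map_poly_embedding[OF embedding] field_embedding_0[OF embedding])
      then show ?thesis by (simp add: map_poly_embedding_eq_0_iff[OF embedding] dvd_eq_mod_eq_0)
    qed
    then obtain c where c: "p = m * c" by blast
    then have "is_unit c" using p m(1) by (auto simp: irreducible_def)
    then obtain c' where "c = [:c':]" by (metis is_unit_polyE)
    then have "p = smult c' m" using c by simp
    then have mp: "map_poly h p = smult (h (lead_coeff p)) (\<Prod>y\<in>orbit x. [:- y, 1:])"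
      using m(2,3) by (simp add: map_poly_smult field_embedding_0[OF embedding] field_embedding_1[OF embedding] field_embedding_mult[OF embedding])
    obtain rs where rs: "set rs = orbit x" "distinct rs" using finite_distinct_list[OF finite_orbit] by blast
    have "(\<Prod>y\<in>orbit x. [:- y, 1:]) = (\<Prod>r\<leftarrow>rs. [:- r, 1:])"
      unfolding rs(1)[symmetric] by (rule prod.distinct_set_conv_list[OF rs(2)])
    moreover have "orbit x \<subseteq> E" using inv x(1) by (auto simp: orbit_def)
    ultimately show "splits_in h E p"
      unfolding splits_in_def using rs mp by (intro exI[of _ rs]) simp
  qed
qed

text \<open>By the Galois correspondence, invariance of \<open>E\<close> is normality of its
  stabiliser. Conjugation is written as \<open>x \<circ> g = g \<circ> y\<close>, free of inverse
  maps, so that it translates directly into codes.\<close>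

lemma normal_over_iff_stab:
  assumes "is_subfield E" "range h \<subseteq> E"
  shows "normal_over h E \<longleftrightarrow> (\<forall>g\<in>G. \<forall>x\<in>stab E. \<exists>y\<in>stab E. x \<circ> g = g \<circ> y)"
  unfolding normal_over_iff_invariant[OF assms]
proof (intro iffI ballI subsetI)
  fix g x assume inv: "\<forall>g\<in>G. g ` E \<subseteq> E" and "g \<in> G" "x \<in> stab E"
  obtain k where k: "k \<in> G" "k \<circ> g = id" "g \<circ> k = id" using G_inverse[OF \<open>g \<in> G\<close>] .
  have "x \<circ> g = g \<circ> (k \<circ> x \<circ> g)" using k(3) by (simp add: fun_eq_iff) 
  moreover have "k \<circ> x \<circ> g \<in> stab E"
  proof -
    have "x (g e) = g e" if "e \<in> E" for e using inv that \<open>g \<in> G\<close> \<open>x \<in> stab E\<close> by (auto simp: stab_def)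
    moreover have "k (g e) = e" for e using k(2) by (metis comp_apply id_apply)
    ultimately show ?thesis using k(1) \<open>g \<in> G\<close> \<open>x \<in> stab E\<close> comp_in_G by (auto simp: stab_def)
  qed
  ultimately show "\<exists>y\<in>stab E. x \<circ> g = g \<circ> y" by blast
next
  fix g y assume *: "\<forall>g\<in>G. \<forall>x\<in>stab E. \<exists>y\<in>stab E. x \<circ> g = g \<circ> y" and "g \<in> G" "y \<in> g ` E"
  then obtain e where e: "e \<in> E" "y = g e" by blast
  have "x y = y" if x: "x \<in> stab E" for x
  proof -
    obtain z where "z \<in> stab E" "x \<circ> g = g \<circ> z" using * \<open>g \<in> G\<close> x by blast
    then have "x (g e) = g (z e)" by (metis comp_apply)
    then show ?thesis using \<open>z \<in> stab E\<close> e by (simp add: stab_def)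
  qed
  then show "y \<in> E" using fixed_field_stab[OF assms] by blast
qed

end

subsection \<open>Adjoining square and cube roots\<close>

text \<open>A partial homomorphism is a total function constrained only on \<open>E\<close>, so it
  can be extended up the tower without changing types.\<close>

definition hom_on :: "'f::field set \<Rightarrow> ('f \<Rightarrow> 'f) \<Rightarrow> bool" where
  "hom_on E \<phi> \<longleftrightarrow> \<phi> 1 = 1 \<and> (\<forall>x\<in>E. \<forall>y\<in>E. \<phi> (x + y) = \<phi> x + \<phi> y \<and> \<phi> (x * y) = \<phi> x * \<phi> y)"

lemma hom_on_UNIV: "hom_on UNIV \<phi> \<longleftrightarrow> field_embedding \<phi>"
  by (auto simp: hom_on_def field_embedding_def)

lemma
  assumes "hom_on E \<phi>" "x \<in> E" "y \<in> E"
  shows hom_on_add: "\<phi> (x + y) = \<phi> x + \<phi> y" and hom_on_mult: "\<phi> (x * y) = \<phi> x * \<phi> y"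
  using assms by (auto simp: hom_on_def)

lemma hom_on_0:
  assumes "hom_on E \<phi>" "is_subfield E" shows "\<phi> 0 = 0"
  using hom_on_add[OF assms(1), of 0 0] is_subfield_0[OF assms(2)]
  by (metis add.right_neutral add_cancel_left_right)

lemma hom_on_1: "hom_on E \<phi> \<Longrightarrow> \<phi> 1 = 1" by (simp add: hom_on_def)

lemma hom_on_power:
  assumes "hom_on E \<phi>" "is_subfield E" "x \<in> E" shows "\<phi> (x ^ n) = \<phi> x ^ n"
  by (induction n) (simp_all add: hom_on_1[OF assms(1)] hom_on_mult[OF assms(1)] assms is_subfield_power)

definition quad_ext :: "'f::field set \<Rightarrow> 'f \<Rightarrow> 'f set" where
  "quad_ext E \<theta> = {u + v * \<theta> | u v. u \<in> E \<and> v \<in> E}"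

definition cubic_ext :: "'f::field set \<Rightarrow> 'f \<Rightarrow> 'f set" where
  "cubic_ext E \<theta> = {u + v * \<theta> + w * \<theta>\<^sup>2 | u v w. u \<in> E \<and> v \<in> E \<and> w \<in> E}"

lemma quad_extI: "u \<in> E \<Longrightarrow> v \<in> E \<Longrightarrow> u + v * \<theta> \<in> quad_ext E \<theta>"
  by (auto simp: quad_ext_def)

lemma cubic_extI: "u \<in> E \<Longrightarrow> v \<in> E \<Longrightarrow> w \<in> E \<Longrightarrow> u + v * \<theta> + w * \<theta>\<^sup>2 \<in> cubic_ext E \<theta>"
  by (auto simp: cubic_ext_def)

lemma
  assumes "is_subfield E"
  shows quad_ext_base: "x \<in> E \<Longrightarrow> x \<in> quad_ext E \<theta>" and quad_ext_gen: "\<theta> \<in> quad_ext E \<theta>"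
    and cubic_ext_base: "x \<in> E \<Longrightarrow> x \<in> cubic_ext E \<theta>" and cubic_ext_gen: "\<theta> \<in> cubic_ext E \<theta>"
  using quad_extI[of x E 0 \<theta>] quad_extI[of 0 E 1 \<theta>] cubic_extI[of x E 0 0 \<theta>] cubic_extI[of 0 E 1 0 \<theta>]
    is_subfield_0[OF assms] is_subfield_1[OF assms] by simp_all

lemma quad_ext_subset: "is_subfield F \<Longrightarrow> E \<subseteq> F \<Longrightarrow> \<theta> \<in> F \<Longrightarrow> quad_ext E \<theta> \<subseteq> F"
  by (auto simp: quad_ext_def intro!: is_subfield_intros)

lemma quad_ext_indep:
  assumes "is_subfield E" "\<theta> \<notin> E" "u \<in> E" "v \<in> E" "u + v * \<theta> = 0"
  shows "u = 0 \<and> v = 0"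
proof (cases "v = 0")
  case False
  then have "\<theta> = - u / v" using assms(5) by (simp add: field_simps eq_neg_iff_add_eq_0)
  then show ?thesis using assms(1-4) by (metis is_subfield_divide is_subfield_minus)
qed (use assms in simp)

lemma quad_ext_eqD:
  assumes "is_subfield E" "\<theta> \<notin> E" "u \<in> E" "v \<in> E" "u' \<in> E" "v' \<in> E" "u + v * \<theta> = u' + v' * \<theta>"
  shows "u = u' \<and> v = v'"
proof -
  have "(u - u') + (v - v') * \<theta> = 0" using assms(7) by (simp add: algebra_simps)
  from quad_ext_indep[OF assms(1,2) _ _ this] show ?thesis
    using assms(1,3-6) by (simp add: is_subfield_diff)
qed

text \<open>A relation with \<open>w \<noteq> 0\<close> reads
  \<open>\<theta>\<^sup>2 = p * \<theta> + q\<close>. Multiplying by \<theta> and comparing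
  coordinates gives \<open>\<theta> ^ 3 = p * q\<close> and \<open>q = - p\<^sup>2\<close>, so
  \<open>- p\<close> would be a cube root of \<open>\<theta> ^ 3\<close> in
  \<open>E\<close>.\<close>

lemma cubic_ext_indep:
  assumes "is_subfield E" "\<theta> ^ 3 \<in> E" "\<And>y. y \<in> E \<Longrightarrow> y ^ 3 \<noteq> \<theta> ^ 3"
    and "u \<in> E" "v \<in> E" "w \<in> E" "u + v * \<theta> + w * \<theta>\<^sup>2 = 0"
  shows "u = 0 \<and> v = 0 \<and> w = 0"
proof -
  have "\<theta> \<notin> E" using assms(3) by blast
  show ?thesis
  proof (cases "w = 0")
    case True
    then show ?thesis using quad_ext_indep[OF assms(1) \<open>\<theta> \<notin> E\<close> assms(4,5)] assms(7) by simp
  next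
    case False
    define p q where "p = - v / w" and "q = - u / w"
    have pq: "p \<in> E" "q \<in> E" using assms(1,4-6) by (auto simp: p_def q_def intro!: is_subfield_intros)
    have sq: "\<theta>\<^sup>2 = p * \<theta> + q"
    proof -
      have "w * \<theta>\<^sup>2 = - v * \<theta> - u" using assms(7) by algebra
      then have "\<theta>\<^sup>2 = (- v * \<theta> - u) / w" using False by (metis nonzero_mult_div_cancel_left)
      then show ?thesis by (simp add: p_def q_def diff_divide_distrib)
    qed
    have "(p * q - \<theta> ^ 3) + (p\<^sup>2 + q) * \<theta> = 0" using sq by algebra
    then have "p * q - \<theta> ^ 3 = 0 \<and> p\<^sup>2 + q = 0"
      using pq assms(1,2) \<open>\<theta> \<notin> E\<close> by (intro quad_ext_indep) (auto intro!: is_subfield_intros)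
    then have "(- p) ^ 3 = \<theta> ^ 3" by algebra
    then show ?thesis using assms(1,3) pq is_subfield_minus by blast
  qed
qed

lemma cubic_ext_eqD:
  assumes "is_subfield E" "\<theta> ^ 3 \<in> E" "\<And>y. y \<in> E \<Longrightarrow> y ^ 3 \<noteq> \<theta> ^ 3"
    and "u \<in> E" "v \<in> E" "w \<in> E" "u' \<in> E" "v' \<in> E" "w' \<in> E"
    and "u + v * \<theta> + w * \<theta>\<^sup>2 = u' + v' * \<theta> + w' * \<theta>\<^sup>2"
  shows "u = u' \<and> v = v' \<and> w = w'"
proof -
  have "(u - u') + (v - v') * \<theta> + (w - w') * \<theta>\<^sup>2 = 0" using assms(10) by (simp add: algebra_simps)
  from cubic_ext_indep[OF assms(1-3) _ _ _ this] show ?thesis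
    using assms(1,4-9) by (simp add: is_subfield_diff)
qed

lemma is_subfield_quad_ext:
  assumes E: "is_subfield E" and "\<theta>\<^sup>2 \<in> E" "\<theta> \<notin> E"
  shows "is_subfield (quad_ext E \<theta>)"
  unfolding is_subfield_def
proof (intro conjI ballI)
  show "0 \<in> quad_ext E \<theta>" "1 \<in> quad_ext E \<theta>"
    using quad_ext_base[OF E] is_subfield_0[OF E] is_subfield_1[OF E] by auto
next
  fix x y assume "x \<in> quad_ext E \<theta>" "y \<in> quad_ext E \<theta>"
  then obtain u v u' v' where *: "u \<in> E" "v \<in> E" "u' \<in> E" "v' \<in> E" "x = u + v * \<theta>" "y = u' + v' * \<theta>"
    by (auto simp: quad_ext_def)
  have diff: "x - y = (u - u') + (v - v') * \<theta>" using * by (simp add: algebra_simps)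
  show "x - y \<in> quad_ext E \<theta>" unfolding diff using * by (intro quad_extI is_subfield_diff[OF E])
  have prod: "x * y = (u * u' + v * v' * \<theta>\<^sup>2) + (u * v' + v * u') * \<theta>" using * by algebra
  show "x * y \<in> quad_ext E \<theta>"
    unfolding prod using * assms by (intro quad_extI is_subfield_add[OF E] is_subfield_mult[OF E])
next
  fix x assume "x \<in> quad_ext E \<theta>"
  then obtain u v where *: "u \<in> E" "v \<in> E" "x = u + v * \<theta>" by (auto simp: quad_ext_def)
  define N where "N = u\<^sup>2 - v\<^sup>2 * \<theta>\<^sup>2"
  have "N \<in> E" using * assms by (auto simp: N_def intro!: is_subfield_intros)
  have N: "N = x * (u + (- v) * \<theta>)" unfolding N_def using * by algebra
  show "inverse x \<in> quad_ext E \<theta>"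
  proof (cases "x = 0")
    case False
    then have "u + (- v) * \<theta> \<noteq> 0"
      using quad_ext_indep[OF E assms(3) *(1) is_subfield_minus[OF E *(2)]] *(3) by auto
    then have "N \<noteq> 0" using False N by simp
    then have "inverse x = (u + (- v) * \<theta>) / N"
      by (intro inverse_unique) (simp only: times_divide_eq_right N[symmetric] divide_self not_False_eq_True)
    then have "inverse x = u / N + (- v / N) * \<theta>" by (simp add: diff_divide_distrib)
    then show ?thesis using * \<open>N \<in> E\<close>
      by (simp only:) (intro quad_extI is_subfield_divide[OF E] is_subfield_minus[OF E])
  qed (use quad_ext_base[OF E is_subfield_0[OF E]] in simp)
qed

lemma is_subfield_cubic_ext:
  assumes E: "is_subfield E" and "\<theta> ^ 3 \<in> E" "\<And>y. y \<in> E \<Longrightarrow> y ^ 3 \<noteq> \<theta> ^ 3"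
  shows "is_subfield (cubic_ext E \<theta>)"
  unfolding is_subfield_def
proof (intro conjI ballI)
  show "0 \<in> cubic_ext E \<theta>" "1 \<in> cubic_ext E \<theta>"
    using cubic_ext_base[OF E] is_subfield_0[OF E] is_subfield_1[OF E] by auto
next
  fix x y assume "x \<in> cubic_ext E \<theta>" "y \<in> cubic_ext E \<theta>"
  then obtain u v w u' v' w' where *: "u \<in> E" "v \<in> E" "w \<in> E" "u' \<in> E" "v' \<in> E" "w' \<in> E"
      "x = u + v * \<theta> + w * \<theta>\<^sup>2" "y = u' + v' * \<theta> + w' * \<theta>\<^sup>2"
    unfolding cubic_ext_def by blast
  have diff: "x - y = (u - u') + (v - v') * \<theta> + (w - w') * \<theta>\<^sup>2" using * by (simp add: algebra_simps)
  show "x - y \<in> cubic_ext E \<theta>" unfolding diff using * by (intro cubic_extI is_subfield_diff[OF E])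
  have prod: "x * y = (u * u' + v * w' * \<theta> ^ 3 + w * v' * \<theta> ^ 3) + (u * v' + v * u' + w * w' * \<theta> ^ 3) * \<theta>
      + (u * w' + v * v' + w * u') * \<theta>\<^sup>2" using * by algebra
  show "x * y \<in> cubic_ext E \<theta>"
    unfolding prod using * assms by (intro cubic_extI is_subfield_add[OF E] is_subfield_mult[OF E])
next
  fix x assume "x \<in> cubic_ext E \<theta>"
  then obtain u v w where *: "u \<in> E" "v \<in> E" "w \<in> E" "x = u + v * \<theta> + w * \<theta>\<^sup>2"
    unfolding cubic_ext_def by blast
  define d where "d = \<theta> ^ 3"
  \<comment> \<open>\<open>N\<close> is the norm of \<open>x\<close> over \<open>E\<close>, and
    \<open>p + q * \<theta> + r * \<theta>\<^sup>2\<close> is the product of its other two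
    conjugates.\<close>
  define N where "N = u ^ 3 + v ^ 3 * d + w ^ 3 * d\<^sup>2 - 3 * u * v * w * d"
  define p q r where "p = u\<^sup>2 - v * w * d" and "q = w\<^sup>2 * d - u * v" and "r = v\<^sup>2 - u * w"
  have "d \<in> E" using assms by (simp add: d_def)
  have mem: "N \<in> E" "p \<in> E" "q \<in> E" "r \<in> E"
    using * \<open>d \<in> E\<close> by (auto simp: N_def p_def q_def r_def intro!: is_subfield_intros[OF E])
  have N: "N = x * (p + q * \<theta> + r * \<theta>\<^sup>2)"
    unfolding N_def p_def q_def r_def d_def using *(4) by algebra
  show "inverse x \<in> cubic_ext E \<theta>"
  proof (cases "x = 0")
    case False
    have "p + q * \<theta> + r * \<theta>\<^sup>2 \<noteq> 0"
    proof
      assume "p + q * \<theta> + r * \<theta>\<^sup>2 = 0"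
      from cubic_ext_indep[OF E assms(2,3) mem(2-4) this] have 0: "p = 0" "q = 0" "r = 0" by auto
      show False
      proof (cases "w = 0")
        case True
        then have "u = 0" "v = 0" using 0 by (auto simp: p_def r_def)
        then show ?thesis using True False * by simp
      next
        case False
        \<comment> \<open>From \<open>w\<^sup>2 * d = u * v\<close> and
          \<open>u * w = v\<^sup>2\<close>; it makes \<open>v / w\<close> a cube root of
          \<open>d\<close> in \<open>E\<close>.\<close>
        have "w\<^sup>2 * d * w = v ^ 3" using 0 unfolding p_def q_def r_def by algebra
        then have "(v / w) ^ 3 = d" using False by (simp add: field_simps power3_eq_cube power2_eq_square)
        then show ?thesis using assms(3)[of "v / w"] * E by (simp add: d_def is_subfield_divide)
      qed
    qed
    then have "N \<noteq> 0" using False N by simp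
    then have "inverse x = (p + q * \<theta> + r * \<theta>\<^sup>2) / N"
      by (intro inverse_unique) (simp flip: N)
    then have "inverse x = p / N + q / N * \<theta> + r / N * \<theta>\<^sup>2" by (simp add: add_divide_distrib)
    then show ?thesis using mem by (simp only:) (intro cubic_extI is_subfield_divide[OF E])
  qed (use cubic_ext_base[OF E is_subfield_0[OF E]] in simp)
qed

text \<open>Uniqueness of coordinates makes
  \<open>u + v * \<theta> \<mapsto> \<phi> u + \<phi> v * \<theta>'\<close> well defined, and
  \<open>\<theta>'\<^sup>2 = \<phi> (\<theta>\<^sup>2)\<close> makes it multiplicative. Either
  square root may serve as \<open>\<theta>'\<close>, which is how conjugations arise.\<close>

lemma hom_extends_quad:
  assumes E: "is_subfield E" and "\<theta>\<^sup>2 \<in> E" "\<theta> \<notin> E" and \<phi>: "hom_on E \<phi>" and "\<theta>'\<^sup>2 = \<phi> (\<theta>\<^sup>2)"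
  obtains \<psi> where "hom_on (quad_ext E \<theta>) \<psi>" "\<And>x. x \<in> E \<Longrightarrow> \<psi> x = \<phi> x" "\<psi> \<theta> = \<theta>'"
proof -
  define \<psi> where "\<psi> x = (THE y. \<exists>u v. u \<in> E \<and> v \<in> E \<and> x = u + v * \<theta> \<and> y = \<phi> u + \<phi> v * \<theta>')" for x
  have \<psi>: "\<psi> (u + v * \<theta>) = \<phi> u + \<phi> v * \<theta>'" if "u \<in> E" "v \<in> E" for u v
    unfolding \<psi>_def by (rule the_equality) (use that quad_ext_eqD[OF E assms(3)] in blast)+
  have base: "\<psi> x = \<phi> x" if "x \<in> E" for x
    using \<psi>[OF that is_subfield_0[OF E]] hom_on_0[OF \<phi> E] by simp
  have "hom_on (quad_ext E \<theta>) \<psi>"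
    unfolding hom_on_def
  proof (intro conjI ballI)
    show "\<psi> 1 = 1" using base[OF is_subfield_1[OF E]] hom_on_1[OF \<phi>] by simp
    fix x y assume "x \<in> quad_ext E \<theta>" "y \<in> quad_ext E \<theta>"
    then obtain u v u' v' where *: "u \<in> E" "v \<in> E" "u' \<in> E" "v' \<in> E" "x = u + v * \<theta>" "y = u' + v' * \<theta>"
      by (auto simp: quad_ext_def)
    have \<psi>xy: "\<psi> x = \<phi> u + \<phi> v * \<theta>'" "\<psi> y = \<phi> u' + \<phi> v' * \<theta>'"
      using * \<psi> by simp_all
    have "x + y = (u + u') + (v + v') * \<theta>" using * by (simp add: algebra_simps)
    then have "\<psi> (x + y) = \<phi> (u + u') + \<phi> (v + v') * \<theta>'"
      using * by (simp only: \<psi> is_subfield_add[OF E])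
    also have "\<dots> = \<psi> x + \<psi> y" unfolding \<psi>xy using * by (simp add: hom_on_add[OF \<phi>] algebra_simps)
    finally show "\<psi> (x + y) = \<psi> x + \<psi> y" .
    have "x * y = (u * u' + v * v' * \<theta>\<^sup>2) + (u * v' + v * u') * \<theta>" using * by algebra
    then have "\<psi> (x * y) = \<phi> (u * u' + v * v' * \<theta>\<^sup>2) + \<phi> (u * v' + v * u') * \<theta>'"
      using * assms(2) by (simp only: \<psi> is_subfield_add[OF E] is_subfield_mult[OF E])
    also have "\<dots> = \<phi> u * \<phi> u' + \<phi> v * \<phi> v' * \<theta>'\<^sup>2 + (\<phi> u * \<phi> v' + \<phi> v * \<phi> u') * \<theta>'"
      using * assms(2,5) by (simp add: hom_on_add[OF \<phi>] hom_on_mult[OF \<phi>] is_subfield_mult[OF E])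
    also have "\<dots> = \<psi> x * \<psi> y" unfolding \<psi>xy by algebra
    finally show "\<psi> (x * y) = \<psi> x * \<psi> y" .
  qed
  moreover have "\<psi> \<theta> = \<theta>'"
    using \<psi>[OF is_subfield_0[OF E] is_subfield_1[OF E]] hom_on_0[OF \<phi> E] hom_on_1[OF \<phi>] by simp
  ultimately show ?thesis using that base by blast
qed

lemma hom_extends_cubic:
  assumes E: "is_subfield E" and "\<theta> ^ 3 \<in> E" "\<And>y. y \<in> E \<Longrightarrow> y ^ 3 \<noteq> \<theta> ^ 3"
    and \<phi>: "hom_on E \<phi>" and "\<theta>' ^ 3 = \<phi> (\<theta> ^ 3)"
  obtains \<psi> where "hom_on (cubic_ext E \<theta>) \<psi>" "\<And>x. x \<in> E \<Longrightarrow> \<psi> x = \<phi> x" "\<psi> \<theta> = \<theta>'"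
proof -
  define \<psi> where "\<psi> x = (THE y. \<exists>u v w. u \<in> E \<and> v \<in> E \<and> w \<in> E \<and> x = u + v * \<theta> + w * \<theta>\<^sup>2 \<and>
      y = \<phi> u + \<phi> v * \<theta>' + \<phi> w * \<theta>'\<^sup>2)" for x
  have \<psi>: "\<psi> (u + v * \<theta> + w * \<theta>\<^sup>2) = \<phi> u + \<phi> v * \<theta>' + \<phi> w * \<theta>'\<^sup>2"
    if "u \<in> E" "v \<in> E" "w \<in> E" for u v w
    unfolding \<psi>_def
  proof (rule the_equality)
    fix y assume "\<exists>u' v' w'. u' \<in> E \<and> v' \<in> E \<and> w' \<in> E \<and>
      u + v * \<theta> + w * \<theta>\<^sup>2 = u' + v' * \<theta> + w' * \<theta>\<^sup>2 \<and> y = \<phi> u' + \<phi> v' * \<theta>' + \<phi> w' * \<theta>'\<^sup>2"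
    then show "y = \<phi> u + \<phi> v * \<theta>' + \<phi> w * \<theta>'\<^sup>2"
      using cubic_ext_eqD[OF E assms(2,3) that] by blast
  qed (use that in blast)
  have base: "\<psi> x = \<phi> x" if "x \<in> E" for x
    using \<psi>[OF that is_subfield_0[OF E] is_subfield_0[OF E]] hom_on_0[OF \<phi> E] by simp
  have "hom_on (cubic_ext E \<theta>) \<psi>"
    unfolding hom_on_def
  proof (intro conjI ballI)
    show "\<psi> 1 = 1" using base[OF is_subfield_1[OF E]] hom_on_1[OF \<phi>] by simp
    fix x y assume "x \<in> cubic_ext E \<theta>" "y \<in> cubic_ext E \<theta>"
    then obtain u v w u' v' w' where *: "u \<in> E" "v \<in> E" "w \<in> E" "u' \<in> E" "v' \<in> E" "w' \<in> E"
        "x = u + v * \<theta> + w * \<theta>\<^sup>2" "y = u' + v' * \<theta> + w' * \<theta>\<^sup>2"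
      unfolding cubic_ext_def by blast
    have \<psi>xy: "\<psi> x = \<phi> u + \<phi> v * \<theta>' + \<phi> w * \<theta>'\<^sup>2"
        "\<psi> y = \<phi> u' + \<phi> v' * \<theta>' + \<phi> w' * \<theta>'\<^sup>2"
      using * \<psi> by simp_all
    have "x + y = (u + u') + (v + v') * \<theta> + (w + w') * \<theta>\<^sup>2" using * by (simp add: algebra_simps)
    then have "\<psi> (x + y) = \<phi> (u + u') + \<phi> (v + v') * \<theta>' + \<phi> (w + w') * \<theta>'\<^sup>2"
      using * by (simp only: \<psi> is_subfield_add[OF E])
    also have "\<dots> = \<psi> x + \<psi> y" unfolding \<psi>xy using * by (simp add: hom_on_add[OF \<phi>] algebra_simps)
    finally show "\<psi> (x + y) = \<psi> x + \<psi> y" .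
    define d where "d = \<theta> ^ 3"
    have "d \<in> E" "\<theta>' ^ 3 = \<phi> d" using assms(2,5) by (auto simp: d_def)
    have "x * y = (u * u' + v * w' * d + w * v' * d) + (u * v' + v * u' + w * w' * d) * \<theta>
      + (u * w' + v * v' + w * u') * \<theta>\<^sup>2" unfolding d_def using * by algebra
    then have "\<psi> (x * y) = \<phi> (u * u' + v * w' * d + w * v' * d)
      + \<phi> (u * v' + v * u' + w * w' * d) * \<theta>' + \<phi> (u * w' + v * v' + w * u') * \<theta>'\<^sup>2"
      using * \<open>d \<in> E\<close> by (simp only: \<psi> is_subfield_add[OF E] is_subfield_mult[OF E])
    also have "\<dots> = (\<phi> u * \<phi> u' + \<phi> v * \<phi> w' * \<theta>' ^ 3 + \<phi> w * \<phi> v' * \<theta>' ^ 3)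
      + (\<phi> u * \<phi> v' + \<phi> v * \<phi> u' + \<phi> w * \<phi> w' * \<theta>' ^ 3) * \<theta>'
      + (\<phi> u * \<phi> w' + \<phi> v * \<phi> v' + \<phi> w * \<phi> u') * \<theta>'\<^sup>2"
      using * \<open>d \<in> E\<close>
      by (simp add: hom_on_add[OF \<phi>] hom_on_mult[OF \<phi>] is_subfield_mult[OF E] is_subfield_add[OF E]
          \<open>\<theta>' ^ 3 = \<phi> d\<close>)
    also have "\<dots> = (\<phi> u + \<phi> v * \<theta>' + \<phi> w * \<theta>'\<^sup>2) * (\<phi> u' + \<phi> v' * \<theta>' + \<phi> w' * \<theta>'\<^sup>2)" by algebra
    also have "\<dots> = \<psi> x * \<psi> y" unfolding \<psi>xy ..
    finally show "\<psi> (x * y) = \<psi> x * \<psi> y" .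
  qed
  moreover have "\<psi> \<theta> = \<theta>'"
    using \<psi>[OF is_subfield_0[OF E] is_subfield_1[OF E] is_subfield_0[OF E]] hom_on_0[OF \<phi> E] hom_on_1[OF \<phi>]
    by simp
  ultimately show ?thesis using that base by blast
qed

lemma fixed_in_quad_ext:
  assumes E: "is_subfield E" and "\<theta> \<notin> E" "(2::'f::field) \<noteq> 0"
    and x: "x \<in> quad_ext E \<theta>" and g: "field_embedding g" "\<And>y. y \<in> E \<Longrightarrow> g y = y" "g \<theta> = - \<theta>" "g x = x"
  shows "(x :: 'f) \<in> E"
proof -
  obtain u v where *: "u \<in> E" "v \<in> E" "x = u + v * \<theta>" using x by (auto simp: quad_ext_def)
  then have "g x = u + (- v) * \<theta>" using g(2,3) by (simp add: field_embedding_simps[OF g(1)])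
  then have "v = - v"
    using quad_ext_eqD[OF E assms(2) *(1,2) *(1) is_subfield_minus[OF E *(2)]] g(4) *(3) by simp
  then have "2 * v = 0" by (metis add.right_inverse mult_2)
  then show ?thesis using * assms(3) by simp
qed

text \<open>\<open>g\<close> multiplies the coordinates at \<theta> and
  \<open>\<theta>\<^sup>2\<close> by \<omega> and \<open>\<omega>\<^sup>2\<close>, neither of which
  is 1, so both coordinates of a fixed element vanish.\<close>

lemma fixed_in_cubic_ext:
  assumes E: "is_subfield E" and "\<theta> ^ 3 \<in> E" "\<And>y. y \<in> E \<Longrightarrow> y ^ 3 \<noteq> \<theta> ^ 3"
    and "\<omega> \<in> E" "\<omega> \<noteq> 1" "\<omega>\<^sup>2 \<noteq> 1" and x: "x \<in> cubic_ext E \<theta>"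
    and g: "field_embedding g" "\<And>y. y \<in> E \<Longrightarrow> g y = y" "g \<theta> = \<omega> * \<theta>" "g x = x"
  shows "x \<in> E"
proof -
  obtain u v w where *: "u \<in> E" "v \<in> E" "w \<in> E" "x = u + v * \<theta> + w * \<theta>\<^sup>2"
    using x unfolding cubic_ext_def by blast
  have "g x = u + (\<omega> * v) * \<theta> + (\<omega>\<^sup>2 * w) * \<theta>\<^sup>2"
    using * g(2,3) by (simp add: field_embedding_simps[OF g(1)] power_mult_distrib mult_ac)
  then have eq: "u + v * \<theta> + w * \<theta>\<^sup>2 = u + (\<omega> * v) * \<theta> + (\<omega>\<^sup>2 * w) * \<theta>\<^sup>2"
    using g(4) *(4) by simp
  have mem: "\<omega> * v \<in> E" "\<omega>\<^sup>2 * w \<in> E" using * assms(4) by (auto intro!: is_subfield_intros[OF E])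
  have "v = \<omega> * v" "w = \<omega>\<^sup>2 * w"
    using cubic_ext_eqD[OF E assms(2,3) *(1-3) *(1) mem eq] by auto
  then have "v = 0" "w = 0" using assms(5,6) mult_cancel_right1 by metis+
  then show ?thesis using * by simp
qed

text \<open>The norm \<open>N\<close> of a cube root of \<open>e \<in> E\<close> is a cube root of \<open>e\<^sup>2\<close>, so \<open>e / N\<close> is one of \<open>e\<close>.\<close>

lemma cube_root_in_quad_ext:
  assumes E: "is_subfield E" and "\<theta>\<^sup>2 \<in> E" "\<theta> \<notin> E" and "e \<in> E" "x \<in> quad_ext E \<theta>" "x ^ 3 = e"
  shows "\<exists>y\<in>E. y ^ 3 = e"
proof (cases "e = 0")
  case True
  then show ?thesis using is_subfield_0[OF E] by (intro bexI[of _ 0]) auto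
next
  case False
  obtain u v where *: "u \<in> E" "v \<in> E" "x = u + v * \<theta>" using assms(5) by (auto simp: quad_ext_def)
  have "(u ^ 3 + 3 * u * v\<^sup>2 * \<theta>\<^sup>2) + (3 * u\<^sup>2 * v + v ^ 3 * \<theta>\<^sup>2) * \<theta> = e + 0 * \<theta>"
    using *(3) assms(6) by algebra
  then have "u ^ 3 + 3 * u * v\<^sup>2 * \<theta>\<^sup>2 = e \<and> 3 * u\<^sup>2 * v + v ^ 3 * \<theta>\<^sup>2 = 0"
    using * assms by (intro quad_ext_eqD[OF E]) (auto intro!: is_subfield_intros[OF E])
  moreover have "(u\<^sup>2 - v\<^sup>2 * \<theta>\<^sup>2) ^ 3 =
      (u ^ 3 + 3 * u * v\<^sup>2 * \<theta>\<^sup>2)\<^sup>2 - \<theta>\<^sup>2 * (3 * u\<^sup>2 * v + v ^ 3 * \<theta>\<^sup>2)\<^sup>2"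
    by algebra
  ultimately have N: "(u\<^sup>2 - v\<^sup>2 * \<theta>\<^sup>2) ^ 3 = e\<^sup>2" by simp
  have "(e / (u\<^sup>2 - v\<^sup>2 * \<theta>\<^sup>2)) ^ 3 = e"
    unfolding power_divide N using False by (simp add: power3_eq_cube power2_eq_square)
  moreover have "e / (u\<^sup>2 - v\<^sup>2 * \<theta>\<^sup>2) \<in> E" using * assms by (auto intro!: is_subfield_intros[OF E])
  ultimately show ?thesis by blast
qed

subsection \<open>Enumerating the subgroups of a finite group given by a multiplication\<close>

text \<open>
  The enumeration decides for each element whether it belongs to the subgroup, which contains \<open>S\<close>
  and is disjoint from \<open>N\<close>. It is complete whatever \<open>grow\<close> returns between its argument \<open>S\<close>
  and the generated subgroup, so \<open>fuel\<close> may bound the number of rounds arbitrarily.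
\<close>

fun grow :: "('g \<Rightarrow> 'g \<Rightarrow> 'g) \<Rightarrow> 'g list \<Rightarrow> 'g list \<Rightarrow> 'g list \<Rightarrow> 'g list \<Rightarrow> 'g list" where
  "grow m [] gens pending S = S"
| "grow m (_ # fuel) gens [] S = S"
| "grow m (_ # fuel) gens (x # pending) S =
     (let new = remdups (filter (\<lambda>y. y \<notin> set S) (map (m x) gens))
      in grow m fuel gens (pending @ new) (new @ S))"

fun subgroups_from :: "('g \<Rightarrow> 'g \<Rightarrow> 'g) \<Rightarrow> 'g list \<Rightarrow> 'g list \<Rightarrow> 'g list \<Rightarrow> 'g list \<Rightarrow> 'g list \<Rightarrow> 'g list list" where
  "subgroups_from m fuel [] gens S N = [S]"
| "subgroups_from m fuel (g # rest) gens S N =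
     (if g \<in> set S then subgroups_from m fuel rest gens S N
      else subgroups_from m fuel rest gens S (g # N) @
        (let S' = grow m fuel (g # gens) (g # S) (g # S)
         in if list_ex (\<lambda>x. x \<in> set N) S' then [] else subgroups_from m fuel rest (g # gens) S' N))"

lemma grow_subset:
  assumes "\<And>x y. x \<in> H \<Longrightarrow> y \<in> H \<Longrightarrow> m x y \<in> H" "set gens \<subseteq> H" "set pending \<subseteq> H" "set S \<subseteq> H"
  shows "set (grow m fuel gens pending S) \<subseteq> H"
  using assms
  by (induction m fuel gens pending S rule: grow.induct) (auto simp: Let_def)

lemma grow_superset: "set S \<subseteq> set (grow m fuel gens pending S)"
  by (induction m fuel gens pending S rule: grow.induct) (auto simp: Let_def)

text \<open>At each undecided element the recursion is followed into the branch that
  \<open>H\<close> dictates. Along this path \<open>S\<close> stays inside \<open>H\<close> and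
  \<open>N\<close> outside, so the pruning test never discards it.\<close>

lemma subgroups_from_complete:
  assumes "\<And>x y. x \<in> H \<Longrightarrow> y \<in> H \<Longrightarrow> m x y \<in> H"
    and "set gens \<subseteq> H" "set S \<subseteq> H" "set N \<inter> H = {}" "H \<subseteq> set S \<union> set N \<union> set rest"
  shows "\<exists>T\<in>set (subgroups_from m fuel rest gens S N). set T = H"
  using assms(2-5)
proof (induction rest arbitrary: gens S N)
  case (Cons g rest)
  consider "g \<in> set S" | "g \<notin> H" "g \<notin> set S" | "g \<in> H" "g \<notin> set S" using Cons.prems by blast
  then show ?case
  proof cases
    case 1
    then have "H \<subseteq> set S \<union> set N \<union> set rest" using Cons.prems(4) by auto
    then show ?thesis using Cons.IH[of gens S N] Cons.prems 1 by simp
  next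
    case 2
    then show ?thesis using Cons.IH[of gens S "g # N"] Cons.prems by auto
  next
    case 3
    define S' where "S' = grow m fuel (g # gens) (g # S) (g # S)"
    have "set S' \<subseteq> H" unfolding S'_def
      using assms(1) 3 Cons.prems by (intro grow_subset) auto
    moreover have "set (g # S) \<subseteq> set S'" unfolding S'_def by (rule grow_superset)
    ultimately have "\<exists>T\<in>set (subgroups_from m fuel rest (g # gens) S' N). set T = H"
      using Cons.prems 3 by (intro Cons.IH) auto
    moreover have "\<not> list_ex (\<lambda>x. x \<in> set N) S'"
      using \<open>set S' \<subseteq> H\<close> Cons.prems(3) by (auto simp: list_ex_iff)
    ultimately show ?thesis using 3 by (auto simp: Let_def simp flip: S'_def)
  qed
qed auto

subsection \<open>Codes for automorphisms\<close>

text \<open>Integers modulo 3 as a datatype: group computations run by evaluation, and identities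
  between exponents are settled by case distinction.\<close>

datatype z3 = Z0 | Z1 | Z2

fun add3 :: "z3 \<Rightarrow> z3 \<Rightarrow> z3" where
  "add3 Z0 y = y"
| "add3 Z1 Z0 = Z1" | "add3 Z1 Z1 = Z2" | "add3 Z1 Z2 = Z0"
| "add3 Z2 Z0 = Z2" | "add3 Z2 Z1 = Z0" | "add3 Z2 Z2 = Z1"

fun neg3 :: "z3 \<Rightarrow> z3" where
  "neg3 Z0 = Z0" | "neg3 Z1 = Z2" | "neg3 Z2 = Z1"

text \<open>\<open>sgn3 d m\<close> is the exponent of the image of \<open>\<zeta>^m\<close> under
  an automorphism with flag \<open>d\<close>.\<close>

fun sgn3 :: "bool \<Rightarrow> z3 \<Rightarrow> z3" where
  "sgn3 False m = m" | "sgn3 True m = neg3 m"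

fun exp3 :: "z3 \<Rightarrow> nat" where
  "exp3 Z0 = 0" | "exp3 Z1 = 1" | "exp3 Z2 = 2"

text \<open>
  \<open>Aut i j e d\<close> stands for the automorphism with \<open>\<zeta> \<mapsto> \<zeta>\<close> or \<open>\<zeta>\<^sup>2\<close> according to \<open>d\<close> and
  \<open>(\<alpha>, \<beta>) \<mapsto> (\<zeta>\<^sup>i \<alpha>, \<zeta>\<^sup>j \<beta>)\<close> or \<open>(\<zeta>\<^sup>i \<beta>, \<zeta>\<^sup>j \<alpha>)\<close> according to \<open>e\<close>.
\<close>

datatype aut = Aut z3 z3 bool bool

text \<open>Composition with the left factor applied last. The left factor acts on the roots of
  unity of the right one through \<open>sgn3 d\<close>, and contributes \<open>j\<close> in place of
  \<open>i\<close> when the right one exchanges \<alpha> and \<beta>.\<close>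

fun mul_aut :: "aut \<Rightarrow> aut \<Rightarrow> aut" where
  "mul_aut (Aut i j e d) (Aut i' j' e' d') =
     Aut (add3 (sgn3 d i') (if e' then j else i)) (add3 (sgn3 d j') (if e' then i else j))
       (e \<noteq> e') (d \<noteq> d')"

abbreviation one_aut :: aut where "one_aut \<equiv> Aut Z0 Z0 False False"

fun inv_aut :: "aut \<Rightarrow> aut" where
  "inv_aut (Aut i j e d) =
     Aut (neg3 (sgn3 d (if e then j else i))) (neg3 (sgn3 d (if e then i else j))) e d"

text \<open>
  The generators occurring in the tables: \<open>GS, GT, GZ\<close> are \<open>s, t, \<zeta>\<close>; \<open>GC m\<close> is \<open>\<alpha>\<beta>\<zeta>\<^sup>m\<close>;
  \<open>GA m\<close> and \<open>GB m\<close> are \<open>\<alpha>\<zeta>\<^sup>m\<close> and \<open>\<beta>\<zeta>\<^sup>m\<close>; \<open>GSum m n\<close> is \<open>\<alpha>\<zeta>\<^sup>m + \<beta>\<zeta>\<^sup>n\<close>; \<open>GR m\<close> is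
  \<open>\<alpha>\<beta>(\<alpha>\<zeta>\<^sup>m + \<beta>\<zeta>\<^sup>-\<^sup>m)\<close>; and \<open>GD m\<close> is \<open>\<zeta>\<^sup>m(\<zeta> - 1)(\<alpha> - \<beta>)\<close>.
\<close>

datatype gen = GS | GT | GZ | GC z3 | GA z3 | GB z3 | GSum z3 z3 | GR z3 | GD z3

text \<open>Each equation compares exponents of \<zeta> in a generator and its image. For
  \<open>GR m\<close> one equation is enough: the two summands acquire the exponents
  \<open>\<plusminus>m + 2i + j\<close> and \<open>\<mp>m + i + 2j\<close>, which are negatives of
  each other modulo 3. For \<open>GD m\<close> with \<open>d\<close> set,
  \<open>\<zeta>\<^sup>2 - 1 = - \<zeta>\<^sup>2(\<zeta> - 1)\<close> brings in a sign that only an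
  exchange of \<alpha> and \<beta> can cancel, whence \<open>e = d\<close>.\<close>

fun fixes_gen :: "aut \<Rightarrow> gen \<Rightarrow> bool" where
  "fixes_gen (Aut i j e d) GS = (\<not> e)"
| "fixes_gen (Aut i j e d) GT = (e = d)"
| "fixes_gen (Aut i j e d) GZ = (\<not> d)"
| "fixes_gen (Aut i j e d) (GC m) = (add3 (sgn3 d m) (add3 i j) = m)"
| "fixes_gen (Aut i j e d) (GA m) = (\<not> e \<and> add3 (sgn3 d m) i = m)"
| "fixes_gen (Aut i j e d) (GB m) = (\<not> e \<and> add3 (sgn3 d m) j = m)"
| "fixes_gen (Aut i j e d) (GSum m n) =
     (add3 (sgn3 d m) i = (if e then n else m) \<and> add3 (sgn3 d n) j = (if e then m else n))"
| "fixes_gen (Aut i j e d) (GR m) =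
     (add3 (sgn3 d m) (add3 (add3 i j) i) = (if e then neg3 m else m))"
| "fixes_gen (Aut i j e d) (GD m) =
     (e = d \<and> i = j \<and> add3 (sgn3 d m) i = (if e then add3 m Z1 else m))"

text \<open>Filtering preserves the order of \<Gamma>, so subgroups in this form are equal as sets
  exactly when they are equal as lists.\<close>

definition stab_aut :: "aut list \<Rightarrow> gen list \<Rightarrow> aut list" where
  "stab_aut \<Gamma> gs = filter (\<lambda>g. list_all (fixes_gen g) gs) \<Gamma>"

definition normal_aut :: "aut list \<Rightarrow> aut list \<Rightarrow> bool" where
  "normal_aut \<Gamma> H = list_all (\<lambda>g. list_all (\<lambda>x. mul_aut (inv_aut g) (mul_aut x g) \<in> set H) H) \<Gamma>"

section \<open>Tables of generators and their computable checks\<close>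

type_synonym gen_table = "(nat \<times> gen list list \<times> gen list list) list"

definition table_gens :: "gen_table \<Rightarrow> gen list list" where
  "table_gens T = concat (map (\<lambda>(d, Ns, Us). Ns @ Us) T)"

text \<open>The whole and the trivial group are included because they belong to K and F;
  distinctness from them makes the listed fields strictly intermediate.\<close>

definition check_distinct :: "aut list \<Rightarrow> gen_table \<Rightarrow> bool" where
  "check_distinct \<Gamma> T = distinct (\<Gamma> # [one_aut] # map (stab_aut \<Gamma>) (table_gens T))"

text \<open>The enumerated lists come in arbitrary order and are first brought into the filtered
  form of \<open>stab_aut\<close>.\<close>

definition check_complete :: "aut list \<Rightarrow> gen_table \<Rightarrow> bool" where
  "check_complete \<Gamma> T =
     (let Hs = \<Gamma> # [one_aut] # map (stab_aut \<Gamma>) (table_gens T)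
      in list_all (\<lambda>S. filter (\<lambda>g. g \<in> set S) \<Gamma> \<in> set Hs) (subgroups_from mul_aut \<Gamma> \<Gamma> [] [one_aut] []))"

definition check_rows :: "aut list \<Rightarrow> gen_table \<Rightarrow> bool" where
  "check_rows \<Gamma> T = list_all (\<lambda>(d, Ns, Us).
     list_all (\<lambda>gs. d * length (stab_aut \<Gamma> gs) = length \<Gamma> \<and> normal_aut \<Gamma> (stab_aut \<Gamma> gs)) Ns \<and>
     list_all (\<lambda>gs. d * length (stab_aut \<Gamma> gs) = length \<Gamma> \<and> \<not> normal_aut \<Gamma> (stab_aut \<Gamma> gs)) Us) T"

definition auts_A :: "aut list" where
  "auts_A = [Aut i i e d. i \<leftarrow> [Z0, Z1, Z2], e \<leftarrow> [False, True], d \<leftarrow> [False, True]]"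

definition auts_B :: "aut list" where
  "auts_B = [Aut i (neg3 i) e d. i \<leftarrow> [Z0, Z1, Z2], e \<leftarrow> [False, True], d \<leftarrow> [False, True]]"

definition auts_C :: "aut list" where
  "auts_C = [Aut i j e d. i \<leftarrow> [Z0, Z1, Z2], j \<leftarrow> [Z0, Z1, Z2], e \<leftarrow> [False, True], d \<leftarrow> [False, True]]"

definition table_A :: gen_table where
  "table_A =
    [(2, [[GS], [GZ], [GT]], []),
     (3, [], [[GC Z0], [GC Z1], [GC Z2]]),
     (4, [[GS, GZ]], []),
     (6, [[GZ, GC Z0]], [[GA Z0], [GA Z1], [GA Z2], [GSum Z1 Z2], [GSum Z0 Z1], [GSum Z0 Z2]])]"

definition table_B :: gen_table where
  "table_B =
    [(2, [[GS], [GZ], [GT]], []),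
     (3, [], [[GSum Z0 Z0], [GSum Z1 Z2], [GSum Z2 Z1]]),
     (4, [[GS, GZ]], []),
     (6, [[GT, GSum Z0 Z0]],
         [[GA Z0], [GA Z1], [GA Z2], [GZ, GSum Z0 Z0], [GZ, GSum Z1 Z2], [GZ, GSum Z2 Z1]])]"

definition table_C :: gen_table where
  "table_C =
    [(2, [[GZ], [GT], [GS]], []),
     (3, [], [[GC Z0], [GC Z1], [GC Z2], [GR Z0], [GR Z1], [GR Z2]]),
     (4, [[GS, GZ]], []),
     (6, [[GZ, GC Z0], [GT, GR Z0]],
         [[GZ, GR Z0], [GZ, GR Z1], [GZ, GR Z2], [GT, GC Z0], [GT, GC Z1], [GT, GC Z2],
          [GS, GC Z0], [GS, GC Z1], [GS, GC Z2], [GS, GR Z0], [GS, GR Z1], [GS, GR Z2],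
          [GA Z0], [GA Z1], [GA Z2], [GB Z0], [GB Z1], [GB Z2]]),
     (9, [], [[GSum m n]. m \<leftarrow> [Z0, Z1, Z2], n \<leftarrow> [Z0, Z1, Z2]]),
     (12, [[GS, GZ, GC Z0], [GS, GZ, GR Z0]], [[GZ, GA Z0], [GZ, GB Z0]]),
     (18, [], [[GA m, GB n]. m \<leftarrow> [Z0, Z1, Z2], n \<leftarrow> [Z0, Z1, Z2]] @
         [[GZ, GSum Z0 Z0], [GZ, GSum Z0 Z1], [GZ, GSum Z0 Z2], [GD Z0], [GD Z1], [GD Z2]])]"

lemma checks_A: "check_distinct auts_A table_A" "check_complete auts_A table_A" "check_rows auts_A table_A"
  by code_simp+

lemma checks_B: "check_distinct auts_B table_B" "check_complete auts_B table_B" "check_rows auts_B table_B"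
  by code_simp+

lemma checks_C: "check_distinct auts_C table_C" "check_complete auts_C table_C" "check_rows auts_C table_C"
  by code_simp+

section \<open>From codes to fields\<close>

definition check_group :: "aut list \<Rightarrow> bool" where
  "check_group \<Gamma> \<longleftrightarrow> distinct \<Gamma> \<and> one_aut \<in> set \<Gamma> \<and>
     list_all (\<lambda>g. inv_aut g \<in> set \<Gamma> \<and> list_all (\<lambda>g'. mul_aut g g' \<in> set \<Gamma>) \<Gamma>) \<Gamma>"

lemma mul_aut_inv: "mul_aut g (inv_aut g) = one_aut" "mul_aut (inv_aut g) g = one_aut"
proof -
  obtain i j e d where g: "g = Aut i j e d" by (cases g)
  show "mul_aut g (inv_aut g) = one_aut" "mul_aut (inv_aut g) g = one_aut"
    unfolding g by (cases i; cases j; cases e; cases d; simp)+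
qed

lemma filter_eq_iff_set: "filter P xs = filter Q xs \<longleftrightarrow> set (filter P xs) = set (filter Q xs)"
proof
  assume "set (filter P xs) = set (filter Q xs)"
  then show "filter P xs = filter Q xs" by (intro filter_cong) auto
qed simp

text \<open>Here \<psi> identifies the codes with a finite automorphism group whose fixed field is
  the base, so the Galois correspondence turns the three checks into the clauses of
  \<open>complete_table\<close>. The equivalence \<open>gens\<close> is asked only of generators in
  the table, because it can fail for others: in case (A) with a = 0 the sum \<alpha> + \<beta> is 0
  and has a larger stabiliser than \<open>fixes_gen\<close> predicts.\<close>

lemma complete_table_from_codes:
  fixes h :: "'k::field \<Rightarrow> 'f::field"
  assumes emb_h: "field_embedding h" and inf: "infinite (UNIV :: 'k set)"
    and group: "check_group \<Gamma>"
    and emb: "\<And>g. g \<in> set \<Gamma> \<Longrightarrow> field_embedding (\<psi> g)"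
    and mul: "\<And>g g'. g \<in> set \<Gamma> \<Longrightarrow> g' \<in> set \<Gamma> \<Longrightarrow> \<psi> (mul_aut g g') = \<psi> g \<circ> \<psi> g'"
    and one: "\<psi> one_aut = id"
    and inj: "inj_on \<psi> (set \<Gamma>)"
    and fixed: "{x. \<forall>g\<in>set \<Gamma>. \<psi> g x = x} = range h"
    and gens: "\<And>gs x g. gs \<in> set (table_gens T) \<Longrightarrow> x \<in> set gs \<Longrightarrow> g \<in> set \<Gamma> \<Longrightarrow>
      \<psi> g (ev x) = ev x \<longleftrightarrow> fixes_gen g x"
    and checks: "check_distinct \<Gamma> T" "check_complete \<Gamma> T" "check_rows \<Gamma> T"
  defines "fld \<equiv> \<lambda>gs. adjoin h (ev ` set gs)"
  shows "complete_table h (map (\<lambda>(d, Ns, Us). (d, map fld Ns, map fld Us)) T)" (is "complete_table h ?T")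
    and "card {E. strictly_intermediate h E} = length (table_gens T)"
proof -
  define G where "G = \<psi> ` set \<Gamma>"
  have group': "distinct \<Gamma>" "one_aut \<in> set \<Gamma>" "\<And>g. g \<in> set \<Gamma> \<Longrightarrow> inv_aut g \<in> set \<Gamma>"
    "\<And>g g'. g \<in> set \<Gamma> \<Longrightarrow> g' \<in> set \<Gamma> \<Longrightarrow> mul_aut g g' \<in> set \<Gamma>"
    using group by (auto simp: check_group_def list_all_iff)
  interpret finite_galois h G
  proof
    show "id \<in> G" using one group'(2) by (auto simp: G_def intro: image_eqI[of _ _ one_aut])
    show "g \<circ> g' \<in> G" if "g \<in> G" "g' \<in> G" for g g'
      using that group'(4) by (auto simp: G_def simp flip: mul)
    show "{x. \<forall>g\<in>G. g x = x} = range h" using fixed by (simp add: G_def)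
  qed (use emb_h inf emb in \<open>auto simp: G_def\<close>)
  have inj_sets: "A = B" if "\<psi> ` A = \<psi> ` B" "A \<subseteq> set \<Gamma>" "B \<subseteq> set \<Gamma>" for A B
    using that inj by (simp add: inj_on_image_eq_iff)
  have sub: "set (stab_aut \<Gamma> gs) \<subseteq> set \<Gamma>" for gs by (auto simp: stab_aut_def)
  have fld: "is_subfield (fld gs)" "range h \<subseteq> fld gs" for gs
    unfolding fld_def by (auto simp: is_subfield_adjoin adjoin_base)
  have stab_fld: "stab (fld gs) = \<psi> ` set (stab_aut \<Gamma> gs)" if "gs \<in> set (table_gens T)" for gs
  proof -
    have "stab (fld gs) = stab (ev ` set gs)" unfolding fld_def by (rule stab_adjoin)
    then show ?thesis using gens[OF that] unfolding stab_def
      by (auto simp: G_def stab_aut_def list_all_iff)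
  qed
  have stab_UNIV: "stab UNIV = \<psi> ` {one_aut}"
    using id_in_G by (auto simp: stab_def one fun_eq_iff)
  have stab_range: "stab (range h) = \<psi> ` set \<Gamma>" using G_base unfolding stab_def by (auto simp: G_def)
  \<comment> \<open>The trivial subgroup is put into filtered form so that
    \<open>filter_eq_iff_set\<close> applies to it.\<close>
  have single: "[one_aut] = filter (\<lambda>g. g = one_aut) \<Gamma>"
  proof -
    have "filter (\<lambda>g. g = one_aut) xs = [one_aut]" if "distinct xs" "one_aut \<in> set xs" for xs
      using that by (induction xs) (auto simp: filter_empty_conv)
    then show ?thesis using group'(1,2) by simp
  qed
  have dist: "distinct (map (stab_aut \<Gamma>) (table_gens T))" "\<Gamma> \<notin> stab_aut \<Gamma> ` set (table_gens T)"
    "[one_aut] \<notin> stab_aut \<Gamma> ` set (table_gens T)"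
    using checks(1) by (auto simp: check_distinct_def)
  have strict: "strictly_intermediate h (fld gs)" if gs: "gs \<in> set (table_gens T)" for gs
  proof -
    have "fld gs \<noteq> range h"
    proof
      assume "fld gs = range h"
      then have "set (stab_aut \<Gamma> gs) = set \<Gamma>"
        using stab_fld[OF gs] stab_range by (intro inj_sets) (auto simp: sub)
      then have "\<forall>x\<in>set \<Gamma>. list_all (fixes_gen x) gs" unfolding stab_aut_def set_filter by blast
      then have "stab_aut \<Gamma> gs = \<Gamma>" unfolding stab_aut_def by (simp add: filter_id_conv)
      then show False using dist(2) gs by force
    qed
    moreover have "fld gs \<noteq> UNIV"
    proof
      assume "fld gs = UNIV"
      then have "set (stab_aut \<Gamma> gs) = set [one_aut]"
        using stab_fld[OF gs] stab_UNIV group'(2) by (intro inj_sets) (auto simp: sub)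
      then have "stab_aut \<Gamma> gs = [one_aut]"
        unfolding stab_aut_def single filter_eq_iff_set by simp
      then show False using dist(3) gs by force
    qed
    ultimately show ?thesis using fld by (auto simp: strictly_intermediate_def)
  qed
  have complete: "E \<in> fld ` set (table_gens T)" if E: "strictly_intermediate h E" for E
  proof -
    have E': "is_subfield E" "range h \<subseteq> E" "E \<noteq> range h" "E \<noteq> UNIV"
      using E by (auto simp: strictly_intermediate_def)
    define H where "H = {g \<in> set \<Gamma>. \<psi> g \<in> stab E}"
    have "stab E \<subseteq> \<psi> ` set \<Gamma>" unfolding stab_def by (auto simp: G_def)
    then have stab_E: "stab E = \<psi> ` H" unfolding H_def by blast
    have "mul_aut x y \<in> H" if "x \<in> H" "y \<in> H" for x y
      using that group'(4) comp_in_G by (auto simp: H_def mul stab_def)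
    moreover have "one_aut \<in> H" using group'(2) id_in_G by (simp add: H_def one stab_def)
    ultimately obtain S where S: "S \<in> set (subgroups_from mul_aut \<Gamma> \<Gamma> [] [one_aut] [])" "set S = H"
      using subgroups_from_complete[of H mul_aut "[]" "[one_aut]" "[]" \<Gamma> \<Gamma>] by (auto simp: H_def)
    have set_filter: "set (filter (\<lambda>g. g \<in> H) \<Gamma>) = H" by (auto simp: H_def)
    have "filter (\<lambda>g. g \<in> H) \<Gamma> \<in> set (\<Gamma> # [one_aut] # map (stab_aut \<Gamma>) (table_gens T))"
      using checks(2) S by (auto simp: check_complete_def Let_def list_all_iff)
    then consider "filter (\<lambda>g. g \<in> H) \<Gamma> = \<Gamma>" | "filter (\<lambda>g. g \<in> H) \<Gamma> = [one_aut]"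
      | gs where "gs \<in> set (table_gens T)" "filter (\<lambda>g. g \<in> H) \<Gamma> = stab_aut \<Gamma> gs" by auto
    then show ?thesis
    proof cases
      case 1
      then have "stab E = stab (range h)" using stab_E stab_range set_filter by simp
      then show ?thesis
        using stab_inject[OF E'(1,2) is_subfield_range[OF emb_h]] E'(3) by simp
    next
      case 2
      then have "stab E = stab UNIV" using stab_E stab_UNIV set_filter by (metis empty_set list.simps(15))
      moreover have "is_subfield (UNIV :: 'f set)" by (simp add: is_subfield_def)
      ultimately show ?thesis using stab_inject[OF E'(1,2), of UNIV] E'(4) by simp
    next
      case 3
      then have "stab E = stab (fld gs)" using stab_E stab_fld set_filter by metis
      then have "E = fld gs" using stab_inject[OF E'(1,2) fld] by simp
      then show ?thesis using 3(1) by blast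
    qed
  qed
  have fields: "table_fields ?T = map fld (table_gens T)"
    by (induction T) (auto simp: table_fields_def table_gens_def)
  have "inj_on fld (set (table_gens T))"
  proof (rule inj_onI)
    fix x y assume xy: "x \<in> set (table_gens T)" "y \<in> set (table_gens T)" "fld x = fld y"
    then have "\<psi> ` set (stab_aut \<Gamma> x) = \<psi> ` set (stab_aut \<Gamma> y)"
      using stab_fld[OF xy(1)] stab_fld[OF xy(2)] by simp
    then have "set (stab_aut \<Gamma> x) = set (stab_aut \<Gamma> y)" by (rule inj_sets) (rule sub)+
    then have "stab_aut \<Gamma> x = stab_aut \<Gamma> y" unfolding stab_aut_def filter_eq_iff_set .
    then show "x = y" using dist(1) xy by (auto simp: distinct_map inj_on_def)
  qed
  then have distinct: "distinct (table_fields ?T)"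
    using dist(1) by (simp add: fields distinct_map)
  have set: "set (table_fields ?T) = {E. strictly_intermediate h E}"
    unfolding fields using strict complete by auto
  show "card {E. strictly_intermediate h E} = length (table_gens T)"
    using distinct_card[OF distinct] unfolding set by (simp add: fields)
  have degree: "ext_degree h (fld gs) = d"
    if gs: "gs \<in> set (table_gens T)" "d * length (stab_aut \<Gamma> gs) = length \<Gamma>" for gs d
  proof -
    have "card G = length \<Gamma>" unfolding G_def
      using inj group'(1) by (simp add: card_image distinct_card)
    moreover have "card (stab (fld gs)) = length (stab_aut \<Gamma> gs)"
      unfolding stab_fld[OF gs(1)] card_image[OF inj_on_subset[OF inj sub]]
      by (rule distinct_card) (simp add: stab_aut_def group'(1))
    moreover have "length \<Gamma> \<noteq> 0" using group'(2) by auto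
    ultimately show ?thesis
      using ext_degree_stab[OF fld, of gs] gs(2) by (metis mult_cancel2 mult_0_right)
  qed
  have normal: "normal_over h (fld gs) \<longleftrightarrow> normal_aut \<Gamma> (stab_aut \<Gamma> gs)"
    if gs: "gs \<in> set (table_gens T)" for gs
  proof -
    have conj_iff: "(\<exists>y\<in>stab (fld gs). \<psi> x \<circ> \<psi> g = \<psi> g \<circ> y) \<longleftrightarrow>
        mul_aut (inv_aut g) (mul_aut x g) \<in> set (stab_aut \<Gamma> gs)" (is "?l \<longleftrightarrow> ?r")
      if g: "g \<in> set \<Gamma>" and x: "x \<in> set (stab_aut \<Gamma> gs)" for g x
    proof -
      have x': "x \<in> set \<Gamma>" using x sub by blast
      have inv: "\<psi> (inv_aut g) \<circ> \<psi> g = id" "\<psi> g \<circ> \<psi> (inv_aut g) = id"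
        using group'(3)[OF g] g by (simp_all add: mul_aut_inv one flip: mul)
      have conj: "\<psi> (mul_aut (inv_aut g) (mul_aut x g)) = \<psi> (inv_aut g) \<circ> (\<psi> x \<circ> \<psi> g)"
        using x' g group'(3,4) by (simp add: mul)
      show ?thesis
      proof
        assume ?l
        then obtain y where y: "y \<in> set (stab_aut \<Gamma> gs)" "\<psi> x \<circ> \<psi> g = \<psi> g \<circ> \<psi> y"
          using stab_fld[OF gs] by auto
        have "\<psi> (mul_aut (inv_aut g) (mul_aut x g)) = \<psi> y"
          unfolding conj y(2) comp_assoc[symmetric] inv(1) by (rule id_comp)
        then have "mul_aut (inv_aut g) (mul_aut x g) = y"
          using group'(3,4) g x' subsetD[OF sub y(1)] by (intro inj_onD[OF inj]) auto
        then show ?r using y(1) by simp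
      next
        assume ?r
        moreover have "\<psi> x \<circ> \<psi> g = \<psi> g \<circ> \<psi> (mul_aut (inv_aut g) (mul_aut x g))"
          unfolding conj comp_assoc[symmetric] inv(2) by simp
        ultimately show ?l using stab_fld[OF gs] by blast
      qed
    qed
    have transfer: "(\<forall>g\<in>G. \<forall>x\<in>stab (fld gs). Q g x) \<longleftrightarrow>
        (\<forall>g\<in>set \<Gamma>. \<forall>x\<in>set (stab_aut \<Gamma> gs). Q (\<psi> g) (\<psi> x))" for Q
      unfolding stab_fld[OF gs] unfolding G_def by blast
    show ?thesis
      unfolding normal_over_iff_stab[OF fld] transfer[of "\<lambda>g x. \<exists>y\<in>stab (fld gs). x \<circ> g = g \<circ> y"]
        normal_aut_def list_all_iff using conj_iff by simp
  qed
  have row: "Ns @ Us = r \<Longrightarrow> set r \<subseteq> set (table_gens T)" if "(d, Ns, Us) \<in> set T" for d Ns Us r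
    using that by (auto simp: table_gens_def)
  show "complete_table h ?T"
    unfolding complete_table_def
  proof (intro conjI distinct set ballI)
    fix x assume "x \<in> set ?T"
    then obtain d Ns Us where x: "(d, Ns, Us) \<in> set T" "x = (d, map fld Ns, map fld Us)" by auto
    have "\<forall>gs\<in>set Ns. d * length (stab_aut \<Gamma> gs) = length \<Gamma> \<and> normal_aut \<Gamma> (stab_aut \<Gamma> gs)"
      "\<forall>gs\<in>set Us. d * length (stab_aut \<Gamma> gs) = length \<Gamma> \<and> \<not> normal_aut \<Gamma> (stab_aut \<Gamma> gs)"
      using checks(3) x(1) by (auto simp: check_rows_def list_all_iff)
    then show "case x of (d, Ns, Us) \<Rightarrow> (\<forall>E\<in>set Ns. ext_degree h E = d \<and> normal_over h E) \<and>
        (\<forall>E\<in>set Us. ext_degree h E = d \<and> \<not> normal_over h E)"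
      using row[OF x(1) refl] degree normal by (auto simp: x(2))
  qed
qed

subsection \<open>The splitting field of \<open>x\<^sup>6 + a x\<^sup>3 + b\<close>\<close>

text \<open>A nonzero polynomial of least degree vanishing at \<open>x\<close> divides
  \<open>p\<close>, and irreducibility makes the cofactor constant, so \<open>p\<close> itself has
  least degree.\<close>

lemma irreducible_root_degree:
  assumes h: "field_embedding h" and p: "irreducible p" "poly (map_poly h p) x = 0"
    and q: "q \<noteq> 0" "poly (map_poly h q) x = 0"
  shows "degree p \<le> degree q"
proof -
  define P where "P r \<longleftrightarrow> r \<noteq> 0 \<and> poly (map_poly h r) x = 0" for r
  define r where "r = arg_min degree P"
  have "P q" using q by (simp add: P_def)
  then have r: "P r" and min: "\<And>r'. P r' \<Longrightarrow> degree r \<le> degree r'"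
    unfolding r_def using arg_min_natI[of P q degree] arg_min_nat_le[of P _ degree] by auto
  have "degree r \<noteq> 0"
  proof
    assume "degree r = 0"
    then obtain c where "r = [:c:]" by (meson degree_eq_zeroE)
    then show False using r by (auto simp: P_def map_poly_pCons field_embedding_0[OF h] field_embedding_eq_0_iff[OF h])
  qed
  have "p mod r = 0"
  proof (rule ccontr)
    assume "p mod r \<noteq> 0"
    moreover have "map_poly h p = map_poly h (p div r) * map_poly h r + map_poly h (p mod r)"
      by (simp flip: map_poly_embedding_mult[OF h] map_poly_embedding_add[OF h])
    ultimately have "P (p mod r)" using r p(2) by (simp add: P_def)
    then have "degree r \<le> degree (p mod r)" by (rule min)
    then show False using degree_mod_less'[OF _ \<open>p mod r \<noteq> 0\<close>] r by (auto simp: P_def)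
  qed
  then obtain c where c: "p = r * c" by (metis mod_0_imp_dvd dvdE)
  moreover have "\<not> is_unit r" using r \<open>degree r \<noteq> 0\<close> by (simp add: P_def is_unit_iff_degree)
  ultimately have "is_unit c" using p(1) unfolding irreducible_def by blast
  then have "c \<noteq> 0" by auto
  then have "degree c = 0" using \<open>is_unit c\<close> by (simp add: is_unit_iff_degree)
  then have "degree p = degree r" using \<open>c \<noteq> 0\<close> c r by (simp add: P_def degree_mult_eq)
  then show ?thesis using min[OF \<open>P q\<close>] by simp
qed

text \<open>Cubing the difference also yields \<open>x * y = u * v\<close>, so \<open>x\<close> and
  \<open>- y\<close> agree with \<open>u\<close> and \<open>- v\<close> up to order. The wrong
  order, \<open>x = - v\<close>, would give 1 = -1 on cubing.\<close>

lemma cube_roots_difference_eq: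
  fixes x :: "'a::field"
  assumes "x ^ 3 = 1" "y ^ 3 = 1" "u ^ 3 = 1" "v ^ 3 = 1" "x \<noteq> y" "x - y = u - v"
    and "(2::'a) \<noteq> 0" "(3::'a) \<noteq> 0"
  shows "x = u \<and> y = v"
proof -
  have "3 * (x * y) * (y - x) = 3 * (u * v) * (v - u)"
  proof -
    have "(x - y) ^ 3 = x ^ 3 - y ^ 3 + 3 * (x * y) * (y - x)" by algebra
    moreover have "(u - v) ^ 3 = u ^ 3 - v ^ 3 + 3 * (u * v) * (v - u)" by algebra
    ultimately show ?thesis using assms by simp
  qed
  moreover have "v - u = y - x" "y - x \<noteq> 0" using assms(5,6) by (auto simp: algebra_simps)
  ultimately have xy: "x * y = u * v" using assms(8) by simp
  have "(x - u) * (x + v) = 0" using xy assms(6) by algebra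
  moreover have "x + v \<noteq> 0"
  proof
    assume "x + v = 0"
    then have "x = - v" by (simp add: eq_neg_iff_add_eq_0)
    then have "1 = - (1 :: 'a)" using assms(1,4) by (simp add: power3_eq_cube)
    then have "2 = (0 :: 'a)" by (metis add.right_inverse one_add_one)
    then show False using assms(7) by simp
  qed
  ultimately show ?thesis using assms(6) by auto
qed

text \<open>From \<open>(x - y)\<^sup>2 = - 3 * (x * y)\<close>, cubing removes the root of unity
  \<open>x * y\<close>. Thus all differences of distinct cube roots of unity share one sixth
  power.\<close>

lemma cube_roots_difference_power6:
  fixes x :: "'a::field"
  assumes "x ^ 3 = 1" "y ^ 3 = 1" "x \<noteq> y"
  shows "(x - y) ^ 6 = - 27"
proof -
  have "(x - y) * ((x - y)\<^sup>2 + 3 * (x * y)) = x ^ 3 - y ^ 3" by algebra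
  then have "(x - y)\<^sup>2 = - 3 * (x * y)" using assms by (simp add: eq_neg_iff_add_eq_0)
  moreover have "(x - y) ^ 6 = ((x - y)\<^sup>2) ^ 3" by algebra
  moreover have "(- 3 * (x * y)) ^ 3 = - 27 * (x ^ 3 * y ^ 3)" by algebra
  ultimately show ?thesis using assms by simp
qed

lemma primitive_cube_root_of_unity_iff:
  fixes z :: "'a::field"
  assumes "(3::'a) \<noteq> 0"
  shows "primitive_cube_root_of_unity z \<longleftrightarrow> z\<^sup>2 + z + 1 = 0"
proof
  assume "primitive_cube_root_of_unity z"
  moreover have "(z - 1) * (z\<^sup>2 + z + 1) = z ^ 3 - 1" by algebra
  ultimately show "z\<^sup>2 + z + 1 = 0" by (auto simp: primitive_cube_root_of_unity_def)
next
  assume *: "z\<^sup>2 + z + 1 = 0"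
  then have "z ^ 3 = 1" by algebra
  moreover have "z \<noteq> 1" using * assms by auto
  ultimately show "primitive_cube_root_of_unity z" by (simp add: primitive_cube_root_of_unity_def)
qed

text \<open>In a finite field of odd characteristic the nonzero squares \<open>Q\<close> have index
  2: by counting, \<open>Q\<close> and its translate by the nonsquare \<open>u\<close> exhaust the
  nonzero elements. So the nonsquare \<open>v\<close> is \<open>u\<close> times a square, and
  \<open>u * v\<close> is a square.\<close>

lemma infinite_if_nonsquares:
  fixes u v :: "'a::field"
  assumes "(2::'a) \<noteq> 0" and nonsquare: "\<And>n. n\<^sup>2 \<noteq> u" "\<And>n. n\<^sup>2 \<noteq> v" "\<And>n. n\<^sup>2 \<noteq> u * v"
  shows "infinite (UNIV :: 'a set)"
proof
  assume fin: "finite (UNIV :: 'a set)"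
  define Q where "Q = (\<lambda>x::'a. x\<^sup>2) ` (- {0})"
  have "u \<noteq> 0" using nonsquare(1)[of 0] by auto
  have finQ: "finite Q" unfolding Q_def using fin by (intro finite_imageI) (rule rev_finite_subset, auto)
  have fibre: "card {x \<in> - {0}. x\<^sup>2 = y} = 2" if "y \<in> Q" for y :: 'a
  proof -
    obtain x where x: "x \<noteq> 0" "y = x\<^sup>2" using \<open>y \<in> Q\<close> by (auto simp: Q_def)
    have "x \<noteq> - x"
    proof
      assume "x = - x"
      then have "2 * x = 0" by (metis add.right_inverse mult_2)
      then show False using assms(1) x by simp
    qed
    moreover have "{z \<in> - {0}. z\<^sup>2 = y} = {x, - x}" using x by (auto simp: power2_eq_iff)
    ultimately show ?thesis by simp
  qed
  have "(\<Union>y\<in>Q. {x \<in> - {0}. x\<^sup>2 = y}) = - {0}" by (auto simp: Q_def)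
  moreover have "card (\<Union>y\<in>Q. {x \<in> - {0}. x\<^sup>2 = y}) = (\<Sum>y\<in>Q. card {x \<in> - {0}. x\<^sup>2 = y})"
    using finQ fin by (intro card_UN_disjoint) (auto intro: rev_finite_subset)
  ultimately have "card (- {0} :: 'a set) = 2 * card Q" using fibre by (simp add: mult.commute)
  moreover have "card ((\<lambda>y. u * y) ` Q) = card Q"
    using \<open>u \<noteq> 0\<close> by (intro card_image) (auto simp: inj_on_def)
  moreover have "Q \<inter> (\<lambda>y. u * y) ` Q = {}"
  proof -
    have False if "x \<noteq> 0" "x'\<^sup>2 = u * x\<^sup>2" for x x' :: 'a
    proof -
      have "(x' / x)\<^sup>2 = u" using that by (simp add: power_divide)
      then show False using nonsquare(1) by blast
    qed
    then show ?thesis by (auto simp: Q_def)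
  qed
  ultimately have "card (Q \<union> (\<lambda>y. u * y) ` Q) = card (- {0} :: 'a set)"
    using finQ by (simp add: card_Un_disjoint)
  moreover have "Q \<union> (\<lambda>y. u * y) ` Q \<subseteq> - {0}" using \<open>u \<noteq> 0\<close> by (auto simp: Q_def)
  moreover have "finite (- {0} :: 'a set)" using fin by (rule rev_finite_subset) auto
  ultimately have "Q \<union> (\<lambda>y. u * y) ` Q = - {0}" using card_subset_eq by blast
  moreover have "v \<noteq> 0" using nonsquare(2)[of 0] by auto
  moreover have "v \<notin> Q" using nonsquare(2) by (auto simp: Q_def)
  ultimately obtain n where "v = u * n\<^sup>2" by (auto simp: Q_def)
  then have "(u * n)\<^sup>2 = u * v" by (simp add: power2_eq_square)
  then show False using nonsquare(3) by blast
qed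

text \<open>The splitting field enters through \<open>generated\<close>, a minimality property that
  applies directly to the explicit extensions constructed below. With \<zeta>, \<alpha> and \<beta>
  fixed, all further constructions can name elements.\<close>

locale sextic =
  fixes h :: "'k::field \<Rightarrow> 'f::field" and a b :: 'k and \<zeta> \<alpha> \<beta> :: 'f
  assumes emb: "field_embedding h"
    and two_base: "(2::'k) \<noteq> 0" and three_base: "(3::'k) \<noteq> 0"
    and zeta_notin: "\<nexists>z::'k. primitive_cube_root_of_unity z"
    and irred: "irreducible [:b, 0, 0, a, 0, 0, 1:]"
    and Delta_neq: "\<And>n. a\<^sup>2 - 4 * b \<noteq> - 3 * n\<^sup>2"
    and zeta: "primitive_cube_root_of_unity \<zeta>"
    and root_alpha: "\<alpha> ^ 6 + h a * \<alpha> ^ 3 + h b = 0"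
    and root_beta: "\<beta> ^ 6 + h a * \<beta> ^ 3 + h b = 0"
    and cubes_neq: "\<alpha> ^ 3 \<noteq> \<beta> ^ 3"
    and generated: "\<And>E. is_subfield E \<Longrightarrow> range h \<subseteq> E \<Longrightarrow> {\<alpha>, \<beta>, \<zeta>} \<subseteq> E \<Longrightarrow> E = UNIV"
begin

lemmas h_simps = field_embedding_simps[OF emb]

lemma two: "(2::'f) \<noteq> 0" and three: "(3::'f) \<noteq> 0"
  using two_base three_base field_embedding_eq_0_iff[OF emb, of 2] field_embedding_eq_0_iff[OF emb, of 3]
  by (simp_all add: h_simps)

text \<open>\<delta> and \<open>w\<close> are square roots of \<Delta> and -3. Unlike \<zeta>,
  \<open>w\<close> is a pure square root as \<open>quad_ext\<close> requires; \<open>zeta_w\<close>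
  recovers \<zeta> from it.\<close>

definition \<delta> where "\<delta> = \<alpha> ^ 3 - \<beta> ^ 3"
definition w where "w = \<zeta> - \<zeta>\<^sup>2"

definition K1 where "K1 = quad_ext (range h) \<delta>"
definition L where "L = quad_ext K1 w"

lemma zeta_quadratic: "\<zeta>\<^sup>2 = - 1 - \<zeta>"
proof -
  have "\<zeta>\<^sup>2 + \<zeta> + 1 = 0" using zeta primitive_cube_root_of_unity_iff[OF three] by simp
  then show ?thesis by algebra
qed

lemma zeta_cubed: "\<zeta> ^ 3 = 1" and zeta_neq_1: "\<zeta> \<noteq> 1"
  using zeta by (auto simp: primitive_cube_root_of_unity_def)

lemma zeta_sq_neq_1: "\<zeta>\<^sup>2 \<noteq> 1" and zeta_sq_neq: "\<zeta>\<^sup>2 \<noteq> \<zeta>" and zeta_neq_0: "\<zeta> \<noteq> 0"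
proof -
  show "\<zeta> \<noteq> 0" using zeta_cubed by auto
  then show "\<zeta>\<^sup>2 \<noteq> \<zeta>" using zeta_neq_1 by (simp add: power2_eq_square)
  show "\<zeta>\<^sup>2 \<noteq> 1"
  proof
    assume "\<zeta>\<^sup>2 = 1"
    then have "\<zeta> = 1" using zeta_cubed by algebra
    then show False using zeta_neq_1 by simp
  qed
qed

lemma w_squared: "w\<^sup>2 = - 3"
  using zeta_quadratic unfolding w_def by algebra

lemma w_nonzero: "w \<noteq> 0"
  using w_squared three by auto

lemma zeta_w: "\<zeta> = h (- 1 / 2) + h (1 / 2) * w"
proof -
  have "2 * \<zeta> = - 1 + w" using zeta_quadratic unfolding w_def by algebra
  then show ?thesis using two by (simp add: h_simps field_simps)
qed

lemma cubes_sum: "\<alpha> ^ 3 + \<beta> ^ 3 = - h a" and cubes_prod: "\<alpha> ^ 3 * \<beta> ^ 3 = h b"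
proof -
  have "(\<alpha> ^ 3 - \<beta> ^ 3) * (\<alpha> ^ 3 + \<beta> ^ 3 + h a) = 0" using root_alpha root_beta by algebra
  then have *: "\<alpha> ^ 3 + \<beta> ^ 3 + h a = 0" using cubes_neq by simp
  then show "\<alpha> ^ 3 + \<beta> ^ 3 = - h a" by (simp add: eq_neg_iff_add_eq_0)
  show "\<alpha> ^ 3 * \<beta> ^ 3 = h b" using * root_alpha by algebra
qed

lemma delta_squared: "\<delta>\<^sup>2 = h (a\<^sup>2 - 4 * b)"
  using cubes_sum cubes_prod unfolding \<delta>_def h_simps by algebra

lemma delta_nonzero: "\<delta> \<noteq> 0"
  using cubes_neq by (simp add: \<delta>_def)

lemma alpha_cubed: "\<alpha> ^ 3 = h (- a / 2) + h (1 / 2) * \<delta>"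
  and beta_cubed: "\<beta> ^ 3 = h (- a / 2) + h (- 1 / 2) * \<delta>"
proof -
  have "2 * \<alpha> ^ 3 = - h a + \<delta>" "2 * \<beta> ^ 3 = - h a - \<delta>"
    using cubes_sum unfolding \<delta>_def by algebra+
  then show "\<alpha> ^ 3 = h (- a / 2) + h (1 / 2) * \<delta>" "\<beta> ^ 3 = h (- a / 2) + h (- 1 / 2) * \<delta>"
    using two by (simp_all add: h_simps field_simps)
qed

lemma Delta_nonsquare: "n\<^sup>2 \<noteq> a\<^sup>2 - 4 * b"
proof
  assume n: "n\<^sup>2 = a\<^sup>2 - 4 * b"
  \<comment> \<open>If \<Delta> were the square of \<open>n\<close>, then \<open>- p\<close> and
    \<open>- q\<close> would be the roots of \<open>y\<^sup>2 + a * y + b\<close>, and f would be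
    the product of \<open>x ^ 3 + p\<close> and \<open>x ^ 3 + q\<close>.\<close>
  define p q where "p = (a - n) / 2" and "q = (a + n) / 2"
  have "2 * p = a - n" "2 * q = a + n" using two_base by (simp_all add: p_def q_def)
  then have "2 * (2 * b) = 2 * (2 * (p * q))" "2 * a = 2 * (p + q)" using n by algebra+
  then have pq: "b = p * q" "a = p + q" by (metis mult_left_cancel two_base)+
  have "[:b, 0, 0, a, 0, 0, 1:] = [:p, 0, 0, 1:] * [:q, 0, 0, 1:]"
    by (simp add: pq)
  then have "is_unit [:p, 0, 0, 1:] \<or> is_unit [:q, 0, 0, 1:]"
    using irred unfolding irreducible_def by blast
  then show False by (simp add: is_unit_iff_degree)
qed

lemma minus_three_nonsquare: "n\<^sup>2 \<noteq> (- 3 :: 'k)"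
proof
  assume n: "n\<^sup>2 = (- 3 :: 'k)"
  define z where "z = (n - 1) / 2"
  have "2 * z = n - 1" using two_base by (simp add: z_def)
  then have "2 * (2 * (z\<^sup>2 + z + 1)) = 0" using n by algebra
  then have "z\<^sup>2 + z + 1 = 0" using two_base by (metis mult_eq_0_iff)
  then show False using zeta_notin primitive_cube_root_of_unity_iff[OF three_base] by blast
qed

lemma infinite_base: "infinite (UNIV :: 'k set)"
proof (rule infinite_if_nonsquares[OF two_base Delta_nonsquare minus_three_nonsquare])
  fix n :: 'k
  show "n\<^sup>2 \<noteq> (a\<^sup>2 - 4 * b) * - 3"
  proof
    assume "n\<^sup>2 = (a\<^sup>2 - 4 * b) * - 3"
    \<comment> \<open>With \<open>n = 3 * m\<close>, a square root of -3\<Delta> yields \<Delta> in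
      the excluded form \<open>- 3 * m\<^sup>2\<close>.\<close>
    moreover obtain m where "n = 3 * m"
      using three_base by (metis nonzero_mult_div_cancel_left times_divide_eq_right)
    ultimately have "3 * (a\<^sup>2 - 4 * b) = 3 * (- 3 * m\<^sup>2)" by algebra
    then have "a\<^sup>2 - 4 * b = - 3 * m\<^sup>2" by (metis mult_left_cancel three_base)
    then show False using Delta_neq by blast
  qed
qed

section \<open>The tower from K to L, and the cube root \<alpha> over L\<close>

lemma subfield_base: "is_subfield (range h)" by (rule is_subfield_range[OF emb])

lemma delta_notin: "\<delta> \<notin> range h"
proof
  assume "\<delta> \<in> range h"
  then obtain n where "\<delta> = h n" by blast
  then have "h (n\<^sup>2) = h (a\<^sup>2 - 4 * b)" using delta_squared by (simp add: h_simps(7))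
  then show False using Delta_nonsquare by (simp only: field_embedding_eq_iff[OF emb])
qed

lemma delta_squared_in: "\<delta>\<^sup>2 \<in> range h" by (simp add: delta_squared)

lemma subfield_K1: "is_subfield K1"
  unfolding K1_def by (rule is_subfield_quad_ext[OF subfield_base delta_squared_in delta_notin])

lemma base_in_K1: "h x \<in> K1" and delta_in_K1: "\<delta> \<in> K1"
  unfolding K1_def by (simp_all add: quad_ext_base[OF subfield_base] quad_ext_gen[OF subfield_base])

lemma K1E:
  assumes "x \<in> K1" obtains u v where "x = h u + h v * \<delta>"
  using assms by (auto simp: K1_def quad_ext_def)

lemma K1_eqD: "h u + h v * \<delta> = h u' + h v' * \<delta> \<Longrightarrow> u = u' \<and> v = v'"
  using quad_ext_eqD[OF subfield_base delta_notin, of "h u" "h v" "h u'" "h v'"]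
  by (simp add: field_embedding_eq_iff[OF emb])

lemma w_squared_in: "w\<^sup>2 \<in> K1"
  using base_in_K1[of "- 3"] by (simp add: w_squared h_simps)

text \<open>Squaring the coordinates forces one of them to vanish. Then either -3 is a square in K,
  or \<Delta> is -3 times one.\<close>

lemma w_notin: "w \<notin> K1"
proof
  assume "w \<in> K1"
  then obtain p q where "w = h p + h q * \<delta>" by (rule K1E)
  then have "h (p\<^sup>2 + q\<^sup>2 * (a\<^sup>2 - 4 * b)) + h (2 * p * q) * \<delta> = h (- 3) + h 0 * \<delta>"
    using w_squared delta_squared unfolding h_simps by algebra
  then have *: "p\<^sup>2 + q\<^sup>2 * (a\<^sup>2 - 4 * b) = - 3" "2 * p * q = 0" by (auto dest: K1_eqD)
  show False
  proof (cases "q = 0")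
    case True
    then show False using *(1) minus_three_nonsquare by simp
  next
    case False
    then have "p = 0" using *(2) two_base by simp
    then have "a\<^sup>2 - 4 * b = - 3 * (1 / q)\<^sup>2"
      using *(1) False by (simp add: field_simps power2_eq_square)
    then show False using Delta_neq by blast
  qed
qed

lemma subfield_L: "is_subfield L"
  unfolding L_def by (rule is_subfield_quad_ext[OF subfield_K1 w_squared_in w_notin])

lemma K1_in_L: "x \<in> K1 \<Longrightarrow> x \<in> L" and w_in_L: "w \<in> L"
  unfolding L_def by (simp_all add: quad_ext_base[OF subfield_K1] quad_ext_gen[OF subfield_K1])

lemma base_in_L: "h x \<in> L" and delta_in_L: "\<delta> \<in> L"
  by (simp_all add: K1_in_L base_in_K1 delta_in_K1)

lemma zeta_in_L: "\<zeta> \<in> L"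
  by (subst zeta_w) (intro is_subfield_add[OF subfield_L] is_subfield_mult[OF subfield_L] base_in_L w_in_L)

lemma zeta_notin_K1: "\<zeta> \<notin> K1"
  using w_notin unfolding w_def by (auto intro!: is_subfield_intros[OF subfield_K1])

lemma cubes_in_K1: "\<alpha> ^ 3 \<in> K1" "\<beta> ^ 3 \<in> K1"
  unfolding alpha_cubed beta_cubed
  using base_in_K1 delta_in_K1 by (auto intro!: is_subfield_intros[OF subfield_K1] simp del: h_simps)

lemma cubes_in_L: "\<alpha> ^ 3 \<in> L" "\<beta> ^ 3 \<in> L"
  using cubes_in_K1 K1_in_L by auto

lemma cubes_notin: "\<alpha> ^ 3 \<notin> range h" "\<beta> ^ 3 \<notin> range h"
proof -
  have "2 * \<alpha> ^ 3 + h a = \<delta>" "- 2 * \<beta> ^ 3 - h a = \<delta>" using cubes_sum unfolding \<delta>_def by algebra+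
  then show "\<alpha> ^ 3 \<notin> range h" "\<beta> ^ 3 \<notin> range h"
    using delta_notin is_subfield_intros[OF subfield_base] rangeI by metis+
qed

lemma roots_neq_0: "\<alpha> \<noteq> 0" "\<beta> \<noteq> 0"
  using cubes_notin is_subfield_0[OF subfield_base] by auto

text \<open>A cube root in \<open>L\<close> yields one in \<open>K1\<close> by
  \<open>cube_root_in_quad_ext\<close>. That element is a root of f and of a quadratic polynomial
  over K, against the irreducibility of f.\<close>

lemma no_cube_root_in_L:
  assumes "y \<in> L" shows "y ^ 3 \<noteq> \<alpha> ^ 3" "y ^ 3 \<noteq> \<beta> ^ 3"
proof -
  have "False" if e: "y \<in> L" "y ^ 3 = e" "e = \<alpha> ^ 3 \<or> e = \<beta> ^ 3" for y e
  proof -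
    have "e \<in> K1" using e(3) cubes_in_K1 by auto
    then obtain x where x: "x \<in> K1" "x ^ 3 = e"
      using cube_root_in_quad_ext[OF subfield_K1 w_squared_in w_notin _ _ e(2)] e(1) unfolding L_def by blast
    obtain p q where pq: "x = h p + h q * \<delta>" using x(1) by (rule K1E)
    \<comment> \<open>The characteristic polynomial of \<open>x\<close> over K, with trace
      \<open>2 * p\<close> and norm
      \<open>p\<^sup>2 - q\<^sup>2 * (a\<^sup>2 - 4 * b)\<close>.\<close>
    define g where "g = [:p\<^sup>2 - q\<^sup>2 * (a\<^sup>2 - 4 * b), - 2 * p, 1:]"
    have "poly (map_poly h g) x = 0"
      using delta_squared pq unfolding g_def
      by (simp add: map_poly_embedding_pCons[OF emb] h_simps) algebra
    moreover have "poly (map_poly h [:b, 0, 0, a, 0, 0, 1:]) x = 0"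
    proof -
      have "e\<^sup>2 + h a * e + h b = 0" using e(3) root_alpha root_beta by (auto simp flip: power_mult)
      then show ?thesis using x(2) by (simp add: map_poly_embedding_pCons[OF emb] h_simps) algebra
    qed
    moreover have "g \<noteq> 0" by (simp add: g_def)
    ultimately have "degree [:b, 0, 0, a, 0, 0, 1:] \<le> degree g"
      by (intro irreducible_root_degree[OF emb irred])
    then show False by (simp add: g_def)
  qed
  then show "y ^ 3 \<noteq> \<alpha> ^ 3" "y ^ 3 \<noteq> \<beta> ^ 3" using assms by blast+
qed

definition M where "M = cubic_ext L \<alpha>"

lemma subfield_M: "is_subfield M"
  unfolding M_def by (rule is_subfield_cubic_ext[OF subfield_L cubes_in_L(1)]) (rule no_cube_root_in_L)

lemma L_in_M: "x \<in> L \<Longrightarrow> x \<in> M" and alpha_in_M: "\<alpha> \<in> M"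
  unfolding M_def by (simp_all add: cubic_ext_base[OF subfield_L] cubic_ext_gen[OF subfield_L])

lemma M_UNIV: "\<beta> \<in> M \<Longrightarrow> M = UNIV"
  using alpha_in_M L_in_M zeta_in_L base_in_L by (intro generated subfield_M) auto

lemma indep_M:
  assumes "u \<in> L" "v \<in> L" "x \<in> L" "u + v * \<alpha> + x * \<alpha>\<^sup>2 = 0"
  shows "u = 0 \<and> v = 0 \<and> x = 0"
  by (rule cubic_ext_indep[OF subfield_L cubes_in_L(1) _ assms]) (rule no_cube_root_in_L)

section \<open>Cube roots of unity as powers of \<zeta>\<close>

definition zp :: "z3 \<Rightarrow> 'f" where "zp m = \<zeta> ^ exp3 m"

lemma zp_simps: "zp Z0 = 1" "zp Z1 = \<zeta>" "zp Z2 = \<zeta>\<^sup>2" by (simp_all add: zp_def)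

lemma zeta_mult:
  "\<zeta> * \<zeta> = \<zeta>\<^sup>2" "\<zeta> * \<zeta>\<^sup>2 = 1" "\<zeta>\<^sup>2 * \<zeta> = 1" "\<zeta> ^ 4 = \<zeta>" "(\<zeta>\<^sup>2) ^ 3 = 1"
proof -
  show "\<zeta> * \<zeta> = \<zeta>\<^sup>2" by (simp add: power2_eq_square)
  show "\<zeta> * \<zeta>\<^sup>2 = 1" "\<zeta>\<^sup>2 * \<zeta> = 1" using zeta_cubed by (simp_all add: power2_eq_square power3_eq_cube mult.assoc)
  show "\<zeta> ^ 4 = \<zeta>" "(\<zeta>\<^sup>2) ^ 3 = 1" using zeta_cubed by algebra+
qed

lemma zp_add: "zp (add3 m n) = zp m * zp n"
  by (cases m; cases n) (simp_all add: zp_simps zeta_mult)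

lemma zp_cubed: "zp m ^ 3 = 1"
  by (cases m) (simp_all only: zp_simps zeta_mult zeta_cubed power_one)

lemma zp_neq_0: "zp m \<noteq> 0" by (simp add: zp_def zeta_neq_0)

lemma zp_eq_iff: "zp m = zp n \<longleftrightarrow> m = n"
  using zeta_neq_1 zeta_sq_neq_1 zeta_sq_neq zeta_neq_1[symmetric] zeta_sq_neq_1[symmetric] zeta_sq_neq[symmetric]
  by (cases m; cases n) (simp_all only: zp_simps simp_thms z3.distinct)

lemma zp_neg: "zp (neg3 m) * zp m = 1"
  by (cases m) (simp_all add: zp_simps zeta_mult)

lemma zp_in_L: "zp m \<in> L"
  unfolding zp_def by (rule is_subfield_power[OF subfield_L zeta_in_L])

lemma zp_neq_minus: "zp m \<noteq> - zp n"
proof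
  assume "zp m = - zp n"
  then have "zp m ^ 3 = - (zp n ^ 3)" by (simp add: power3_eq_cube)
  then have "2 = (0::'f)" unfolding zp_cubed by (metis add.right_inverse one_add_one)
  then show False using two by simp
qed

lemma cube_eqE:
  assumes "x ^ 3 = y ^ 3" obtains m where "x = zp m * y"
proof -
  have "(x - y) * (x - \<zeta> * y) * (x - \<zeta>\<^sup>2 * y) = x ^ 3 - y ^ 3"
    using zeta_quadratic by algebra
  then have "x = zp Z0 * y \<or> x = zp Z1 * y \<or> x = zp Z2 * y" using assms by (auto simp: zp_simps)
  then show ?thesis using that by blast
qed

subsection \<open>Automorphisms realising a code\<close>

text \<open>A relation rather than a map on codes: which codes are realised depends on the case,
  whereas uniqueness, multiplicativity and injectivity hold throughout.\<close>

fun realizes :: "aut \<Rightarrow> ('f \<Rightarrow> 'f) \<Rightarrow> bool" where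
  "realizes (Aut i j e d) \<psi> \<longleftrightarrow> field_embedding \<psi> \<and> (\<forall>x. \<psi> (h x) = h x) \<and> \<psi> \<zeta> = zp (sgn3 d Z1) \<and>
     \<psi> \<alpha> = zp i * (if e then \<beta> else \<alpha>) \<and> \<psi> \<beta> = zp j * (if e then \<alpha> else \<beta>)"

lemma realizes_emb: "realizes g \<psi> \<Longrightarrow> field_embedding \<psi>" and realizes_base: "realizes g \<psi> \<Longrightarrow> \<psi> (h x) = h x"
  by (cases g; simp)+

lemma hom_zp:
  assumes "hom_on E \<psi>" "is_subfield E" "\<zeta> \<in> E" "\<psi> \<zeta> = zp (sgn3 d Z1)"
  shows "\<psi> (zp m) = zp (sgn3 d m)"
  by (cases m; cases d)
    (simp_all add: zp_simps zeta_mult hom_on_power[OF assms(1,2,3)] assms(4) hom_on_1[OF assms(1)])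

lemma realizes_zp: "realizes (Aut i j e d) \<psi> \<Longrightarrow> \<psi> (zp m) = zp (sgn3 d m)"
  using hom_zp[of UNIV \<psi> d m] by (simp add: hom_on_UNIV is_subfield_def)

lemma realizes_delta:
  assumes "realizes (Aut i j e d) \<psi>" shows "\<psi> \<delta> = (if e then - \<delta> else \<delta>)"
proof -
  have emb\<psi>: "field_embedding \<psi>" by (rule realizes_emb[OF assms])
  have "\<psi> (\<alpha> ^ 3) = (if e then \<beta> ^ 3 else \<alpha> ^ 3)" "\<psi> (\<beta> ^ 3) = (if e then \<alpha> ^ 3 else \<beta> ^ 3)"
    using assms by (simp_all add: field_embedding_power[OF emb\<psi>] power_mult_distrib zp_cubed)
  then show ?thesis by (simp add: \<delta>_def field_embedding_diff[OF emb\<psi>])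
qed

lemma realizes_w:
  assumes "realizes (Aut i j e d) \<psi>" shows "\<psi> w = (if d then - w else w)"
proof -
  have emb\<psi>: "field_embedding \<psi>" by (rule realizes_emb[OF assms])
  have "\<psi> w = zp (sgn3 d Z1) - zp (sgn3 d Z2)"
    using realizes_zp[OF assms, of Z1] realizes_zp[OF assms, of Z2]
    by (simp add: w_def zp_simps field_embedding_diff[OF emb\<psi>])
  then show ?thesis by (cases d) (simp_all add: w_def zp_simps)
qed

lemma realizes_unique:
  assumes "realizes g \<psi>" "realizes g \<psi>'" shows "\<psi> = \<psi>'"
proof -
  have e: "field_embedding \<psi>" "field_embedding \<psi>'" using assms realizes_emb by auto
  have "is_subfield {x. \<psi> x = \<psi>' x}"
    unfolding is_subfield_def by (simp add: field_embedding_simps[OF e(1)] field_embedding_simps[OF e(2)])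
  moreover have "range h \<subseteq> {x. \<psi> x = \<psi>' x}"
    using realizes_base[OF assms(1)] realizes_base[OF assms(2)] by auto
  moreover have "{\<alpha>, \<beta>, \<zeta>} \<subseteq> {x. \<psi> x = \<psi>' x}" using assms by (cases g) auto
  ultimately have "{x. \<psi> x = \<psi>' x} = UNIV" by (rule generated)
  then show ?thesis by (auto simp: fun_eq_iff)
qed

lemma realizes_mul:
  assumes "realizes g \<psi>" "realizes g' \<psi>'" shows "realizes (mul_aut g g') (\<psi> \<circ> \<psi>')"
proof -
  obtain i j e d i' j' e' d' where g: "g = Aut i j e d" "g' = Aut i' j' e' d'" by (cases g, cases g')
  have e: "field_embedding \<psi>" "field_embedding \<psi>'" using assms realizes_emb by auto
  have "field_embedding (\<psi> \<circ> \<psi>')"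
    using e by (simp add: field_embedding_def)
  moreover have "\<psi> (zp (sgn3 d' Z1)) = zp (sgn3 (d \<noteq> d') Z1)"
    using realizes_zp[OF assms(1)[unfolded g]] by (cases d; cases d') simp_all
  ultimately show ?thesis
    using assms unfolding g
    by (simp add: field_embedding_mult[OF e(1)] realizes_zp[OF assms(1)[unfolded g]] zp_add)
qed

lemma realizes_one: "realizes one_aut id"
  by (simp add: zp_simps field_embedding_def)

lemma realizes_inj:
  assumes "realizes g \<psi>" "realizes g' \<psi>" shows "g = g'"
proof -
  obtain i j e d i' j' e' d' where g: "g = Aut i j e d" "g' = Aut i' j' e' d'" by (cases g, cases g')
  have "d = d'" using assms unfolding g by (cases d; cases d') (auto simp: zp_eq_iff)
  moreover have "e = e'"
    using realizes_delta[OF assms(1)[unfolded g]] realizes_delta[OF assms(2)[unfolded g]] delta_nonzero two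
    by (cases e; cases e') (auto simp: eq_neg_iff_add_eq_0 simp flip: mult_2)
  moreover have "i = i'" "j = j'"
    using assms \<open>e = e'\<close> roots_neq_0 unfolding g by (auto simp: zp_eq_iff split: if_splits)
  ultimately show ?thesis by (simp add: g)
qed

lemma hom_on_L:
  obtains \<phi> where "hom_on L \<phi>" "\<And>x. \<phi> (h x) = h x" "\<phi> \<delta> = (if e then - \<delta> else \<delta>)" "\<phi> w = (if d then - w else w)"
proof -
  have "hom_on (range h) id" by (simp add: hom_on_def)
  moreover have "(if e then - \<delta> else \<delta>)\<^sup>2 = id (\<delta>\<^sup>2)" by simp
  ultimately obtain \<phi> where "hom_on (quad_ext (range h) \<delta>) \<phi>" "\<And>x. x \<in> range h \<Longrightarrow> \<phi> x = id x"
      "\<phi> \<delta> = (if e then - \<delta> else \<delta>)"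
    using hom_extends_quad[OF subfield_base delta_squared_in delta_notin] by blast
  then have \<phi>: "hom_on K1 \<phi>" "\<And>x. x \<in> range h \<Longrightarrow> \<phi> x = x" "\<phi> \<delta> = (if e then - \<delta> else \<delta>)"
    by (auto simp: K1_def)
  have "w\<^sup>2 = h (- 3)" by (simp add: w_squared h_simps)
  then have "\<phi> (w\<^sup>2) = w\<^sup>2" using \<phi>(2)[OF rangeI, of "- 3"] by (simp only:)
  then have "(if d then - w else w)\<^sup>2 = \<phi> (w\<^sup>2)" by simp
  from hom_extends_quad[OF subfield_K1 w_squared_in w_notin \<phi>(1) this]
  obtain \<psi> where "hom_on L \<psi>" "\<And>x. x \<in> K1 \<Longrightarrow> \<psi> x = \<phi> x" "\<psi> w = (if d then - w else w)"
    unfolding L_def by blast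
  then show ?thesis using that[of \<psi>] \<phi>(2,3) base_in_K1 delta_in_K1 by simp
qed

text \<open>The map on \<open>L\<close> exchanges \<open>\<alpha> ^ 3\<close> and
  \<open>\<beta> ^ 3\<close> exactly when \<open>e\<close>, so every cube root of the image is
  admissible for \<alpha> and each \<open>i\<close> occurs. The values at \<delta> and
  \<open>\<beta> ^ 3\<close> are recorded because they govern the image of \<beta> in cases (A) and
  (C).\<close>

lemma hom_on_M:
  obtains \<phi> where "hom_on M \<phi>" "\<And>x. \<phi> (h x) = h x" "\<phi> \<zeta> = zp (sgn3 d Z1)"
    "\<phi> \<delta> = (if e then - \<delta> else \<delta>)" "\<phi> (\<beta> ^ 3) = (if e then \<alpha> ^ 3 else \<beta> ^ 3)"
    "\<phi> \<alpha> = zp i * (if e then \<beta> else \<alpha>)"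
proof -
  obtain \<phi> where \<phi>: "hom_on L \<phi>" "\<And>x. \<phi> (h x) = h x" "\<phi> \<delta> = (if e then - \<delta> else \<delta>)"
    "\<phi> w = (if d then - w else w)" using hom_on_L[where e = e and d = d] by blast
  have lin: "\<phi> (h p + h q * x) = h p + h q * \<phi> x" if "x \<in> L" for p q x
    using that base_in_L
    by (simp add: hom_on_add[OF \<phi>(1)] hom_on_mult[OF \<phi>(1)] is_subfield_mult[OF subfield_L] \<phi>(2))
  have alpha: "\<phi> (\<alpha> ^ 3) = (if e then \<beta> ^ 3 else \<alpha> ^ 3)"
    unfolding alpha_cubed beta_cubed lin[OF delta_in_L] \<phi>(3) by (simp add: h_simps)
  have beta: "\<phi> (\<beta> ^ 3) = (if e then \<alpha> ^ 3 else \<beta> ^ 3)"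
    unfolding alpha_cubed beta_cubed lin[OF delta_in_L] \<phi>(3) by (simp add: h_simps)
  have zeta: "\<phi> \<zeta> = zp (sgn3 d Z1)"
  proof -
    have h_half: "2 * h (- 1 / 2) = - 1" using two by (simp add: h_simps)
    \<comment> \<open>The conjugate of \<open>x + y * v\<close> is twice \<open>x\<close> minus the
      element itself; applied to \<zeta> this gives
      \<open>- 1 - \<zeta> = \<zeta>\<^sup>2\<close>.\<close>
    have neg: "x + y * - v = 2 * x - (x + y * v)" for x y v :: 'f by (simp add: algebra_simps)
    have "h (- 1 / 2) + h (1 / 2) * - w = \<zeta>\<^sup>2"
      unfolding neg zeta_w[symmetric] h_half zeta_quadratic ..
    moreover have "h (- 1 / 2) + h (1 / 2) * w = \<zeta>" by (rule zeta_w[symmetric])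
    moreover have "\<phi> \<zeta> = h (- 1 / 2) + h (1 / 2) * \<phi> w" by (subst zeta_w) (rule lin[OF w_in_L])
    ultimately show ?thesis by (cases d) (simp_all only: zp_simps \<phi>(4) sgn3.simps neg3.simps if_True if_False)
  qed
  have "(zp i * (if e then \<beta> else \<alpha>)) ^ 3 = \<phi> (\<alpha> ^ 3)"
    by (simp add: alpha power_mult_distrib zp_cubed)
  from hom_extends_cubic[OF subfield_L cubes_in_L(1) no_cube_root_in_L(1) \<phi>(1) this]
  obtain \<psi> where "hom_on M \<psi>" "\<And>x. x \<in> L \<Longrightarrow> \<psi> x = \<phi> x" "\<psi> \<alpha> = zp i * (if e then \<beta> else \<alpha>)"
    unfolding M_def by blast
  then show ?thesis
    using that[of \<psi>] \<phi>(2,3) beta zeta base_in_L delta_in_L cubes_in_L zeta_in_L by simp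
qed

text \<open>The automorphism changing the sign of \<open>w\<close> alone forces \<open>x\<close>
  into \<open>K1\<close>, and the one changing the sign of \<delta> alone forces it into K.\<close>

lemma fixed_in_L:
  assumes x: "x \<in> L" and "realizes (Aut Z0 Z0 False True) \<psi>" "\<psi> x = x"
    and "realizes (Aut Z0 Z0 True False) \<psi>'" "\<psi>' x = x"
  shows "x \<in> range h"
proof -
  note emb\<psi> = realizes_emb[OF assms(2)] and emb\<psi>' = realizes_emb[OF assms(4)]
  have "\<psi> y = y" if "y \<in> K1" for y
  proof -
    obtain p q where "y = h p + h q * \<delta>" using \<open>y \<in> K1\<close> by (rule K1E)
    then show ?thesis
      using realizes_delta[OF assms(2)] realizes_base[OF assms(2)]
      by (simp add: field_embedding_add[OF emb\<psi>] field_embedding_mult[OF emb\<psi>])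
  qed
  then have "x \<in> K1"
    using realizes_w[OF assms(2)] assms(3)
    by (intro fixed_in_quad_ext[OF subfield_K1 w_notin two x[unfolded L_def] emb\<psi>]) auto
  then show ?thesis
    using realizes_delta[OF assms(4)] realizes_base[OF assms(4)] assms(5) unfolding K1_def
    by (intro fixed_in_quad_ext[OF subfield_base delta_notin two _ emb\<psi>']) auto
qed

lemma realizes_fixes_L:
  assumes "realizes (Aut i j False False) \<psi>" "x \<in> L" shows "\<psi> x = x"
proof -
  note emb\<psi> = realizes_emb[OF assms(1)]
  obtain y z where "x = y + z * w" "y \<in> K1" "z \<in> K1" using assms(2) by (auto simp: L_def quad_ext_def)
  moreover from this obtain p q p' q' where "y = h p + h q * \<delta>" "z = h p' + h q' * \<delta>" by (metis K1E)
  ultimately show ?thesis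
    using realizes_delta[OF assms(1)] realizes_w[OF assms(1)] realizes_base[OF assms(1)]
    by (simp add: field_embedding_add[OF emb\<psi>] field_embedding_mult[OF emb\<psi>])
qed

end

section \<open>Roots and reducibility of polynomials over a field\<close>

lemma irreducible_no_root:
  assumes "irreducible p" "degree p > 1" shows "poly p (r :: 'a::field) \<noteq> 0"
proof
  assume "poly p r = 0"
  then obtain c where c: "p = [:- r, 1:] * c" by (metis dvdE poly_eq_0_iff_dvd)
  have "\<not> is_unit [:- r, 1:]" by (simp add: is_unit_iff_degree)
  then have "is_unit c" using assms(1) c unfolding irreducible_def by blast
  then have "c \<noteq> 0" by auto
  then have "degree p = 1" using c \<open>is_unit c\<close> degree_mult_eq[of "[:- r, 1:]" c] by (simp add: is_unit_iff_degree)
  then show False using assms(2) by simp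
qed

lemma cubic_root_if_reducible:
  assumes "\<not> irreducible p" "degree p = 3"
  obtains r :: "'a::field" where "poly p r = 0"
proof -
  have "p \<noteq> 0" using assms(2) by auto
  then have "\<not> is_unit p" using assms(2) by (simp add: is_unit_iff_degree)
  with \<open>p \<noteq> 0\<close> obtain u v where uv: "p = u * v" "\<not> is_unit u" "\<not> is_unit v"
    using assms(1) unfolding irreducible_def by blast
  have nz: "u \<noteq> 0" "v \<noteq> 0" using uv(1) \<open>p \<noteq> 0\<close> by auto
  have "degree u + degree v = 3" using uv(1) nz assms(2) by (simp add: degree_mult_eq)
  moreover have "degree u \<noteq> 0" "degree v \<noteq> 0" using uv nz by (auto simp: is_unit_iff_degree)
  ultimately have "degree u = 1 \<or> degree v = 1" by auto
  then obtain l where l: "l \<in> {u, v}" "degree l = 1" by auto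
  then obtain c d where "l = [:c, d:]" "d \<noteq> 0" by (metis degree1_coeffs)
  then have "poly l (- c / d) = 0" by simp
  then have "poly p (- c / d) = 0" using uv(1) l(1) by auto
  then show ?thesis by (rule that)
qed

context sextic
begin

subsection \<open>Which generators an automorphism fixes\<close>

definition lin :: "z3 \<Rightarrow> z3 \<Rightarrow> bool" where
  "lin m n \<longleftrightarrow> (\<forall>k l. zp k * \<alpha> + zp l * \<beta> = zp m * \<alpha> + zp n * \<beta> \<longrightarrow> k = m \<and> l = n)"

definition indep :: bool where
  "indep \<longleftrightarrow> (\<forall>u\<in>L. \<forall>v\<in>L. u * \<alpha> + v * \<beta> = 0 \<longrightarrow> u = 0 \<and> v = 0)"

lemma indep_eq_iff:
  assumes indep "u \<in> L" "v \<in> L" "u' \<in> L" "v' \<in> L"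
  shows "u * \<alpha> + v * \<beta> = u' * \<alpha> + v' * \<beta> \<longleftrightarrow> u = u' \<and> v = v'"
proof
  assume "u * \<alpha> + v * \<beta> = u' * \<alpha> + v' * \<beta>"
  then have "(u - u') * \<alpha> + (v - v') * \<beta> = 0" by (simp add: algebra_simps)
  moreover have "u - u' \<in> L" "v - v' \<in> L" using assms by (simp_all add: is_subfield_diff[OF subfield_L])
  ultimately have "u - u' = 0 \<and> v - v' = 0" using assms(1) unfolding indep_def by blast
  then show "u = u' \<and> v = v'" by simp
qed auto

lemma lin_iff:
  "lin m n \<Longrightarrow> zp k * \<alpha> + zp l * \<beta> = zp m * \<alpha> + zp n * \<beta> \<longleftrightarrow> k = m \<and> l = n"
  by (auto simp: lin_def)

lemma lin_if_indep: "indep \<Longrightarrow> lin m n"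
  unfolding lin_def by (simp add: indep_eq_iff zp_in_L zp_eq_iff)

fun ev :: "'f \<Rightarrow> 'f \<Rightarrow> gen \<Rightarrow> 'f" where
  "ev s t GS = s"
| "ev s t GT = t"
| "ev s t GZ = \<zeta>"
| "ev s t (GC m) = \<alpha> * \<beta> * zp m"
| "ev s t (GA m) = \<alpha> * zp m"
| "ev s t (GB m) = \<beta> * zp m"
| "ev s t (GSum m n) = \<alpha> * zp m + \<beta> * zp n"
| "ev s t (GR m) = \<alpha> * \<beta> * (\<alpha> * zp m + \<beta> * zp (neg3 m))"
| "ev s t (GD m) = zp m * (\<zeta> - 1) * (\<alpha> - \<beta>)"

fun generic :: "gen \<Rightarrow> bool" where
  "generic (GSum m n) = lin m n"
| "generic (GR m) = lin m (neg3 m)"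
| "generic (GD m) = indep"
| "generic _ = True"

lemma neg_fixed_iff: "- x = x \<longleftrightarrow> (x :: 'f) = 0"
proof
  assume "- x = x"
  then have "2 * x = 0" by (metis add.right_inverse mult_2)
  then show "x = 0" using two by simp
qed simp

lemma realizes_sum:
  assumes "realizes (Aut i j e d) \<psi>"
  shows "\<psi> (\<alpha> * zp m + \<beta> * zp n) =
    zp (if e then add3 (sgn3 d n) j else add3 (sgn3 d m) i) * \<alpha> +
    zp (if e then add3 (sgn3 d m) i else add3 (sgn3 d n) j) * \<beta>"
proof -
  note emb\<psi> = realizes_emb[OF assms]
  show ?thesis
    using assms
    by (simp add: field_embedding_add[OF emb\<psi>] field_embedding_mult[OF emb\<psi>] realizes_zp[OF assms] zp_add algebra_simps)
qed

lemma realizes_prod: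
  assumes "realizes (Aut i j e d) \<psi>"
  shows "\<psi> (\<alpha> * \<beta>) = zp (add3 i j) * (\<alpha> * \<beta>)"
  using assms by (simp add: field_embedding_mult[OF realizes_emb[OF assms]] zp_add)

lemma realizes_difference:
  assumes "realizes (Aut i j e d) \<psi>"
  shows "\<psi> (zp m * (\<zeta> - 1) * (\<alpha> - \<beta>)) = (\<zeta> - 1) *
    ((if d = e then zp (if d then add3 Z2 (add3 (sgn3 d m) j) else add3 m i)
      else - zp (if d then add3 Z2 (add3 (sgn3 d m) i) else add3 m j)) * \<alpha> +
     (if d = e then - zp (if d then add3 Z2 (add3 (sgn3 d m) i) else add3 m j)
      else zp (if d then add3 Z2 (add3 (sgn3 d m) j) else add3 m i)) * \<beta>)"
proof -
  note emb\<psi> = realizes_emb[OF assms]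
  have factor: "zp (sgn3 d Z1) - 1 = (if d then - zp Z2 else 1) * (\<zeta> - 1)"
    by (cases d) (use zeta_cubed in \<open>simp_all add: zp_simps algebra_simps zeta_mult\<close>)
  have img: "\<psi> (zp m * (\<zeta> - 1) * (\<alpha> - \<beta>)) = zp (sgn3 d m) * (zp (sgn3 d Z1) - 1) *
      (zp i * (if e then \<beta> else \<alpha>) - zp j * (if e then \<alpha> else \<beta>))"
    using assms by (simp add: field_embedding_simps[OF emb\<psi>] realizes_zp[OF assms])
  show ?thesis
    unfolding img factor by (cases d; cases e) (simp_all add: zp_add algebra_simps)
qed

lemma realizes_fixes_gen:
  assumes r: "realizes g \<psi>" and s: "s\<^sup>2 = h (a\<^sup>2 - 4 * b)" and t: "t\<^sup>2 = h (- 3 * (a\<^sup>2 - 4 * b))"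
    and "generic x"
  shows "\<psi> (ev s t x) = ev s t x \<longleftrightarrow> fixes_gen g x"
proof -
  obtain i j e d where g: "g = Aut i j e d" by (cases g)
  note r = r[unfolded g]
  note emb\<psi> = realizes_emb[OF r]
  \<comment> \<open>The square roots \<open>s\<close> and \<open>t\<close> are known only up to
    sign, but automorphisms act on them by signs, so either choice has the same stabiliser.\<close>
  have "s\<^sup>2 = \<delta>\<^sup>2" using s delta_squared by simp
  then have "s = \<delta> \<or> s = - \<delta>" by (simp only: power2_eq_iff)
  then have \<psi>s: "\<psi> s = (if e then - s else s)" and "s \<noteq> 0"
    using realizes_delta[OF r] delta_nonzero by (auto simp: field_embedding_minus[OF emb\<psi>])
  have "t\<^sup>2 = (w * \<delta>)\<^sup>2" unfolding t power_mult_distrib w_squared delta_squared by (simp add: h_simps)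
  then have "t = w * \<delta> \<or> t = - (w * \<delta>)" by (simp only: power2_eq_iff)
  then have \<psi>t: "\<psi> t = (if e = d then t else - t)" and "t \<noteq> 0"
    using realizes_delta[OF r] realizes_w[OF r] delta_nonzero w_nonzero
    by (auto simp: field_embedding_minus[OF emb\<psi>] field_embedding_mult[OF emb\<psi>])
  show ?thesis
  proof (cases x)
    case GS
    then show ?thesis using \<psi>s \<open>s \<noteq> 0\<close> by (simp add: g neg_fixed_iff)
  next
    case GT
    then show ?thesis using \<psi>t \<open>t \<noteq> 0\<close> by (simp add: g neg_fixed_iff)
  next
    case GZ
    have "\<psi> \<zeta> = zp (sgn3 d Z1)" using r by simp
    then show ?thesis using GZ zp_eq_iff[of "sgn3 d Z1" Z1] by (cases d) (simp_all add: g zp_simps)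
  next
    case (GC m)
    have "\<psi> (\<alpha> * \<beta> * zp m) = \<alpha> * \<beta> * zp (add3 (sgn3 d m) (add3 i j))"
      using realizes_prod[OF r] by (simp add: field_embedding_mult[OF emb\<psi>] realizes_zp[OF r] zp_add mult_ac)
    then show ?thesis using GC roots_neq_0 by (simp add: g zp_eq_iff)
  next
    case (GA m)
    have img: "\<psi> (\<alpha> * zp m) = (if e then \<beta> else \<alpha>) * zp (add3 (sgn3 d m) i)"
      using r by (simp add: field_embedding_mult[OF emb\<psi>] realizes_zp[OF r] zp_add mult_ac)
    show ?thesis
    proof (cases e)
      case True
      have "\<beta> * zp (add3 (sgn3 d m) i) \<noteq> \<alpha> * zp m"
      proof
        assume "\<beta> * zp (add3 (sgn3 d m) i) = \<alpha> * zp m"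
        then have "(\<beta> * zp (add3 (sgn3 d m) i)) ^ 3 = (\<alpha> * zp m) ^ 3" by simp
        then show False using cubes_neq by (simp add: power_mult_distrib zp_cubed)
      qed
      then show ?thesis using GA img True by (simp add: g)
    next
      case False
      then show ?thesis using GA img roots_neq_0 by (simp add: g zp_eq_iff)
    qed
  next
    case (GB m)
    have img: "\<psi> (\<beta> * zp m) = (if e then \<alpha> else \<beta>) * zp (add3 (sgn3 d m) j)"
      using r by (simp add: field_embedding_mult[OF emb\<psi>] realizes_zp[OF r] zp_add mult_ac)
    show ?thesis
    proof (cases e)
      case True
      have "\<alpha> * zp (add3 (sgn3 d m) j) \<noteq> \<beta> * zp m"
      proof
        assume "\<alpha> * zp (add3 (sgn3 d m) j) = \<beta> * zp m"
        then have "(\<alpha> * zp (add3 (sgn3 d m) j)) ^ 3 = (\<beta> * zp m) ^ 3" by simp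
        then show False using cubes_neq by (simp add: power_mult_distrib zp_cubed)
      qed
      then show ?thesis using GB img True by (simp add: g)
    next
      case False
      then show ?thesis using GB img roots_neq_0 by (simp add: g zp_eq_iff)
    qed
  next
    case (GSum m n)
    define k l where "k = (if e then add3 (sgn3 d n) j else add3 (sgn3 d m) i)"
      and "l = (if e then add3 (sgn3 d m) i else add3 (sgn3 d n) j)"
    have "lin m n" using assms(4) GSum by simp
    then have "zp k * \<alpha> + zp l * \<beta> = zp m * \<alpha> + zp n * \<beta> \<longleftrightarrow> k = m \<and> l = n"
      by (rule lin_iff)
    moreover have "\<psi> (ev s t x) = zp k * \<alpha> + zp l * \<beta>" "ev s t x = zp m * \<alpha> + zp n * \<beta>"
      using realizes_sum[OF r] by (simp_all add: GSum k_def l_def mult.commute)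
    ultimately show ?thesis by (auto simp: g GSum k_def l_def)
  next
    case (GR m)
    define k l where "k = (if e then add3 (sgn3 d (neg3 m)) j else add3 (sgn3 d m) i)"
      and "l = (if e then add3 (sgn3 d m) i else add3 (sgn3 d (neg3 m)) j)"
    have "lin m (neg3 m)" using assms(4) GR by simp
    then have "zp (add3 (add3 i j) k) * \<alpha> + zp (add3 (add3 i j) l) * \<beta> = zp m * \<alpha> + zp (neg3 m) * \<beta>
        \<longleftrightarrow> add3 (add3 i j) k = m \<and> add3 (add3 i j) l = neg3 m"
      by (rule lin_iff)
    moreover have "\<psi> (ev s t x) = \<alpha> * \<beta> * (zp (add3 (add3 i j) k) * \<alpha> + zp (add3 (add3 i j) l) * \<beta>)"
    proof -
      have "\<psi> (ev s t x) = zp (add3 i j) * (\<alpha> * \<beta>) * (zp k * \<alpha> + zp l * \<beta>)"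
        unfolding GR ev.simps field_embedding_mult[OF emb\<psi>, of "\<alpha> * \<beta>"] realizes_prod[OF r]
          realizes_sum[OF r] k_def l_def ..
      then show ?thesis by (simp add: zp_add[of "add3 i j"] algebra_simps)
    qed
    moreover have "ev s t x = \<alpha> * \<beta> * (zp m * \<alpha> + zp (neg3 m) * \<beta>)"
      by (simp add: GR mult.commute)
    ultimately have "\<psi> (ev s t x) = ev s t x \<longleftrightarrow> add3 (add3 i j) k = m \<and> add3 (add3 i j) l = neg3 m"
      using roots_neq_0 by simp
    also have "\<dots> \<longleftrightarrow> fixes_gen g x"
      unfolding g GR k_def l_def by (cases e; cases d; cases i; cases j; cases m; simp)
    finally show ?thesis .
  next
    case (GD m)
    define u v where
      "u = (if d = e then zp (if d then add3 Z2 (add3 (sgn3 d m) j) else add3 m i)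
        else - zp (if d then add3 Z2 (add3 (sgn3 d m) i) else add3 m j))"
      and "v = (if d = e then - zp (if d then add3 Z2 (add3 (sgn3 d m) i) else add3 m j)
        else zp (if d then add3 Z2 (add3 (sgn3 d m) j) else add3 m i))"
    have indep using assms(4) GD by simp
    have mem: "u \<in> L" "v \<in> L" "zp m \<in> L" "- zp m \<in> L"
      unfolding u_def v_def using zp_in_L is_subfield_minus[OF subfield_L] by auto
    have "\<psi> (ev s t x) = (\<zeta> - 1) * (u * \<alpha> + v * \<beta>)"
      unfolding GD ev.simps realizes_difference[OF r] u_def v_def ..
    moreover have "ev s t x = (\<zeta> - 1) * (zp m * \<alpha> + (- zp m) * \<beta>)"
      by (simp add: GD algebra_simps)
    ultimately have "\<psi> (ev s t x) = ev s t x \<longleftrightarrow> u = zp m \<and> v = - zp m"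
      using zeta_neq_1 indep_eq_iff[OF \<open>indep\<close> mem] by simp
    also have "\<dots> \<longleftrightarrow> d = e \<and> (if d then add3 Z2 (add3 (sgn3 d m) j) else add3 m i) = m \<and>
        (if d then add3 Z2 (add3 (sgn3 d m) i) else add3 m j) = m"
      unfolding u_def v_def by (auto simp: zp_eq_iff zp_neq_minus zp_neq_minus[symmetric])
    also have "\<dots> \<longleftrightarrow> fixes_gen g x"
      unfolding g GD by (cases e; cases d; cases i; cases j; cases m; simp)
    finally show ?thesis .
  qed
qed

text \<open>Realising maps are chosen arbitrarily, one for each code; their uniqueness makes the
  choice multiplicative.\<close>

lemma complete_table_if_realized:
  assumes "check_group \<Gamma>" "check_distinct \<Gamma> T" "check_complete \<Gamma> T" "check_rows \<Gamma> T"
    and s: "s\<^sup>2 = h (a\<^sup>2 - 4 * b)" and t: "t\<^sup>2 = h (- 3 * (a\<^sup>2 - 4 * b))"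
    and exists: "\<And>g. g \<in> set \<Gamma> \<Longrightarrow> \<exists>\<psi>. realizes g \<psi>"
    and fixed: "\<And>x. (\<And>g \<psi>. g \<in> set \<Gamma> \<Longrightarrow> realizes g \<psi> \<Longrightarrow> \<psi> x = x) \<Longrightarrow> x \<in> range h"
    and generic: "\<And>gs x. gs \<in> set (table_gens T) \<Longrightarrow> x \<in> set gs \<Longrightarrow> generic x"
  shows "complete_table h (map (\<lambda>(d, Ns, Us). (d, map (\<lambda>gs. adjoin h (ev s t ` set gs)) Ns,
      map (\<lambda>gs. adjoin h (ev s t ` set gs)) Us)) T)"
    and "card {E. strictly_intermediate h E} = length (table_gens T)"
proof -
  define \<psi> where "\<psi> g = (SOME \<psi>. realizes g \<psi>)" for g
  have \<psi>: "realizes g (\<psi> g)" if "g \<in> set \<Gamma>" for g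
    unfolding \<psi>_def using exists[OF that] by (rule someI_ex)
  have group: "one_aut \<in> set \<Gamma>" "\<And>g g'. g \<in> set \<Gamma> \<Longrightarrow> g' \<in> set \<Gamma> \<Longrightarrow> mul_aut g g' \<in> set \<Gamma>"
    using assms(1) by (auto simp: check_group_def list_all_iff)
  have "{x. \<forall>g\<in>set \<Gamma>. \<psi> g x = x} = range h"
  proof (intro equalityI subsetI)
    fix x assume x: "x \<in> {x. \<forall>g\<in>set \<Gamma>. \<psi> g x = x}"
    show "x \<in> range h"
    proof (rule fixed)
      fix g \<phi> assume "g \<in> set \<Gamma>" "realizes g \<phi>"
      then show "\<phi> x = x" using realizes_unique[OF _ \<psi>] x by blast
    qed
  qed (use \<psi> realizes_base in blast)
  note fixed_field = this
  have inj: "inj_on \<psi> (set \<Gamma>)" by (rule inj_onI) (metis \<psi> realizes_inj)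
  note mul = realizes_unique[OF \<psi>[OF group(2)] realizes_mul[OF \<psi> \<psi>]]
  note one = realizes_unique[OF \<psi>[OF group(1)] realizes_one]
  have fixes_iff: "\<psi> g (ev s t x) = ev s t x \<longleftrightarrow> fixes_gen g x"
    if "gs \<in> set (table_gens T)" "x \<in> set gs" "g \<in> set \<Gamma>" for gs x g
    using realizes_fixes_gen[OF \<psi> s t generic] that by blast
  note table = complete_table_from_codes[where \<psi> = \<psi> and ev = "ev s t", OF emb infinite_base assms(1)
      realizes_emb[OF \<psi>] mul one inj fixed_field fixes_iff assms(2-4)]
  show "complete_table h (map (\<lambda>(d, Ns, Us). (d, map (\<lambda>gs. adjoin h (ev s t ` set gs)) Ns,
      map (\<lambda>gs. adjoin h (ev s t ` set gs)) Us)) T)"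
    by (rule table(1))
  show "card {E. strictly_intermediate h E} = length (table_gens T)"
    by (rule table(2))
qed

end

lemma check_group_A: "check_group auts_A" by code_simp
lemma check_group_B: "check_group auts_B" by code_simp
lemma check_group_C: "check_group auts_C" by code_simp

context sextic
begin

section \<open>The cubic R and the field K(\<alpha>)\<close>

lemma b_neq_0: "b \<noteq> 0"
  using cubes_prod roots_neq_0 field_embedding_0[OF emb] by auto

lemma K1_subset:
  assumes "is_subfield E" "range h \<subseteq> E" "\<alpha> ^ 3 \<in> E \<or> \<beta> ^ 3 \<in> E"
  shows "K1 \<subseteq> E"
proof -
  have "\<delta> = 2 * \<alpha> ^ 3 + h a" "\<delta> = - 2 * \<beta> ^ 3 - h a" using cubes_sum unfolding \<delta>_def by algebra+
  moreover have "2 * \<alpha> ^ 3 + h a \<in> E \<or> - 2 * \<beta> ^ 3 - h a \<in> E"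
  proof -
    have mem: "h a \<in> E" "2 \<in> E" "- 2 \<in> E" using assms(1,2) is_subfield_numeral is_subfield_minus by blast+
    show ?thesis using assms(3)
      by (blast intro: mem is_subfield_mult[OF assms(1)] is_subfield_add[OF assms(1)] is_subfield_diff[OF assms(1)])
  qed
  ultimately have "\<delta> \<in> E" by metis
  then show ?thesis unfolding K1_def by (intro quad_ext_subset assms(1,2))
qed

lemma zp_in_K1D: "zp m \<in> K1 \<Longrightarrow> m = Z0"
proof (cases m)
  case Z1
  then show "zp m \<in> K1 \<Longrightarrow> m = Z0" using zeta_notin_K1 by (simp add: zp_simps)
next
  case Z2
  have "\<zeta> = - 1 - \<zeta>\<^sup>2" using zeta_quadratic by algebra
  then have "\<zeta>\<^sup>2 \<notin> K1"
    using zeta_notin_K1 is_subfield_diff[OF subfield_K1] is_subfield_minus[OF subfield_K1] is_subfield_1[OF subfield_K1]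
    by metis
  then show "zp m \<in> K1 \<Longrightarrow> m = Z0" using Z2 by (simp add: zp_simps)
qed

text \<open>K(\<alpha>) lies in \<open>cubic_ext K1 \<alpha>\<close>. Comparing coordinates over
  \<open>L\<close>, where \<zeta> has constant coordinate \<zeta>, would put \<zeta> into
  \<open>K1\<close>.\<close>

lemma zeta_notin_adjoin_alpha: "\<zeta> \<notin> adjoin h {\<alpha>}"
proof
  assume \<zeta>: "\<zeta> \<in> adjoin h {\<alpha>}"
  have "is_subfield (cubic_ext K1 \<alpha>)"
    using no_cube_root_in_L(1) K1_in_L by (intro is_subfield_cubic_ext[OF subfield_K1 cubes_in_K1(1)]) blast
  then have "adjoin h {\<alpha>} \<subseteq> cubic_ext K1 \<alpha>"
    using cubic_ext_base[OF subfield_K1] cubic_ext_gen[OF subfield_K1] base_in_K1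
    by (intro adjoin_least) auto
  then obtain u v x where uvx: "u \<in> K1" "v \<in> K1" "x \<in> K1" "\<zeta> = u + v * \<alpha> + x * \<alpha>\<^sup>2"
    using \<zeta> unfolding cubic_ext_def by blast
  then have eq: "(u - \<zeta>) + v * \<alpha> + x * \<alpha>\<^sup>2 = 0" by (simp add: algebra_simps)
  have "u - \<zeta> \<in> L" "v \<in> L" "x \<in> L"
    using uvx(1-3) K1_in_L zeta_in_L is_subfield_diff[OF subfield_L] by auto
  from indep_M[OF this eq] have "u - \<zeta> = 0" by simp
  then show False using uvx(1) zeta_notin_K1 by simp
qed

text \<open>By Cardano's formula \<open>r\<close> is the sum of
  \<open>u = \<zeta>^k \<alpha>\<^sup>2\<beta>\<close> and
  \<open>v = \<zeta>^-k \<alpha>\<beta>\<^sup>2\<close>. Since \<open>r\<close> lies in K, both lie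
  in \<open>K1\<close> and are conjugate over K; the factor \<open>\<zeta>^k\<close> is then
  absorbed into \<beta>.\<close>

lemma resolvent_roots:
  assumes "poly [:a * b, - 3 * b, 0, 1:] r = 0"
  obtains k p q where "\<alpha>\<^sup>2 * (\<beta> * zp k) = h p + h q * \<delta>" "\<alpha> * (\<beta> * zp k)\<^sup>2 = h p - h q * \<delta>"
proof -
  have "h (a * b + r * (- 3 * b + r * (r * 1))) = h 0" using assms by simp
  then have r: "h r ^ 3 - 3 * h b * h r + h a * h b = 0"
    unfolding h_simps by algebra
  define u0 v0 where "u0 = \<alpha>\<^sup>2 * \<beta>" and "v0 = \<alpha> * \<beta>\<^sup>2"
  have u0v0: "u0 * v0 = h b" "u0 ^ 3 + v0 ^ 3 = - h a * h b" "u0 ^ 3 = \<alpha> ^ 3 * h b"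
  proof -
    have "u0 * v0 = \<alpha> ^ 3 * \<beta> ^ 3" "u0 ^ 3 + v0 ^ 3 = (\<alpha> ^ 3 + \<beta> ^ 3) * (\<alpha> ^ 3 * \<beta> ^ 3)"
      "u0 ^ 3 = \<alpha> ^ 3 * (\<alpha> ^ 3 * \<beta> ^ 3)" unfolding u0_def v0_def by algebra+
    then show "u0 * v0 = h b" "u0 ^ 3 + v0 ^ 3 = - h a * h b" "u0 ^ 3 = \<alpha> ^ 3 * h b"
      by (simp_all only: cubes_prod cubes_sum)
  qed
  have "(h r - u0 - v0) * (h r - \<zeta> * u0 - \<zeta>\<^sup>2 * v0) * (h r - \<zeta>\<^sup>2 * u0 - \<zeta> * v0)
      = h r ^ 3 - 3 * (u0 * v0) * h r - (u0 ^ 3 + v0 ^ 3)"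
    using zeta_quadratic by algebra
  also have "\<dots> = 0" unfolding u0v0(1,2) using r by (simp add: algebra_simps)
  finally have "h r = zp Z0 * u0 + zp (neg3 Z0) * v0 \<or> h r = zp Z1 * u0 + zp (neg3 Z1) * v0 \<or>
      h r = zp Z2 * u0 + zp (neg3 Z2) * v0"
    by (auto simp: zp_simps diff_diff_eq)
  then obtain k where k: "h r = zp k * u0 + zp (neg3 k) * v0" by blast
  define u v where "u = zp k * u0" and "v = zp (neg3 k) * v0"
  have uv: "u + v = h r" "u * v = h b" "u ^ 3 = \<alpha> ^ 3 * h b"
  proof -
    show "u + v = h r" by (simp add: u_def v_def k)
    have "u * v = (zp (neg3 k) * zp k) * (u0 * v0)" by (simp add: u_def v_def mult_ac)
    then show "u * v = h b" by (simp add: zp_neg u0v0)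
    show "u ^ 3 = \<alpha> ^ 3 * h b" by (simp add: u_def power_mult_distrib zp_cubed u0v0)
  qed
  have hb: "h b \<noteq> 0" using b_neq_0 by (simp add: field_embedding_eq_0_iff[OF emb])
  have cube_notin: "\<alpha> ^ 3 * h b \<notin> range h"
  proof
    assume "\<alpha> ^ 3 * h b \<in> range h"
    then have "(\<alpha> ^ 3 * h b) / h b \<in> range h" by (intro is_subfield_divide[OF subfield_base]) auto
    then show False using hb cubes_notin(1) by simp
  qed
  \<comment> \<open>All of \<open>u + v\<close>, \<open>u * v\<close> and \<open>u ^ 3\<close> are
    known, so this expresses \<open>u\<close> rationally by elements of \<open>K1\<close>.\<close>
  have "((u + v)\<^sup>2 - u * v) * u = u ^ 3 + (u * v) * (u + v)" by algebra
  then have "((h r)\<^sup>2 - h b) * u = \<alpha> ^ 3 * h b + h b * h r" by (simp only: uv)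
  moreover have "(h r)\<^sup>2 - h b \<noteq> 0"
  proof
    assume "(h r)\<^sup>2 - h b = 0"
    then have "\<alpha> ^ 3 * h b = h (- b * r)" using calculation by (simp add: h_simps eq_neg_iff_add_eq_0)
    then show False using cube_notin by simp
  qed
  ultimately have "u = (\<alpha> ^ 3 * h b + h b * h r) / ((h r)\<^sup>2 - h b)" by (simp add: field_simps)
  moreover have "(\<alpha> ^ 3 * h b + h b * h r) / ((h r)\<^sup>2 - h b) \<in> K1"
    by (intro is_subfield_intros[OF subfield_K1] base_in_K1 cubes_in_K1)
  ultimately obtain p q where u: "u = h p + h q * \<delta>" using K1E by metis
  have "q \<noteq> 0"
  proof
    assume "q = 0"
    then have "\<alpha> ^ 3 * h b = h (p ^ 3)" using u uv(3) by (simp add: h_simps)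
    then show False using cube_notin by simp
  qed
  have v: "v = h (r - p) - h q * \<delta>" using uv(1) u by (simp add: h_simps algebra_simps)
  \<comment> \<open>Since \<open>u * v\<close> lies in K, its \<delta>-coordinate vanishes. This
    forces \<open>r = 2 * p\<close>, so \<open>v\<close> is the conjugate of
    \<open>u\<close>.\<close>
  have "h (p * (r - p) - q\<^sup>2 * (a\<^sup>2 - 4 * b)) + h (q * (r - 2 * p)) * \<delta> =
      h p * (h r - h p) - (h q)\<^sup>2 * \<delta>\<^sup>2 + h q * (h r - 2 * h p) * \<delta>"
    unfolding delta_squared h_simps ..
  also have "\<dots> = u * v" unfolding u v h_simps by algebra
  also have "\<dots> = h b + h 0 * \<delta>" by (simp add: uv(2) h_simps)
  finally have "q * (r - 2 * p) = 0" by (auto dest: K1_eqD)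
  then have "r = 2 * p" using \<open>q \<noteq> 0\<close> by simp
  then have "r - p = p" by (simp only: mult_2 add_diff_cancel)
  then have "v = h p - h q * \<delta>" using v by (simp only:)
  moreover have "v = \<alpha> * (\<beta> * zp k)\<^sup>2"
  proof -
    have "zp (neg3 k) = zp k ^ 2" using zp_neg[of k] zp_cubed[of k] by algebra
    then show ?thesis by (simp add: v_def v0_def power_mult_distrib mult_ac)
  qed
  moreover have "u = \<alpha>\<^sup>2 * (\<beta> * zp k)" by (simp add: u_def u0_def mult_ac)
  ultimately have "\<alpha>\<^sup>2 * (\<beta> * zp k) = h p + h q * \<delta>" "\<alpha> * (\<beta> * zp k)\<^sup>2 = h p - h q * \<delta>"
    using u by simp_all
  then show ?thesis by (rule that)
qed

subsection \<open>The three cases\<close>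

text \<open>For cases (A) and (B), where F = L(\<alpha>): a map multiplying \<alpha> by \<zeta> and
  fixing \<open>L\<close> confines \<open>x\<close> to \<open>L\<close>, and two sign changes
  confine it to K.\<close>

lemma fixed_in_base:
  assumes "M = UNIV" "\<And>g \<psi>. g \<in> set \<Gamma> \<Longrightarrow> realizes g \<psi> \<Longrightarrow> \<psi> x = x" "\<And>g. g \<in> set \<Gamma> \<Longrightarrow> \<exists>\<psi>. realizes g \<psi>"
    and "Aut Z1 j False False \<in> set \<Gamma>" "Aut Z0 Z0 False True \<in> set \<Gamma>" "Aut Z0 Z0 True False \<in> set \<Gamma>"
  shows "x \<in> range h"
proof -
  obtain \<psi> where \<psi>: "realizes (Aut Z1 j False False) \<psi>" using assms(3,4) by blast
  have "x \<in> L"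
  proof (rule fixed_in_cubic_ext[OF subfield_L cubes_in_L(1) _ zeta_in_L zeta_neq_1 zeta_sq_neq_1])
    show "x \<in> cubic_ext L \<alpha>" using assms(1) by (simp add: M_def)
    show "\<psi> \<alpha> = \<zeta> * \<alpha>" using \<psi> by (simp add: zp_simps)
  qed (use no_cube_root_in_L(1) realizes_emb[OF \<psi>] realizes_fixes_L[OF \<psi>] assms(2)[OF assms(4) \<psi>] in auto)
  moreover obtain \<psi>1 \<psi>2 where "realizes (Aut Z0 Z0 False True) \<psi>1" "realizes (Aut Z0 Z0 True False) \<psi>2"
    using assms(3)[OF assms(5)] assms(3)[OF assms(6)] by blast
  ultimately show ?thesis using assms(2)[OF assms(5)] assms(2)[OF assms(6)] by (intro fixed_in_L)
qed

text \<open>Two different combinations with equal value make \<kappa> a quotient of differences of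
  cube roots of unity, and in \<open>K1\<close> this leaves only \<kappa> = -1, which means a = 0.
  In that case \<open>zp m - zp n\<close> must determine its two terms, which it does for
  \<open>m \<noteq> n\<close>.\<close>

lemma lin_if_ratio_in_K1:
  assumes "\<kappa> \<in> K1" "\<beta> = \<kappa> * \<alpha>" "m \<noteq> n"
  shows "lin m n"
  unfolding lin_def
proof (intro allI impI)
  fix k l assume "zp k * \<alpha> + zp l * \<beta> = zp m * \<alpha> + zp n * \<beta>"
  then have "(zp k - zp m) * \<alpha> = (\<kappa> * (zp n - zp l)) * \<alpha>" unfolding assms(2) by (simp add: algebra_simps)
  then have eq: "zp k - zp m = \<kappa> * (zp n - zp l)" using roots_neq_0 by simp
  have cube: "\<kappa> ^ 3 \<noteq> 1" using cubes_neq by (auto simp: assms(2) power_mult_distrib)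
  have "\<kappa> \<noteq> 0" using roots_neq_0 assms(2) by auto
  show "k = m \<and> l = n"
  proof (cases "k = m")
    case True
    then show ?thesis using eq \<open>\<kappa> \<noteq> 0\<close> by (simp add: zp_eq_iff)
  next
    case False
    then have "zp k \<noteq> zp m" by (simp add: zp_eq_iff)
    then have "zp n \<noteq> zp l" using eq by auto
    \<comment> \<open>Sixth powers eliminate the unknown roots of unity and leave
      \<open>\<kappa> ^ 6 = 1\<close>. As \<open>\<kappa> ^ 3 \<noteq> 1\<close>, it follows that
      \<open>- \<kappa>\<close> is a cube root of unity in \<open>K1\<close>, hence 1.\<close>
    have "- 27 = \<kappa> ^ 6 * - 27"
      using arg_cong[OF eq, of "\<lambda>x. x ^ 6"] cube_roots_difference_power6[OF zp_cubed zp_cubed \<open>zp k \<noteq> zp m\<close>]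
        cube_roots_difference_power6[OF zp_cubed zp_cubed \<open>zp n \<noteq> zp l\<close>]
      by (simp add: power_mult_distrib)
    then have "3 * (3 * (3 * ((\<kappa> ^ 3 - 1) * (\<kappa> ^ 3 + 1)))) = 0" by algebra
    then have "(\<kappa> ^ 3 - 1) * (\<kappa> ^ 3 + 1) = 0" using three by (metis mult_eq_0_iff)
    then have "\<kappa> ^ 3 + 1 = 0" using cube by simp
    then have "(- \<kappa>) ^ 3 = 1 ^ 3" by (simp add: eq_neg_iff_add_eq_0 neg_eq_iff_add_eq_0)
    then obtain r where r: "- \<kappa> = zp r * 1" by (rule cube_eqE)
    moreover have "- \<kappa> \<in> K1" using assms(1) by (rule is_subfield_minus[OF subfield_K1])
    ultimately have "r = Z0" using zp_in_K1D by simp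
    then have "\<kappa> = - 1" using r by (metis zp_simps(1) mult_1 minus_equation_iff)
    then have "zp k - zp m = zp l - zp n" using eq by simp
    then have "zp m = zp n"
      using cube_roots_difference_eq[OF zp_cubed zp_cubed zp_cubed zp_cubed \<open>zp k \<noteq> zp m\<close> _ two three] by blast
    then show ?thesis using assms(3) by (simp add: zp_eq_iff)
  qed
qed

text \<open>Since \<open>\<alpha>\<^sup>2 * \<beta>\<close> lies in \<open>K1\<close>, \<beta> is a
  \<open>K1\<close>-multiple of \<alpha> and F = L(\<alpha>). The image of
  \<open>\<alpha>\<^sup>2 * \<beta>\<close> is prescribed on \<open>K1\<close>, so the image of
  \<alpha> determines that of \<beta>, with the same exponent.\<close>

lemma complete_table_A:
  assumes pq: "\<alpha>\<^sup>2 * \<beta> = h p + h q * \<delta>" "\<alpha> * \<beta>\<^sup>2 = h p - h q * \<delta>"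
    and s: "s\<^sup>2 = h (a\<^sup>2 - 4 * b)" and t: "t\<^sup>2 = h (- 3 * (a\<^sup>2 - 4 * b))"
  shows "complete_table h (map (\<lambda>(d, Ns, Us). (d, map (\<lambda>gs. adjoin h (ev s t ` set gs)) Ns,
      map (\<lambda>gs. adjoin h (ev s t ` set gs)) Us)) table_A)"
    and "card {E. strictly_intermediate h E} = length (table_gens table_A)"
proof -
  define \<kappa> where "\<kappa> = (h p + h q * \<delta>) / \<alpha> ^ 3"
  have "\<kappa> \<in> K1" unfolding \<kappa>_def
    by (intro is_subfield_intros[OF subfield_K1] base_in_K1 cubes_in_K1 delta_in_K1)
  have beta: "\<beta> = \<kappa> * \<alpha>"
    using roots_neq_0 by (simp add: \<kappa>_def power2_eq_square power3_eq_cube flip: pq(1))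
  have M: "M = UNIV"
    by (rule M_UNIV, subst beta) (intro is_subfield_mult[OF subfield_M] alpha_in_M L_in_M K1_in_L \<open>\<kappa> \<in> K1\<close>)
  have realized: "\<exists>\<psi>. realizes (Aut i i e d) \<psi>" for i e d
  proof -
    obtain \<psi> where \<psi>: "hom_on M \<psi>" "\<And>x. \<psi> (h x) = h x" "\<psi> \<zeta> = zp (sgn3 d Z1)"
      "\<psi> \<delta> = (if e then - \<delta> else \<delta>)" "\<psi> \<alpha> = zp i * (if e then \<beta> else \<alpha>)"
      using hom_on_M[where e = e and d = d and i = i] by blast
    have emb\<psi>: "field_embedding \<psi>" using \<psi>(1) by (simp add: M hom_on_UNIV)
    have "(\<psi> \<alpha>)\<^sup>2 * \<psi> \<beta> = \<psi> (\<alpha>\<^sup>2 * \<beta>)"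
      by (simp add: field_embedding_mult[OF emb\<psi>] field_embedding_power[OF emb\<psi>])
    also have "\<dots> = (if e then \<alpha> * \<beta>\<^sup>2 else \<alpha>\<^sup>2 * \<beta>)"
      unfolding pq by (simp add: field_embedding_add[OF emb\<psi>] field_embedding_mult[OF emb\<psi>] \<psi>)
    finally have eq: "(\<psi> \<alpha>)\<^sup>2 * \<psi> \<beta> = (if e then \<alpha> * \<beta>\<^sup>2 else \<alpha>\<^sup>2 * \<beta>)" .
    have "(\<psi> \<alpha>)\<^sup>2 * (zp i * (if e then \<alpha> else \<beta>)) = zp i ^ 3 * (if e then \<alpha> * \<beta>\<^sup>2 else \<alpha>\<^sup>2 * \<beta>)"
      unfolding \<psi>(5) by (cases e) (simp_all add: power2_eq_square power3_eq_cube mult_ac)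
    then have "(\<psi> \<alpha>)\<^sup>2 * \<psi> \<beta> = (\<psi> \<alpha>)\<^sup>2 * (zp i * (if e then \<alpha> else \<beta>))"
      unfolding eq zp_cubed by simp
    moreover have "(\<psi> \<alpha>)\<^sup>2 \<noteq> 0" unfolding \<psi>(5) using roots_neq_0 zp_neq_0 by auto
    ultimately have "\<psi> \<beta> = zp i * (if e then \<alpha> else \<beta>)" by (metis mult_left_cancel)
    then have "realizes (Aut i i e d) \<psi>" using emb\<psi> \<psi> by simp
    then show ?thesis by blast
  qed
  have exists: "\<exists>\<psi>. realizes g \<psi>" if g: "g \<in> set auts_A" for g
  proof -
    obtain i e d where "g = Aut i i e d" using g by (auto simp: auts_A_def)
    then show ?thesis using realized by metis
  qed
  have generic: "generic x" if "gs \<in> set (table_gens table_A)" "x \<in> set gs" for gs x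
    using that lin_if_ratio_in_K1[OF \<open>\<kappa> \<in> K1\<close> beta] by (auto simp: table_gens_def table_A_def)
  have fixed: "x \<in> range h" if x: "\<And>g \<psi>. g \<in> set auts_A \<Longrightarrow> realizes g \<psi> \<Longrightarrow> \<psi> x = x" for x
  proof (rule fixed_in_base[where \<Gamma> = auts_A and j = Z1, OF M])
    show "\<psi> x = x" if "g \<in> set auts_A" "realizes g \<psi>" for g \<psi> using that by (rule x)
    show "\<exists>\<psi>. realizes g \<psi>" if "g \<in> set auts_A" for g using that by (rule exists)
  qed (simp_all add: auts_A_def)
  note * = complete_table_if_realized[OF check_group_A checks_A s t exists fixed generic]
  show "complete_table h (map (\<lambda>(d, Ns, Us). (d, map (\<lambda>gs. adjoin h (ev s t ` set gs)) Ns,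
      map (\<lambda>gs. adjoin h (ev s t ` set gs)) Us)) table_A)" by (rule *(1))
  show "card {E. strictly_intermediate h E} = length (table_gens table_A)" by (rule *(2))
qed

text \<open>Since \<alpha>\<beta> lies in K, \<beta> is an \<open>L\<close>-multiple of
  \<open>\<alpha>\<^sup>2\<close>. So F = L(\<alpha>), while \<alpha> and \<beta> are independent
  over \<open>L\<close>; invariance of \<alpha>\<beta> makes the exponents opposite.\<close>

lemma complete_table_B:
  assumes c: "\<alpha> * \<beta> = h c"
    and s: "s\<^sup>2 = h (a\<^sup>2 - 4 * b)" and t: "t\<^sup>2 = h (- 3 * (a\<^sup>2 - 4 * b))"
  shows "complete_table h (map (\<lambda>(d, Ns, Us). (d, map (\<lambda>gs. adjoin h (ev s t ` set gs)) Ns,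
      map (\<lambda>gs. adjoin h (ev s t ` set gs)) Us)) table_B)"
    and "card {E. strictly_intermediate h E} = length (table_gens table_B)"
proof -
  have beta: "\<beta> = h c / \<alpha> ^ 3 * \<alpha>\<^sup>2"
    using roots_neq_0 by (simp add: power2_eq_square power3_eq_cube flip: c)
  have ratio: "h c / \<alpha> ^ 3 \<in> L" by (intro is_subfield_divide[OF subfield_L] base_in_L cubes_in_L)
  have M: "M = UNIV"
    by (rule M_UNIV, subst beta)
      (intro is_subfield_mult[OF subfield_M] is_subfield_power[OF subfield_M] alpha_in_M L_in_M ratio)
  have "indep" unfolding indep_def
  proof (intro ballI impI)
    fix u v assume uv: "u \<in> L" "v \<in> L" "u * \<alpha> + v * \<beta> = 0"
    then have "0 + u * \<alpha> + (v * (h c / \<alpha> ^ 3)) * \<alpha>\<^sup>2 = 0" by (subst (asm) beta) (simp add: mult.assoc)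
    then have "u = 0 \<and> v * (h c / \<alpha> ^ 3) = 0"
      using uv ratio is_subfield_0[OF subfield_L] is_subfield_mult[OF subfield_L] indep_M by blast
    moreover have "h c / \<alpha> ^ 3 \<noteq> 0" using roots_neq_0 by (simp flip: c)
    ultimately show "u = 0 \<and> v = 0" by simp
  qed
  have realized: "\<exists>\<psi>. realizes (Aut i (neg3 i) e d) \<psi>" for i e d
  proof -
    obtain \<psi> where \<psi>: "hom_on M \<psi>" "\<And>x. \<psi> (h x) = h x" "\<psi> \<zeta> = zp (sgn3 d Z1)"
      "\<psi> \<alpha> = zp i * (if e then \<beta> else \<alpha>)"
      using hom_on_M[where e = e and d = d and i = i] by blast
    have emb\<psi>: "field_embedding \<psi>" using \<psi>(1) by (simp add: M hom_on_UNIV)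
    have "\<psi> \<alpha> * \<psi> \<beta> = \<alpha> * \<beta>"
      using \<psi>(2)[of c] by (simp add: c flip: field_embedding_mult[OF emb\<psi>])
    also have "\<dots> = (zp (neg3 i) * zp i) * (\<alpha> * \<beta>)" by (simp add: zp_neg)
    also have "\<dots> = \<psi> \<alpha> * (zp (neg3 i) * (if e then \<alpha> else \<beta>))"
      unfolding \<psi>(4) by (cases e) (simp_all add: mult_ac)
    finally have "\<psi> \<alpha> * \<psi> \<beta> = \<psi> \<alpha> * (zp (neg3 i) * (if e then \<alpha> else \<beta>))" .
    moreover have "\<psi> \<alpha> \<noteq> 0" unfolding \<psi>(4) using roots_neq_0 zp_neq_0 by auto
    ultimately have "\<psi> \<beta> = zp (neg3 i) * (if e then \<alpha> else \<beta>)" by (metis mult_left_cancel)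
    then have "realizes (Aut i (neg3 i) e d) \<psi>" using emb\<psi> \<psi> by simp
    then show ?thesis by blast
  qed
  have exists: "\<exists>\<psi>. realizes g \<psi>" if g: "g \<in> set auts_B" for g
  proof -
    obtain i e d where "g = Aut i (neg3 i) e d" using g by (auto simp: auts_B_def simp del: neg3.simps)
    then show ?thesis using realized by metis
  qed
  have generic: "generic x" for x using \<open>indep\<close> lin_if_indep by (cases x) auto
  have fixed: "x \<in> range h" if x: "\<And>g \<psi>. g \<in> set auts_B \<Longrightarrow> realizes g \<psi> \<Longrightarrow> \<psi> x = x" for x
  proof (rule fixed_in_base[where \<Gamma> = auts_B and j = Z2, OF M])
    show "\<psi> x = x" if "g \<in> set auts_B" "realizes g \<psi>" for g \<psi> using that by (rule x)
    show "\<exists>\<psi>. realizes g \<psi>" if "g \<in> set auts_B" for g using that by (rule exists)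
  qed (simp_all add: auts_B_def)
  note * = complete_table_if_realized[OF check_group_B checks_B s t exists fixed generic]
  show "complete_table h (map (\<lambda>(d, Ns, Us). (d, map (\<lambda>gs. adjoin h (ev s t ` set gs)) Ns,
      map (\<lambda>gs. adjoin h (ev s t ` set gs)) Us)) table_B)" by (rule *(1))
  show "card {E. strictly_intermediate h E} = length (table_gens table_B)" by (rule *(2))
qed

section \<open>Case (C): \<beta> is a new cube root over L(\<alpha>)\<close>

lemma prod_notin_L:
  assumes "\<nexists>c. c ^ 3 = b" shows "\<alpha> * \<beta> \<notin> L"
proof
  assume "\<alpha> * \<beta> \<in> L"
  moreover have "(\<alpha> * \<beta>) ^ 3 = h b" by (simp add: power_mult_distrib cubes_prod)
  ultimately obtain y where "y \<in> K1" "y ^ 3 = h b"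
    using cube_root_in_quad_ext[OF subfield_K1 w_squared_in w_notin base_in_K1] L_def by metis
  then obtain x where "x \<in> range h" "x ^ 3 = h b"
    using cube_root_in_quad_ext[OF subfield_base delta_squared_in delta_notin rangeI] K1_def by metis
  then obtain c where "h (c ^ 3) = h b" by (auto simp: h_simps)
  then show False using assms by (simp only: field_embedding_eq_iff[OF emb]) blast
qed

text \<open>Otherwise \<open>\<alpha> ^ 3 * h b\<close> has a cube root \<open>x\<close> in
  \<open>K1\<close>. The cube of its norm \<open>N\<close> is \<open>b ^ 3\<close>, and K has no
  primitive cube root of unity, so \<open>N = b\<close>. Taking the trace of \<open>x ^ 3\<close>
  then shows that the trace \<open>2 * p\<close> of \<open>x\<close> is a root of R.\<close>

lemma alpha_sq_beta_notin_L:
  assumes "\<And>r. poly [:a * b, - 3 * b, 0, 1:] r \<noteq> 0" shows "\<alpha>\<^sup>2 * \<beta> \<notin> L"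
proof
  assume "\<alpha>\<^sup>2 * \<beta> \<in> L"
  moreover have "(\<alpha>\<^sup>2 * \<beta>) ^ 3 = \<alpha> ^ 3 * (\<alpha> ^ 3 * \<beta> ^ 3)" by algebra
  then have "(\<alpha>\<^sup>2 * \<beta>) ^ 3 = \<alpha> ^ 3 * h b" by (simp only: cubes_prod)
  moreover have "\<alpha> ^ 3 * h b \<in> K1" by (intro is_subfield_mult[OF subfield_K1] cubes_in_K1 base_in_K1)
  ultimately obtain x where x: "x \<in> K1" "x ^ 3 = \<alpha> ^ 3 * h b"
    using cube_root_in_quad_ext[OF subfield_K1 w_squared_in w_notin] L_def by metis
  obtain p q where pq: "x = h p + h q * \<delta>" using x(1) by (rule K1E)
  define D where "D = a\<^sup>2 - 4 * b"
  have "h (p ^ 3 + 3 * p * q\<^sup>2 * D) + h (3 * p\<^sup>2 * q + q ^ 3 * D) * \<delta> =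
      h p ^ 3 + 3 * h p * (h q)\<^sup>2 * \<delta>\<^sup>2 + (3 * (h p)\<^sup>2 * h q + h q ^ 3 * \<delta>\<^sup>2) * \<delta>"
    unfolding delta_squared D_def[symmetric] h_simps ..
  also have "\<dots> = x ^ 3" unfolding pq by algebra
  also have "\<dots> = h (- a / 2 * b) + h (1 / 2 * b) * \<delta>"
    unfolding x(2) alpha_cubed field_embedding_mult[OF emb] by algebra
  finally have coeffs: "p ^ 3 + 3 * p * q\<^sup>2 * D = - a / 2 * b" "3 * p\<^sup>2 * q + q ^ 3 * D = 1 / 2 * b"
    using K1_eqD by blast+
  have PQ: "2 * (p ^ 3 + 3 * p * q\<^sup>2 * D) = - a * b" "2 * (3 * p\<^sup>2 * q + q ^ 3 * D) = b"
    unfolding coeffs using two_base by simp_all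
  define N where "N = p\<^sup>2 - q\<^sup>2 * D"
  have "2 * (2 * N ^ 3) = 2 * (2 * b ^ 3)"
  proof -
    have "2 * (2 * N ^ 3) = (2 * (p ^ 3 + 3 * p * q\<^sup>2 * D))\<^sup>2 - D * (2 * (3 * p\<^sup>2 * q + q ^ 3 * D))\<^sup>2"
      unfolding N_def by algebra
    also have "\<dots> = (- a * b)\<^sup>2 - D * b\<^sup>2" unfolding PQ ..
    also have "\<dots> = 2 * (2 * b ^ 3)" unfolding D_def by algebra
    finally show ?thesis .
  qed
  then have "N ^ 3 = b ^ 3" by (metis mult_left_cancel two_base)
  then have "(N / b) ^ 3 = 1" using b_neq_0 by (simp add: power_divide)
  then have "N / b = 1" using zeta_notin unfolding primitive_cube_root_of_unity_def by blast
  then have "N = b" using b_neq_0 by simp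
  then have qD: "p\<^sup>2 - b = q\<^sup>2 * D" unfolding N_def by (simp add: algebra_simps)
  have "a * b - 3 * b * (2 * p) + (2 * p) ^ 3 = a * b + 2 * (p ^ 3 + 3 * p * (p\<^sup>2 - b))" by algebra
  also have "\<dots> = a * b + - a * b" unfolding qD PQ(1)[symmetric] by (simp add: mult.assoc)
  finally have "a * b - 3 * b * (2 * p) + (2 * p) ^ 3 = 0" by simp
  then have "poly [:a * b, - 3 * b, 0, 1:] (2 * p) = 0"
    by (simp add: algebra_simps power3_eq_cube)
  then show False using assms by blast
qed

text \<open>Kummer theory: if \<beta> were in \<open>M\<close>, the map \<alpha> \<mapsto>
  \<zeta>\<alpha> over \<open>L\<close> would multiply it by some \<open>zp k\<close>, so \<beta>
  would be a multiple over \<open>L\<close> of 1, \<alpha> or \<open>\<alpha>\<^sup>2\<close>. Then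
  \<beta>, \<open>\<alpha>\<^sup>2 * \<beta>\<close> or \<open>\<alpha> * \<beta>\<close> would lie
  in \<open>L\<close>.\<close>

lemma no_cube_root_in_M:
  assumes "\<alpha> * \<beta> \<notin> L" "\<alpha>\<^sup>2 * \<beta> \<notin> L" "y \<in> M" shows "y ^ 3 \<noteq> \<beta> ^ 3"
proof
  assume "y ^ 3 = \<beta> ^ 3"
  then obtain r where "\<beta> = zp r * y" using cube_eqE by metis
  then have "\<beta> \<in> M" using assms(3) zp_in_L L_in_M is_subfield_mult[OF subfield_M] by blast
  then obtain u v x where uvx: "u \<in> L" "v \<in> L" "x \<in> L" "\<beta> = u + v * \<alpha> + x * \<alpha>\<^sup>2"
    unfolding M_def cubic_ext_def by blast
  obtain \<psi> where \<psi>: "hom_on M \<psi>" "\<And>x. x \<in> L \<Longrightarrow> \<psi> x = x" "\<psi> \<alpha> = \<zeta> * \<alpha>"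
  proof -
    have "hom_on L id" by (simp add: hom_on_def)
    moreover have "(\<zeta> * \<alpha>) ^ 3 = id (\<alpha> ^ 3)" by (simp add: power_mult_distrib zeta_cubed)
    ultimately show ?thesis
      using hom_extends_cubic[OF subfield_L cubes_in_L(1) no_cube_root_in_L(1), of id "\<zeta> * \<alpha>"] that
      unfolding M_def by (metis id_apply)
  qed
  have img: "\<psi> \<beta> = u + (\<zeta> * v) * \<alpha> + (\<zeta>\<^sup>2 * x) * \<alpha>\<^sup>2"
    unfolding uvx(4) using uvx(1-3) L_in_M alpha_in_M \<psi>(2,3)
    by (simp add: hom_on_add[OF \<psi>(1)] hom_on_mult[OF \<psi>(1)] hom_on_power[OF \<psi>(1) subfield_M]
        is_subfield_add[OF subfield_M] is_subfield_mult[OF subfield_M] is_subfield_power[OF subfield_M]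
        power_mult_distrib mult_ac)
  have "(\<psi> \<beta>) ^ 3 = \<beta> ^ 3"
    using hom_on_power[OF \<psi>(1) subfield_M \<open>\<beta> \<in> M\<close>, of 3] \<psi>(2)[OF cubes_in_L(2)] by simp
  then obtain k where "\<psi> \<beta> = zp k * \<beta>" by (rule cube_eqE)
  then have "u + (\<zeta> * v) * \<alpha> + (\<zeta>\<^sup>2 * x) * \<alpha>\<^sup>2 = zp k * \<beta>" using img by simp
  also have "zp k * \<beta> = zp k * u + (zp k * v) * \<alpha> + (zp k * x) * \<alpha>\<^sup>2"
    by (subst uvx(4)) (simp add: algebra_simps)
  finally have "u + (\<zeta> * v) * \<alpha> + (\<zeta>\<^sup>2 * x) * \<alpha>\<^sup>2 = zp k * u + (zp k * v) * \<alpha> + (zp k * x) * \<alpha>\<^sup>2" .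
  moreover have "\<zeta> * v \<in> L" "\<zeta>\<^sup>2 * x \<in> L" "zp k * u \<in> L" "zp k * v \<in> L" "zp k * x \<in> L"
    using uvx(1-3) zeta_in_L zp_in_L by (auto intro!: is_subfield_mult[OF subfield_L] is_subfield_power[OF subfield_L])
  ultimately have "u = zp k * u \<and> \<zeta> * v = zp k * v \<and> \<zeta>\<^sup>2 * x = zp k * x"
    using uvx(1) by (intro cubic_ext_eqD[OF subfield_L cubes_in_L(1) no_cube_root_in_L(1)]) auto
  then have coeffs: "u = 0 \<or> k = Z0" "v = 0 \<or> k = Z1" "x = 0 \<or> k = Z2"
    using zp_eq_iff[of Z0 k] zp_eq_iff[of Z1 k] zp_eq_iff[of Z2 k] by (auto simp: zp_simps)
  show False
  proof (cases k)
    case Z0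
    then have "\<beta> = u" using coeffs uvx(4) by simp
    then show False using no_cube_root_in_L(2)[OF uvx(1)] by simp
  next
    case Z1
    then have "\<beta> = v * \<alpha>" using coeffs uvx(4) by simp
    then have "\<alpha>\<^sup>2 * \<beta> = v * \<alpha> ^ 3" by (simp add: power2_eq_square power3_eq_cube mult_ac)
    then show False using assms(2) uvx(2) cubes_in_L is_subfield_mult[OF subfield_L] by simp
  next
    case Z2
    then have "\<beta> = x * \<alpha>\<^sup>2" using coeffs uvx(4) by simp
    then have "\<alpha> * \<beta> = x * \<alpha> ^ 3" by (simp add: power2_eq_square power3_eq_cube mult_ac)
    then show False using assms(1) uvx(3) cubes_in_L is_subfield_mult[OF subfield_L] by simp
  qed
qed

text \<open>Here \<open>\<beta> ^ 3\<close> is not a cube in \<open>M\<close>, so any cube root of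
  its image extends the map from \<open>M\<close>, and \<open>i\<close> and \<open>j\<close> are
  independent. Fixed elements descend through one more level, from F to \<open>M\<close>.\<close>

lemma complete_table_C:
  assumes notin: "\<alpha> * \<beta> \<notin> L" "\<alpha>\<^sup>2 * \<beta> \<notin> L"
    and s: "s\<^sup>2 = h (a\<^sup>2 - 4 * b)" and t: "t\<^sup>2 = h (- 3 * (a\<^sup>2 - 4 * b))"
  shows "complete_table h (map (\<lambda>(d, Ns, Us). (d, map (\<lambda>gs. adjoin h (ev s t ` set gs)) Ns,
      map (\<lambda>gs. adjoin h (ev s t ` set gs)) Us)) table_C)"
    and "card {E. strictly_intermediate h E} = length (table_gens table_C)"
proof -
  note no_root = no_cube_root_in_M[OF notin]
  have beta3: "\<beta> ^ 3 \<in> M" using cubes_in_L L_in_M by blast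
  have UNIV: "cubic_ext M \<beta> = UNIV"
  proof (rule generated)
    show "is_subfield (cubic_ext M \<beta>)" by (rule is_subfield_cubic_ext[OF subfield_M beta3 no_root])
    show "range h \<subseteq> cubic_ext M \<beta>" "{\<alpha>, \<beta>, \<zeta>} \<subseteq> cubic_ext M \<beta>"
      using cubic_ext_base[OF subfield_M] cubic_ext_gen[OF subfield_M] L_in_M alpha_in_M base_in_L zeta_in_L
      by auto
  qed
  have "\<beta> \<notin> M" using no_root by blast
  have indep unfolding indep_def
  proof (intro ballI impI)
    fix u v assume uv: "u \<in> L" "v \<in> L" "u * \<alpha> + v * \<beta> = 0"
    have "u * \<alpha> \<in> M" "v \<in> M" using uv L_in_M alpha_in_M is_subfield_mult[OF subfield_M] by auto
    from quad_ext_indep[OF subfield_M \<open>\<beta> \<notin> M\<close> this uv(3)] show "u = 0 \<and> v = 0"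
      using roots_neq_0 by simp
  qed
  have realized: "\<exists>\<psi>. realizes (Aut i j e d) \<psi>" for i j e d
  proof -
    obtain \<psi> where \<psi>: "hom_on M \<psi>" "\<And>x. \<psi> (h x) = h x" "\<psi> \<zeta> = zp (sgn3 d Z1)"
      "\<psi> (\<beta> ^ 3) = (if e then \<alpha> ^ 3 else \<beta> ^ 3)" "\<psi> \<alpha> = zp i * (if e then \<beta> else \<alpha>)"
      using hom_on_M[where e = e and d = d and i = i] by blast
    have "(zp j * (if e then \<alpha> else \<beta>)) ^ 3 = \<psi> (\<beta> ^ 3)"
      by (simp add: \<psi>(4) power_mult_distrib zp_cubed)
    from hom_extends_cubic[OF subfield_M beta3 no_root \<psi>(1) this]
    obtain \<phi> where \<phi>: "hom_on UNIV \<phi>" "\<And>x. x \<in> M \<Longrightarrow> \<phi> x = \<psi> x" "\<phi> \<beta> = zp j * (if e then \<alpha> else \<beta>)"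
      unfolding UNIV by blast
    then have "realizes (Aut i j e d) \<phi>"
      using \<psi> L_in_M alpha_in_M base_in_L zeta_in_L by (simp add: hom_on_UNIV)
    then show ?thesis by blast
  qed
  have exists: "\<exists>\<psi>. realizes g \<psi>" for g using realized by (cases g) auto
  have generic: "generic x" for x using \<open>indep\<close> lin_if_indep by (cases x) auto
  have all: "Aut i j e d \<in> set auts_C" for i j e d
    by (cases i; cases j; cases e; cases d) (simp_all add: auts_C_def)
  have fixed: "x \<in> range h" if x: "\<And>g \<psi>. g \<in> set auts_C \<Longrightarrow> realizes g \<psi> \<Longrightarrow> \<psi> x = x" for x
  proof -
    obtain \<psi> where \<psi>: "realizes (Aut Z0 Z1 False False) \<psi>" using realized by blast
    have fix_M: "\<psi> y = y" if y: "y \<in> M" for y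
    proof -
      note emb\<psi> = realizes_emb[OF \<psi>]
      have "\<psi> \<alpha> = \<alpha>" using \<psi> by (simp add: zp_simps)
      then show ?thesis using y realizes_fixes_L[OF \<psi>] unfolding M_def cubic_ext_def
        by (auto simp: field_embedding_simps[OF emb\<psi>])
    qed
    have "x \<in> M"
    proof (rule fixed_in_cubic_ext[OF subfield_M beta3 no_root _ zeta_neq_1 zeta_sq_neq_1])
      show "x \<in> cubic_ext M \<beta>" by (simp add: UNIV)
      show "\<psi> \<beta> = \<zeta> * \<beta>" using \<psi> by (simp add: zp_simps)
    qed (use fix_M realizes_emb[OF \<psi>] x[OF all \<psi>] zeta_in_L L_in_M in auto)
    obtain \<phi> where \<phi>: "realizes (Aut Z1 Z0 False False) \<phi>" using realized by blast
    have "x \<in> L"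
    proof (rule fixed_in_cubic_ext[OF subfield_L cubes_in_L(1) _ zeta_in_L zeta_neq_1 zeta_sq_neq_1])
      show "x \<in> cubic_ext L \<alpha>" using \<open>x \<in> M\<close> by (simp add: M_def)
      show "\<phi> \<alpha> = \<zeta> * \<alpha>" using \<phi> by (simp add: zp_simps)
    qed (use no_cube_root_in_L(1) realizes_emb[OF \<phi>] realizes_fixes_L[OF \<phi>] x[OF all \<phi>] in auto)
    moreover obtain \<psi>1 \<psi>2 where "realizes (Aut Z0 Z0 False True) \<psi>1" "realizes (Aut Z0 Z0 True False) \<psi>2"
      using realized by blast
    ultimately show ?thesis using x[OF all] by (intro fixed_in_L)
  qed
  note * = complete_table_if_realized[OF check_group_C checks_C s t exists fixed generic]
  show "complete_table h (map (\<lambda>(d, Ns, Us). (d, map (\<lambda>gs. adjoin h (ev s t ` set gs)) Ns,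
      map (\<lambda>gs. adjoin h (ev s t ` set gs)) Us)) table_C)" by (rule *(1))
  show "card {E. strictly_intermediate h E} = length (table_gens table_C)" by (rule *(2))
qed

end

context sextic
begin

text \<open>The cubes put \<delta> into both K(\<alpha>) and K(\<open>\<beta>'\<close>). The two
  relations then express \<open>\<beta>'\<close> through \<alpha> and \<alpha> through
  \<open>\<beta>'\<close>.\<close>

lemma adjoin_eq_if_resolvent:
  assumes pq: "\<alpha>\<^sup>2 * \<beta>' = h p + h q * \<delta>" "\<alpha> * \<beta>'\<^sup>2 = h p - h q * \<delta>" and "\<beta>' ^ 3 = \<beta> ^ 3"
  shows "\<alpha> * \<beta>' \<in> adjoin h {\<alpha>} \<and> adjoin h {\<alpha>} = adjoin h {\<beta>'}"
proof -
  note sub = is_subfield_adjoin[of h]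
  have gen: "\<alpha> \<in> adjoin h {\<alpha>}" "\<beta>' \<in> adjoin h {\<beta>'}" by (simp_all add: adjoin_gen)
  have base: "range h \<subseteq> adjoin h S" for S by (auto simp: adjoin_base)
  have "\<beta>' \<noteq> 0" using assms(3) roots_neq_0 by auto
  have "\<delta> \<in> adjoin h {\<alpha>}"
    using K1_subset[OF sub base] delta_in_K1 is_subfield_power[OF sub gen(1)] by blast
  then have "(h p + h q * \<delta>) / \<alpha>\<^sup>2 \<in> adjoin h {\<alpha>}"
    using gen(1) adjoin_base[of h] by (auto intro!: is_subfield_intros[OF sub])
  then have \<beta>': "\<beta>' \<in> adjoin h {\<alpha>}" using roots_neq_0 by (simp flip: pq(1))
  have "\<beta> ^ 3 \<in> adjoin h {\<beta>'}" using is_subfield_power[OF sub gen(2), of 3] by (simp add: assms(3))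
  then have "\<delta> \<in> adjoin h {\<beta>'}" using K1_subset[OF sub base] delta_in_K1 by blast
  then have "(h p - h q * \<delta>) / \<beta>'\<^sup>2 \<in> adjoin h {\<beta>'}"
    using gen(2) adjoin_base[of h] by (auto intro!: is_subfield_intros[OF sub])
  then have "\<alpha> \<in> adjoin h {\<beta>'}" using \<open>\<beta>' \<noteq> 0\<close> by (simp flip: pq(2))
  then have "adjoin h {\<alpha>} = adjoin h {\<beta>'}"
    using \<beta>' by (intro equalityI adjoin_least sub base) auto
  then show ?thesis using is_subfield_mult[OF sub gen(1) \<beta>'] by simp
qed

section \<open>The tables in explicit form\<close>

lemma table_A_fields:
  "map (\<lambda>(d, Ns, Us). (d, map (\<lambda>gs. adjoin h (ev s t ` set gs)) Ns,
     map (\<lambda>gs. adjoin h (ev s t ` set gs)) Us)) table_A =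
   [(2, [adjoin h {s}, adjoin h {\<zeta>}, adjoin h {t}], []),
    (3, [], [adjoin h {\<alpha> * \<beta>}, adjoin h {\<alpha> * \<beta> * \<zeta>}, adjoin h {\<alpha> * \<beta> * \<zeta>\<^sup>2}]),
    (4, [adjoin h {s, \<zeta>}], []),
    (6, [adjoin h {\<zeta>, \<alpha> * \<beta>}],
      [adjoin h {\<alpha>}, adjoin h {\<alpha> * \<zeta>}, adjoin h {\<alpha> * \<zeta>\<^sup>2},
       adjoin h {\<alpha> * \<zeta> + \<beta> * \<zeta>\<^sup>2}, adjoin h {\<alpha> + \<beta> * \<zeta>}, adjoin h {\<alpha> + \<beta> * \<zeta>\<^sup>2}])]"
  by (simp add: table_A_def zp_simps)

lemma table_B_fields:
  "map (\<lambda>(d, Ns, Us). (d, map (\<lambda>gs. adjoin h (ev s t ` set gs)) Ns,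
     map (\<lambda>gs. adjoin h (ev s t ` set gs)) Us)) table_B =
   [(2, [adjoin h {s}, adjoin h {\<zeta>}, adjoin h {t}], []),
    (3, [], [adjoin h {\<alpha> + \<beta>}, adjoin h {\<alpha> * \<zeta> + \<beta> * \<zeta>\<^sup>2}, adjoin h {\<alpha> * \<zeta>\<^sup>2 + \<beta> * \<zeta>}]),
    (4, [adjoin h {s, \<zeta>}], []),
    (6, [adjoin h {t, \<alpha> + \<beta>}],
      [adjoin h {\<alpha>}, adjoin h {\<alpha> * \<zeta>}, adjoin h {\<alpha> * \<zeta>\<^sup>2},
       adjoin h {\<zeta>, \<alpha> + \<beta>}, adjoin h {\<zeta>, \<alpha> * \<zeta> + \<beta> * \<zeta>\<^sup>2}, adjoin h {\<zeta>, \<alpha> * \<zeta>\<^sup>2 + \<beta> * \<zeta>}])]"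
  by (simp add: table_B_def zp_simps)

lemma table_C_fields:
  "map (\<lambda>(d, Ns, Us). (d, map (\<lambda>gs. adjoin h (ev s t ` set gs)) Ns,
     map (\<lambda>gs. adjoin h (ev s t ` set gs)) Us)) table_C =
   (let K = adjoin h; c = \<alpha> * \<beta>; \<rho>\<^sub>0 = c * (\<alpha> + \<beta>); \<rho>\<^sub>1 = c * (\<alpha> * \<zeta> + \<beta> * \<zeta>\<^sup>2);
        \<rho>\<^sub>2 = c * (\<alpha> * \<zeta>\<^sup>2 + \<beta> * \<zeta>)
    in
     [(2, [K {\<zeta>}, K {t}, K {s}], []),
      (3, [], [K {c * \<zeta> ^ i}. i \<leftarrow> [0..<3]] @ [K {\<rho>}. \<rho> \<leftarrow> [\<rho>\<^sub>0, \<rho>\<^sub>1, \<rho>\<^sub>2]]),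
      (4, [K {s, \<zeta>}], []),
      (6, [K {\<zeta>, c}, K {t, \<rho>\<^sub>0}],
          [K {\<zeta>, \<rho>}. \<rho> \<leftarrow> [\<rho>\<^sub>0, \<rho>\<^sub>1, \<rho>\<^sub>2]] @
          [K {t, c * \<zeta> ^ i}. i \<leftarrow> [0..<3]] @
          [K {s, c * \<zeta> ^ i}. i \<leftarrow> [0..<3]] @
          [K {s, \<rho>}. \<rho> \<leftarrow> [\<rho>\<^sub>0, \<rho>\<^sub>1, \<rho>\<^sub>2]] @
          [K {\<alpha> * \<zeta> ^ i}. i \<leftarrow> [0..<3]] @
          [K {\<beta> * \<zeta> ^ i}. i \<leftarrow> [0..<3]]),
      (9, [], [K {\<alpha> * \<zeta> ^ i + \<beta> * \<zeta> ^ j}. i \<leftarrow> [0..<3], j \<leftarrow> [0..<3]]),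
      (12, [K {s, \<zeta>, c}, K {s, \<zeta>, \<rho>\<^sub>0}], [K {\<zeta>, \<alpha>}, K {\<zeta>, \<beta>}]),
      (18, [],
          [K {\<alpha> * \<zeta> ^ i, \<beta> * \<zeta> ^ j}. i \<leftarrow> [0..<3], j \<leftarrow> [0..<3]] @
          [K {\<zeta>, \<alpha> + \<beta> * \<zeta> ^ i}. i \<leftarrow> [0..<3]] @
          [K {\<zeta> ^ i * (\<zeta> - 1) * (\<alpha> - \<beta>)}. i \<leftarrow> [0..<3]])])"
  by (simp add: table_C_def zp_simps zeta_mult(1) Let_def upt_rec)

lemma card_table_gens:
  "length (table_gens table_A) = 14" "length (table_gens table_B) = 14" "length (table_gens table_C) = 58"
  by (simp_all add: table_gens_def table_A_def table_B_def table_C_def)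

end

section \<open>Roots in the splitting field and the final assembly\<close>

lemma poly_divisor_has_root:
  fixes p :: "'a::field poly"
  assumes "p dvd (\<Prod>r\<leftarrow>rs. [:- r, 1:])" "degree p > 0"
  obtains x where "poly p x = 0"
proof -
  have "\<exists>x. poly p x = 0" using assms
  proof (induction rs)
    case Nil
    then have "p \<noteq> 0" "is_unit p" by auto
    then show ?case using Nil by (simp add: is_unit_iff_degree)
  next
    case (Cons r rs)
    show ?case
    proof (cases "poly p r = 0")
      case False
      obtain k where k: "[:- r, 1:] * (\<Prod>r\<leftarrow>rs. [:- r, 1:]) = p * k" using Cons.prems(1) by auto
      then have "poly p r * poly k r = 0" by (metis poly_mult poly_eq_0_iff_dvd dvd_triv_left)
      then obtain k' where "k = [:- r, 1:] * k'" using False by (auto simp: poly_eq_0_iff_dvd)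
      then have "[:- r, 1:] * (\<Prod>r\<leftarrow>rs. [:- r, 1:]) = [:- r, 1:] * (p * k')" using k by (metis mult.left_commute)
      then have "(\<Prod>r\<leftarrow>rs. [:- r, 1:]) = p * k'" by (subst (asm) mult_left_cancel) auto
      then show ?thesis using Cons.IH Cons.prems(2) by simp
    qed blast
  qed
  then show ?thesis using that by blast
qed

lemma of_nat_prime_neq_0:
  assumes "prime p" "CHAR('a::field) \<noteq> p" shows "of_nat p \<noteq> (0 :: 'a)"
proof
  assume "of_nat p = (0 :: 'a)"
  then have "CHAR('a) dvd p" by (simp add: of_nat_eq_0_iff_char_dvd)
  then have "CHAR('a) = 1" using assms by (metis prime_nat_iff)
  then show False using of_nat_CHAR[where 'a = 'a] by simp
qed

text \<open>The existence claims at the start ensure that the universally quantified part is not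
  vacuous; likewise in cases (A) and (B) a choice of \<beta> as described is shown to exist before
  the table is given for every such choice.\<close>

theorem mainTheorem5:
  fixes h :: "'k::field \<Rightarrow> 'f::field"
    and a b \<Delta> :: 'k
    and f R :: "'k poly"
  assumes embedding: "field_embedding h"
    and char: "CHAR('k) \<noteq> 2" "CHAR('k) \<noteq> 3"
    and zeta_notin: "\<not> (\<exists>z::'k. primitive_cube_root_of_unity z)"
    and f_def: "f = [:b, 0, 0, a, 0, 0, 1:]"
    and irred: "irreducible f"
    and splitting: "is_splitting_field h f"
    and Delta_def: "\<Delta> = a\<^sup>2 - 4 * b"
    and R_def: "R = [:a * b, - 3 * b, 0, 1:]"
    and Delta_neq: "\<forall>n::'k. \<Delta> \<noteq> - 3 * n\<^sup>2"
  shows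
    "(\<exists>\<zeta>::'f. primitive_cube_root_of_unity \<zeta>) \<and>
     (\<exists>s::'f. s\<^sup>2 = h \<Delta>) \<and> (\<exists>t::'f. t\<^sup>2 = h (- 3 * \<Delta>)) \<and>
     (\<exists>\<alpha> \<beta>. poly (map_poly h f) \<alpha> = 0 \<and> poly (map_poly h f) \<beta> = 0 \<and> \<alpha> ^ 3 \<noteq> \<beta> ^ 3) \<and>
     (\<forall>\<zeta> s t \<alpha> \<beta> :: 'f.
        primitive_cube_root_of_unity \<zeta> \<and> s\<^sup>2 = h \<Delta> \<and> t\<^sup>2 = h (- 3 * \<Delta>) \<and>
        poly (map_poly h f) \<alpha> = 0 \<and> poly (map_poly h f) \<beta> = 0 \<and> \<alpha> ^ 3 \<noteq> \<beta> ^ 3 \<longrightarrow>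
        (let K = adjoin h; c = \<alpha> * \<beta> in
         \<comment> \<open>Case (A)\<close>
         (\<not> (\<exists>d::'k. d ^ 3 = b) \<and> \<not> irreducible R \<longrightarrow>
            (\<exists>i<3. \<alpha> * (\<beta> * \<zeta> ^ i) \<in> K {\<alpha>} \<and> K {\<alpha>} = K {\<beta> * \<zeta> ^ i}) \<and>
            (\<alpha> * \<beta> \<in> K {\<alpha>} \<and> K {\<alpha>} = K {\<beta>} \<longrightarrow>
               card {E. strictly_intermediate h E} = 14 \<and>
               complete_table h
                [(2, [K {s}, K {\<zeta>}, K {t}], []),
                 (3, [], [K {c}, K {c * \<zeta>}, K {c * \<zeta>\<^sup>2}]),
                 (4, [K {s, \<zeta>}], []),
                 (6, [K {\<zeta>, c}],
                     [K {\<alpha>}, K {\<alpha> * \<zeta>}, K {\<alpha> * \<zeta>\<^sup>2},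
                      K {\<alpha> * \<zeta> + \<beta> * \<zeta>\<^sup>2}, K {\<alpha> + \<beta> * \<zeta>}, K {\<alpha> + \<beta> * \<zeta>\<^sup>2}])])) \<and>
         \<comment> \<open>Case (B)\<close>
         ((\<exists>d::'k. d ^ 3 = b) \<and> irreducible R \<longrightarrow>
            (\<exists>i<3. \<alpha> * (\<beta> * \<zeta> ^ i) \<in> range h) \<and>
            (\<alpha> * \<beta> \<in> range h \<longrightarrow>
               card {E. strictly_intermediate h E} = 14 \<and>
               complete_table h
                [(2, [K {s}, K {\<zeta>}, K {t}], []),
                 (3, [], [K {\<alpha> + \<beta>}, K {\<alpha> * \<zeta> + \<beta> * \<zeta>\<^sup>2}, K {\<alpha> * \<zeta>\<^sup>2 + \<beta> * \<zeta>}]),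
                 (4, [K {s, \<zeta>}], []),
                 (6, [K {t, \<alpha> + \<beta>}],
                     [K {\<alpha>}, K {\<alpha> * \<zeta>}, K {\<alpha> * \<zeta>\<^sup>2},
                      K {\<zeta>, \<alpha> + \<beta>}, K {\<zeta>, \<alpha> * \<zeta> + \<beta> * \<zeta>\<^sup>2}, K {\<zeta>, \<alpha> * \<zeta>\<^sup>2 + \<beta> * \<zeta>}])])) \<and>
         \<comment> \<open>Case (C)\<close>
         (\<not> (\<exists>d::'k. d ^ 3 = b) \<and> irreducible R \<longrightarrow>
            (let \<rho>\<^sub>0 = c * (\<alpha> + \<beta>);
                 \<rho>\<^sub>1 = c * (\<alpha> * \<zeta> + \<beta> * \<zeta>\<^sup>2);
                 \<rho>\<^sub>2 = c * (\<alpha> * \<zeta>\<^sup>2 + \<beta> * \<zeta>)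
             in
               card {E. strictly_intermediate h E} = 58 \<and>
               complete_table h
                [(2, [K {\<zeta>}, K {t}, K {s}], []),
                 (3, [], [K {c * \<zeta> ^ i}. i \<leftarrow> [0..<3]] @ [K {\<rho>}. \<rho> \<leftarrow> [\<rho>\<^sub>0, \<rho>\<^sub>1, \<rho>\<^sub>2]]),
                 (4, [K {s, \<zeta>}], []),
                 (6, [K {\<zeta>, c}, K {t, \<rho>\<^sub>0}],
                     [K {\<zeta>, \<rho>}. \<rho> \<leftarrow> [\<rho>\<^sub>0, \<rho>\<^sub>1, \<rho>\<^sub>2]] @
                     [K {t, c * \<zeta> ^ i}. i \<leftarrow> [0..<3]] @
                     [K {s, c * \<zeta> ^ i}. i \<leftarrow> [0..<3]] @
                     [K {s, \<rho>}. \<rho> \<leftarrow> [\<rho>\<^sub>0, \<rho>\<^sub>1, \<rho>\<^sub>2]] @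
                     [K {\<alpha> * \<zeta> ^ i}. i \<leftarrow> [0..<3]] @
                     [K {\<beta> * \<zeta> ^ i}. i \<leftarrow> [0..<3]]),
                 (9, [], [K {\<alpha> * \<zeta> ^ i + \<beta> * \<zeta> ^ j}. i \<leftarrow> [0..<3], j \<leftarrow> [0..<3]]),
                 (12, [K {s, \<zeta>, c}, K {s, \<zeta>, \<rho>\<^sub>0}], [K {\<zeta>, \<alpha>}, K {\<zeta>, \<beta>}]),
                 (18, [],
                     [K {\<alpha> * \<zeta> ^ i, \<beta> * \<zeta> ^ j}. i \<leftarrow> [0..<3], j \<leftarrow> [0..<3]] @
                     [K {\<zeta>, \<alpha> + \<beta> * \<zeta> ^ i}. i \<leftarrow> [0..<3]] @
                     [K {\<zeta> ^ i * (\<zeta> - 1) * (\<alpha> - \<beta>)}. i \<leftarrow> [0..<3]])]))))"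
proof -
  have two: "(2 :: 'k) \<noteq> 0" using of_nat_prime_neq_0[of 2, where 'a = 'k] char(1) by simp
  have three: "(3 :: 'k) \<noteq> 0" using of_nat_prime_neq_0[of 3, where 'a = 'k] char(2) by simp
  have three': "(3 :: 'f) \<noteq> 0"
    using three field_embedding_eq_0_iff[OF embedding, of 3] by (simp add: field_embedding_numeral[OF embedding])
  have Delta_neq': "a\<^sup>2 - 4 * b \<noteq> - 3 * n\<^sup>2" for n using Delta_neq Delta_def by simp
  have root_iff: "poly (map_poly h f) x = 0 \<longleftrightarrow> x ^ 6 + h a * x ^ 3 + h b = 0" for x
  proof -
    have "poly (map_poly h f) x = x ^ 6 + h a * x ^ 3 + h b"
      by (simp add: f_def map_poly_embedding_pCons[OF embedding] field_embedding_simps[OF embedding]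
          algebra_simps eval_nat_numeral)
    then show ?thesis by simp
  qed
  have sextic: "sextic h a b \<zeta> \<alpha> \<beta>"
    if \<zeta>: "primitive_cube_root_of_unity \<zeta>" and roots: "poly (map_poly h f) \<alpha> = 0" "poly (map_poly h f) \<beta> = 0"
      and neq: "\<alpha> ^ 3 \<noteq> \<beta> ^ 3" for \<zeta> \<alpha> \<beta>
  proof
    fix E assume E: "is_subfield E" "range h \<subseteq> E" "{\<alpha>, \<beta>, \<zeta>} \<subseteq> E"
    have \<zeta>2: "\<zeta>\<^sup>2 + \<zeta> + 1 = 0" using \<zeta> primitive_cube_root_of_unity_iff[OF three'] by simp
    \<comment> \<open>As \<zeta> lies in \<open>E\<close>, one cube root in \<open>E\<close> brings
      the other two. Every root of f has the same cube as \<alpha> or \<beta>, so all roots lie in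
      \<open>E\<close>.\<close>
    have cube: "x \<in> E" if "x ^ 3 = y ^ 3" "y \<in> E" for x y
    proof -
      have "(x - y) * (x - \<zeta> * y) * (x - \<zeta>\<^sup>2 * y) = x ^ 3 - y ^ 3" using \<zeta>2 by algebra
      then have "x = y \<or> x = \<zeta> * y \<or> x = \<zeta>\<^sup>2 * y" using that(1) by auto
      then show ?thesis using that(2) E(3) by (auto intro!: is_subfield_intros[OF E(1)])
    qed
    have "{x. poly (map_poly h f) x = 0} \<subseteq> E"
    proof
      fix x assume "x \<in> {x. poly (map_poly h f) x = 0}"
      then have x: "x ^ 6 + h a * x ^ 3 + h b = 0" by (simp add: root_iff)
      have "(\<alpha> ^ 3 - \<beta> ^ 3) * (\<alpha> ^ 3 + \<beta> ^ 3 + h a) = 0"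
        using roots unfolding root_iff by algebra
      then have "\<alpha> ^ 3 + \<beta> ^ 3 + h a = 0" using neq by simp
      then have "(x ^ 3 - \<alpha> ^ 3) * (x ^ 3 - \<beta> ^ 3) = 0" using x roots unfolding root_iff by algebra
      then have "x ^ 3 = \<alpha> ^ 3 \<or> x ^ 3 = \<beta> ^ 3" by simp
      then show "x \<in> E" using cube E(3) by blast
    qed
    then have "adjoin h {x. poly (map_poly h f) x = 0} \<subseteq> E" using E by (intro adjoin_least)
    then show "E = UNIV" using splitting unfolding is_splitting_field_def by blast
  qed (use embedding two three zeta_notin irred f_def Delta_neq' \<zeta> roots neq root_iff in auto)
  obtain rs where rs: "map_poly h f = (\<Prod>r\<leftarrow>rs. [:- r, 1:])"
    using splitting by (auto simp: is_splitting_field_def splits_in_def f_def field_embedding_1[OF embedding])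
  have deg: "degree (map_poly h f) = 6" by (simp add: degree_map_poly_embedding[OF embedding] f_def)
  obtain \<alpha> where \<alpha>: "poly (map_poly h f) \<alpha> = 0"
    using poly_divisor_has_root[of "map_poly h f" rs] rs deg by auto
  have "\<alpha> \<noteq> 0"
  proof
    assume "\<alpha> = 0"
    then have "b = 0" using \<alpha> by (simp add: root_iff field_embedding_eq_0_iff[OF embedding])
    then have "poly f 0 = 0" by (simp add: f_def)
    then show False using irreducible_no_root[OF irred] by (simp add: f_def)
  qed
  \<comment> \<open>\<open>B\<close> is the second root of \<open>y\<^sup>2 + h a * y + h b\<close>,
    so f is the product of \<open>x ^ 3 - \<alpha> ^ 3\<close> and \<open>x ^ 3 - B\<close>. Since f
    splits over F, the second factor supplies \<beta>.\<close>
  define B where "B = - h a - \<alpha> ^ 3"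
  have AB: "\<alpha> ^ 3 * B = h b" using \<alpha> unfolding root_iff B_def by algebra
  have ha: "h a = - B - \<alpha> ^ 3" by (simp add: B_def)
  have factor: "map_poly h f = [:- (\<alpha> ^ 3), 0, 0, 1:] * [:- B, 0, 0, 1:]"
    by (simp add: f_def map_poly_embedding_pCons[OF embedding] field_embedding_0[OF embedding]
        field_embedding_1[OF embedding] ha flip: AB)
  obtain \<beta> where \<beta>: "\<beta> ^ 3 = B"
  proof (rule poly_divisor_has_root[of "[:- B, 0, 0, 1:]" rs])
    show "[:- B, 0, 0, 1:] dvd (\<Prod>r\<leftarrow>rs. [:- r, 1:])" unfolding rs[symmetric] factor by (rule dvd_triv_right)
    fix x assume "poly [:- B, 0, 0, 1:] x = 0"
    then have "x ^ 3 = B" by (simp add: power3_eq_cube mult.assoc)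
    then show thesis by (rule that)
  qed simp
  have root_beta: "poly (map_poly h f) \<beta> = 0"
    unfolding factor by (simp add: \<beta>[symmetric] power3_eq_cube)
  \<comment> \<open>Equal cubes would mean \<Delta> = 0, which is the excluded form
    \<open>- 3 * n\<^sup>2\<close> with \<open>n = 0\<close>.\<close>
  have neq: "\<alpha> ^ 3 \<noteq> \<beta> ^ 3"
  proof
    assume "\<alpha> ^ 3 = \<beta> ^ 3"
    then have "h (a\<^sup>2 - 4 * b) = h 0"
      using AB \<beta> unfolding B_def field_embedding_simps[OF embedding] by algebra
    then have "a\<^sup>2 - 4 * b = - 3 * 0\<^sup>2" by (simp add: field_embedding_eq_iff[OF embedding])
    then show False using Delta_neq' by blast
  qed
  \<comment> \<open>\<zeta> is found as a ratio of roots: \<open>x ^ 3 - \<alpha> ^ 3\<close> has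
    the factor \<open>x\<^sup>2 + \<alpha> * x + \<alpha>\<^sup>2\<close>, whose roots divided by
    \<alpha> satisfy \<open>z\<^sup>2 + z + 1 = 0\<close>.\<close>
  obtain \<zeta> where \<zeta>: "primitive_cube_root_of_unity (\<zeta> :: 'f)"
  proof (rule poly_divisor_has_root[of "[:\<alpha>\<^sup>2, \<alpha>, 1:]" rs])
    have "[:- (\<alpha> ^ 3), 0, 0, 1:] = [:\<alpha>\<^sup>2, \<alpha>, 1:] * [:- \<alpha>, 1:]"
      by (simp add: power3_eq_cube power2_eq_square)
    then show "[:\<alpha>\<^sup>2, \<alpha>, 1:] dvd (\<Prod>r\<leftarrow>rs. [:- r, 1:])"
      unfolding rs[symmetric] factor by (metis dvd_triv_left dvd_mult2)
    fix x assume "poly [:\<alpha>\<^sup>2, \<alpha>, 1:] x = 0"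
    then have "\<alpha>\<^sup>2 + x * (\<alpha> + x) = 0" by simp
    then have "(x / \<alpha>)\<^sup>2 + x / \<alpha> + 1 = 0" using \<open>\<alpha> \<noteq> 0\<close> by (simp add: field_simps power2_eq_square)
    then have "primitive_cube_root_of_unity (x / \<alpha>)" using primitive_cube_root_of_unity_iff[OF three'] by blast
    then show thesis by (rule that)
  qed simp
  interpret F: sextic h a b \<zeta> \<alpha> \<beta> by (rule sextic[OF \<zeta> \<alpha> root_beta neq])
  have s: "F.\<delta>\<^sup>2 = h \<Delta>" by (simp add: F.delta_squared Delta_def)
  have t: "(F.w * F.\<delta>)\<^sup>2 = h (- 3 * \<Delta>)"
    unfolding power_mult_distrib F.w_squared s by (simp add: field_embedding_simps[OF embedding])
  show ?thesis
  proof (intro conjI allI impI)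
    show "\<exists>\<zeta>::'f. primitive_cube_root_of_unity \<zeta>" using \<zeta> by blast
    show "\<exists>s::'f. s\<^sup>2 = h \<Delta>" using s by blast
    show "\<exists>t::'f. t\<^sup>2 = h (- 3 * \<Delta>)" using t by blast
    show "\<exists>\<alpha> \<beta>. poly (map_poly h f) \<alpha> = 0 \<and> poly (map_poly h f) \<beta> = 0 \<and> \<alpha> ^ 3 \<noteq> \<beta> ^ 3"
      using \<alpha> root_beta neq by blast
  next
    fix \<zeta> s t \<alpha> \<beta> :: 'f
    assume hyps: "primitive_cube_root_of_unity \<zeta> \<and> s\<^sup>2 = h \<Delta> \<and> t\<^sup>2 = h (- 3 * \<Delta>) \<and>
      poly (map_poly h f) \<alpha> = 0 \<and> poly (map_poly h f) \<beta> = 0 \<and> \<alpha> ^ 3 \<noteq> \<beta> ^ 3"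
    interpret sextic h a b \<zeta> \<alpha> \<beta> using hyps by (intro sextic) auto
    have st: "s\<^sup>2 = h (a\<^sup>2 - 4 * b)" "t\<^sup>2 = h (- 3 * (a\<^sup>2 - 4 * b))" using hyps by (simp_all add: Delta_def)
    have resolvent: "\<exists>k p q. \<alpha>\<^sup>2 * (\<beta> * zp k) = h p + h q * \<delta> \<and> \<alpha> * (\<beta> * zp k)\<^sup>2 = h p - h q * \<delta>"
      if red: "\<not> irreducible R"
    proof -
      obtain r where "poly R r = 0" using cubic_root_if_reducible[OF red] by (auto simp: R_def)
      then show ?thesis using resolvent_roots[of r] unfolding R_def by blast
    qed
    have exp3_less: "exp3 k < 3" for k by (cases k) simp_all
    \<comment> \<open>A root of R gives the relation for some \<open>\<beta> * zp k\<close>, not yet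
      for the given \<beta>. Both lie in K(\<alpha>), hence so does \<open>zp k\<close>, and since
      \<zeta> is not in K(\<alpha>) only \<open>k = Z0\<close> remains.\<close>
    have resolvent': "\<exists>p q. \<alpha>\<^sup>2 * \<beta> = h p + h q * \<delta> \<and> \<alpha> * \<beta>\<^sup>2 = h p - h q * \<delta>"
      if red: "\<not> irreducible R" and adjoin_eq: "\<alpha> * \<beta> \<in> adjoin h {\<alpha>} \<and> adjoin h {\<alpha>} = adjoin h {\<beta>}"
    proof -
      obtain k p q where kpq: "\<alpha>\<^sup>2 * (\<beta> * zp k) = h p + h q * \<delta>" "\<alpha> * (\<beta> * zp k)\<^sup>2 = h p - h q * \<delta>"
        using resolvent[OF red] by blast
      have "(\<beta> * zp k) ^ 3 = \<beta> ^ 3" by (simp add: power_mult_distrib zp_cubed)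
      note adj = adjoin_eq_if_resolvent[OF kpq this]
      have "\<beta> * zp k \<in> adjoin h {\<alpha>}" "\<beta> \<in> adjoin h {\<alpha>}" using adj adjoin_eq adjoin_gen by blast+
      then have "\<beta> * zp k / \<beta> \<in> adjoin h {\<alpha>}" by (intro is_subfield_divide[OF is_subfield_adjoin])
      then have zp_k: "zp k \<in> adjoin h {\<alpha>}" using roots_neq_0 by simp
      have "k = Z0"
      proof (cases k)
        case Z1
        then show ?thesis using zp_k zeta_notin_adjoin_alpha by (simp add: zp_simps)
      next
        case Z2
        have "- 1 - \<zeta>\<^sup>2 \<in> adjoin h {\<alpha>}"
          using zp_k Z2 is_subfield_1[OF is_subfield_adjoin]
          by (auto simp: zp_simps intro!: is_subfield_diff[OF is_subfield_adjoin] is_subfield_minus[OF is_subfield_adjoin])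
        moreover have "\<zeta> = - 1 - \<zeta>\<^sup>2" using zeta_quadratic by algebra
        ultimately show ?thesis using zeta_notin_adjoin_alpha by simp
      qed
      then show ?thesis using kpq by (auto simp: zp_simps)
    qed
    show "(let K = adjoin h; c = \<alpha> * \<beta> in
         (\<not> (\<exists>d::'k. d ^ 3 = b) \<and> \<not> irreducible R \<longrightarrow>
            (\<exists>i<3. \<alpha> * (\<beta> * \<zeta> ^ i) \<in> K {\<alpha>} \<and> K {\<alpha>} = K {\<beta> * \<zeta> ^ i}) \<and>
            (\<alpha> * \<beta> \<in> K {\<alpha>} \<and> K {\<alpha>} = K {\<beta>} \<longrightarrow>
               card {E. strictly_intermediate h E} = 14 \<and>
               complete_table h
                [(2, [K {s}, K {\<zeta>}, K {t}], []),
                 (3, [], [K {c}, K {c * \<zeta>}, K {c * \<zeta>\<^sup>2}]),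
                 (4, [K {s, \<zeta>}], []),
                 (6, [K {\<zeta>, c}],
                     [K {\<alpha>}, K {\<alpha> * \<zeta>}, K {\<alpha> * \<zeta>\<^sup>2},
                      K {\<alpha> * \<zeta> + \<beta> * \<zeta>\<^sup>2}, K {\<alpha> + \<beta> * \<zeta>}, K {\<alpha> + \<beta> * \<zeta>\<^sup>2}])])) \<and>
         ((\<exists>d::'k. d ^ 3 = b) \<and> irreducible R \<longrightarrow>
            (\<exists>i<3. \<alpha> * (\<beta> * \<zeta> ^ i) \<in> range h) \<and>
            (\<alpha> * \<beta> \<in> range h \<longrightarrow>
               card {E. strictly_intermediate h E} = 14 \<and>
               complete_table h
                [(2, [K {s}, K {\<zeta>}, K {t}], []),
                 (3, [], [K {\<alpha> + \<beta>}, K {\<alpha> * \<zeta> + \<beta> * \<zeta>\<^sup>2}, K {\<alpha> * \<zeta>\<^sup>2 + \<beta> * \<zeta>}]),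
                 (4, [K {s, \<zeta>}], []),
                 (6, [K {t, \<alpha> + \<beta>}],
                     [K {\<alpha>}, K {\<alpha> * \<zeta>}, K {\<alpha> * \<zeta>\<^sup>2},
                      K {\<zeta>, \<alpha> + \<beta>}, K {\<zeta>, \<alpha> * \<zeta> + \<beta> * \<zeta>\<^sup>2}, K {\<zeta>, \<alpha> * \<zeta>\<^sup>2 + \<beta> * \<zeta>}])])) \<and>
         (\<not> (\<exists>d::'k. d ^ 3 = b) \<and> irreducible R \<longrightarrow>
            (let \<rho>\<^sub>0 = c * (\<alpha> + \<beta>);
                 \<rho>\<^sub>1 = c * (\<alpha> * \<zeta> + \<beta> * \<zeta>\<^sup>2);
                 \<rho>\<^sub>2 = c * (\<alpha> * \<zeta>\<^sup>2 + \<beta> * \<zeta>)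
             in
               card {E. strictly_intermediate h E} = 58 \<and>
               complete_table h
                [(2, [K {\<zeta>}, K {t}, K {s}], []),
                 (3, [], [K {c * \<zeta> ^ i}. i \<leftarrow> [0..<3]] @ [K {\<rho>}. \<rho> \<leftarrow> [\<rho>\<^sub>0, \<rho>\<^sub>1, \<rho>\<^sub>2]]),
                 (4, [K {s, \<zeta>}], []),
                 (6, [K {\<zeta>, c}, K {t, \<rho>\<^sub>0}],
                     [K {\<zeta>, \<rho>}. \<rho> \<leftarrow> [\<rho>\<^sub>0, \<rho>\<^sub>1, \<rho>\<^sub>2]] @
                     [K {t, c * \<zeta> ^ i}. i \<leftarrow> [0..<3]] @
                     [K {s, c * \<zeta> ^ i}. i \<leftarrow> [0..<3]] @
                     [K {s, \<rho>}. \<rho> \<leftarrow> [\<rho>\<^sub>0, \<rho>\<^sub>1, \<rho>\<^sub>2]] @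
                     [K {\<alpha> * \<zeta> ^ i}. i \<leftarrow> [0..<3]] @
                     [K {\<beta> * \<zeta> ^ i}. i \<leftarrow> [0..<3]]),
                 (9, [], [K {\<alpha> * \<zeta> ^ i + \<beta> * \<zeta> ^ j}. i \<leftarrow> [0..<3], j \<leftarrow> [0..<3]]),
                 (12, [K {s, \<zeta>, c}, K {s, \<zeta>, \<rho>\<^sub>0}], [K {\<zeta>, \<alpha>}, K {\<zeta>, \<beta>}]),
                 (18, [],
                     [K {\<alpha> * \<zeta> ^ i, \<beta> * \<zeta> ^ j}. i \<leftarrow> [0..<3], j \<leftarrow> [0..<3]] @
                     [K {\<zeta>, \<alpha> + \<beta> * \<zeta> ^ i}. i \<leftarrow> [0..<3]] @
                     [K {\<zeta> ^ i * (\<zeta> - 1) * (\<alpha> - \<beta>)}. i \<leftarrow> [0..<3]])])))"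
      unfolding Let_def
    proof (intro conjI impI, goal_cases)
      case 1
      then obtain k p q where kpq: "\<alpha>\<^sup>2 * (\<beta> * zp k) = h p + h q * \<delta>" "\<alpha> * (\<beta> * zp k)\<^sup>2 = h p - h q * \<delta>"
        using resolvent by blast
      have "(\<beta> * zp k) ^ 3 = \<beta> ^ 3" by (simp add: power_mult_distrib zp_cubed)
      from adjoin_eq_if_resolvent[OF kpq this] show ?case
        using exp3_less unfolding zp_def by blast
    next
      case 2
      then obtain p q where "\<alpha>\<^sup>2 * \<beta> = h p + h q * \<delta>" "\<alpha> * \<beta>\<^sup>2 = h p - h q * \<delta>" using resolvent' by blast
      from complete_table_A(2)[OF this st] show ?case unfolding card_table_gens .
    next
      case 3
      then obtain p q where "\<alpha>\<^sup>2 * \<beta> = h p + h q * \<delta>" "\<alpha> * \<beta>\<^sup>2 = h p - h q * \<delta>" using resolvent' by blast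
      from complete_table_A(1)[OF this st] show ?case unfolding table_A_fields .
    next
      case 4
      \<comment> \<open>Here \<alpha>\<beta> and \<open>h d\<close> are cube roots of the same
        element; the root of unity between them is moved into \<beta>.\<close>
      then obtain d where "d ^ 3 = b" by blast
      then have "(\<alpha> * \<beta>) ^ 3 = h d ^ 3"
        by (simp add: power_mult_distrib cubes_prod flip: field_embedding_power[OF embedding])
      then have "h d ^ 3 = (\<alpha> * \<beta>) ^ 3" by simp
      then obtain k where "h d = zp k * (\<alpha> * \<beta>)" by (rule cube_eqE)
      then have "\<alpha> * (\<beta> * zp k) = h d" by (simp add: mult_ac)
      then have "\<alpha> * (\<beta> * zp k) \<in> range h" by (simp only: rangeI)
      then show ?case using exp3_less unfolding zp_def by blast
    next
      case 5
      then obtain c where "\<alpha> * \<beta> = h c" by blast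
      from complete_table_B(2)[OF this st] show ?case unfolding card_table_gens .
    next
      case 6
      then obtain c where "\<alpha> * \<beta> = h c" by blast
      from complete_table_B(1)[OF this st] show ?case unfolding table_B_fields .
    next
      case 7
      then have notin: "\<alpha> * \<beta> \<notin> L" "\<alpha>\<^sup>2 * \<beta> \<notin> L"
        using prod_notin_L alpha_sq_beta_notin_L irreducible_no_root[of R] by (auto simp: R_def)
      from complete_table_C(2)[OF notin st] show ?case unfolding card_table_gens .
    next
      case 8
      then have notin: "\<alpha> * \<beta> \<notin> L" "\<alpha>\<^sup>2 * \<beta> \<notin> L"
        using prod_notin_L alpha_sq_beta_notin_L irreducible_no_root[of R] by (auto simp: R_def)
      from complete_table_C(1)[OF notin st] show ?case unfolding table_C_fields Let_def .
    qed
  qed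
qed

end
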